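(* Let $G$ be a triangle-divisible tripartite graph with vertex classes $X,Y,Z$, each of size $n$. If $$\widehat{\delta}(G)\geq \frac{4n}{5},$$ then $G$ has a fractional triangle decomposition.
   Context: Graphs are finite and simple. $G$ is tripartite with vertex classes $X,Y,Z$ if its vertex set is the disjoint union of $X,Y,Z$ and every edge joins two different classes. For a vertex $v$ and a class $W$, $d_G(v,W)$ is the number of neighbours of $v$ in $W$. The partite minimum degree is $\widehat{\delta}(G)=\min\{d_G(v,W): U,W\in\{X,Y,Z\},\ U\neq W,\ v\in U\}$. $G$ is triangle-divisible if $d_G(x,Y)=d_G(x,Z)$ for all $x\in X$, $d_G(y,X)=d_G(y,Z)$ for all $y\in Y$, and $d_G(z,X)=d_G(z,Y)$ for all $z\in Z$. Let $\mathcal T(G)$ be the set of triangles of $G$. A fractional triangle decomposition of $G$ is a family of real numbers $(w_T)_{T\in\mathcal T(G)}$ with $w_T\ge 0$ and $\sum_{T\in\mathcal T(G),\, e\in E(T)} w_T=1$ for every edge $e\in E(G)$. *)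

theory Defs
  imports Complex_Main
begin

definition simple_graph :: "'a set \<Rightarrow> 'a set set \<Rightarrow> bool" where
  "simple_graph V E \<longleftrightarrow> finite V \<and> (\<forall>e\<in>E. e \<subseteq> V \<and> card e = 2)"

definition tripartite :: "'a set \<Rightarrow> 'a set set \<Rightarrow> 'a set \<Rightarrow> 'a set \<Rightarrow> 'a set \<Rightarrow> bool" where
  "tripartite V E X Y Z \<longleftrightarrow>
     V = X \<union> Y \<union> Z \<and> X \<inter> Y = {} \<and> X \<inter> Z = {} \<and> Y \<inter> Z = {} \<and>
     (\<forall>e\<in>E. \<exists>U\<in>{X, Y, Z}. \<exists>W\<in>{X, Y, Z}. U \<noteq> W \<and> (\<exists>u\<in>U. \<exists>w\<in>W. e = {u, w}))"

definition degree_in :: "'a set set \<Rightarrow> 'a \<Rightarrow> 'a set \<Rightarrow> nat" where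
  "degree_in E v W = card {w\<in>W. {v, w} \<in> E}"

text \<open>If all three classes are empty, this is the minimum of the empty set, an unspecified
  natural number.\<close>

definition partite_min_degree :: "'a set set \<Rightarrow> 'a set \<Rightarrow> 'a set \<Rightarrow> 'a set \<Rightarrow> nat" where
  "partite_min_degree E X Y Z =
     Min {degree_in E v W | U W v. U \<in> {X, Y, Z} \<and> W \<in> {X, Y, Z} \<and> U \<noteq> W \<and> v \<in> U}"

definition triangle_divisible :: "'a set set \<Rightarrow> 'a set \<Rightarrow> 'a set \<Rightarrow> 'a set \<Rightarrow> bool" where
  "triangle_divisible E X Y Z \<longleftrightarrow>
     (\<forall>x\<in>X. degree_in E x Y = degree_in E x Z) \<and>
     (\<forall>y\<in>Y. degree_in E y X = degree_in E y Z) \<and>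
     (\<forall>z\<in>Z. degree_in E z X = degree_in E z Y)"

text \<open>A triangle is represented by its set of three vertices.\<close>

definition triangle_edges :: "'a set \<Rightarrow> 'a set set" where
  "triangle_edges T = {e. e \<subseteq> T \<and> card e = 2}"

definition triangles :: "'a set \<Rightarrow> 'a set set \<Rightarrow> 'a set set" where
  "triangles V E = {T. T \<subseteq> V \<and> card T = 3 \<and> triangle_edges T \<subseteq> E}"

definition fractional_triangle_decomposition ::
    "'a set \<Rightarrow> 'a set set \<Rightarrow> ('a set \<Rightarrow> real) \<Rightarrow> bool" where
  "fractional_triangle_decomposition V E w \<longleftrightarrow>
     (\<forall>T\<in>triangles V E. w T \<ge> 0) \<and>
     (\<forall>e\<in>E. (\<Sum>T\<in>{T \<in> triangles V E. e \<in> triangle_edges T}. w T) = 1)"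

end

theory Submission
  imports Defs
begin

text \<open>
Write \<open>d v\<close> for the degree of \<open>v\<close> into either of the other two classes, \<open>s v = d v / n - 4/5\<close>, which lies in
\<open>[0, 1/5]\<close>, and \<open>m v = 1 / (1 - s v)\<close>. We look for weights of the form
\<open>w T = (\<Prod>v\<in>T. m v) * (\<Sum>e\<in>T. \<theta> e)\<close> with \<open>\<theta> \<ge> 0\<close>. The requirement that every edge has load 1 is a positive
semidefinite linear system for \<open>\<theta>\<close>; adding \<open>\<delta> * m u * m v * \<theta> {u, v}\<close> to the load of \<open>{u, v}\<close> makes it
positive definite, so there is a unique solution \<open>\<theta>\<close> for each \<open>\<delta> > 0\<close>, continuous in \<open>\<delta>\<close>. Divisibility
implies that \<open>\<Theta> v = (\<Sum>u\<in>W. m u * \<theta> {v, u})\<close> is the same for both classes \<open>W\<close> not containing \<open>v\<close>.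

As long as \<open>\<Theta> v \<le> 1/2 - s v\<close> for all \<open>v\<close>, looking at the edge where \<open>\<theta>\<close> is smallest shows \<open>\<theta> \<ge> 0\<close>. The
bound on \<open>\<Theta>\<close> holds strictly for large \<open>\<delta>\<close>, and as \<open>\<delta>\<close> decreases it can never become an equality: at a
vertex \<open>x\<close> with \<open>\<Theta> x = 1/2 - s x\<close> the load equations of the edges at \<open>x\<close> bound the total of \<open>\<theta>\<close> between
the two classes not containing \<open>x\<close> from above, whereas the variational characterisation of \<open>\<theta>\<close>, applied to the
trial potential \<open>1/3 - (s u + s v) / 2 + 4/5 * (s u * s v)\<close>, bounds it from below by something larger. So
\<open>\<theta>\<close> is nonnegative and bounded for all \<open>\<delta> > 0\<close>, and a limit point for \<open>\<delta> \<rightarrow> 0\<close> gives the decomposition.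
\<close>

section \<open>Regularised linear systems\<close>

text \<open>Gaussian elimination by induction on the index set: eliminating the pivot
  \<open>k\<close> leaves the Schur complement \<open>A'\<close>, which is again symmetric and
  positive definite, and back substitution recovers the coordinate \<open>k\<close>.\<close>

lemma positive_definite_solvable:
  fixes A :: "'b \<Rightarrow> 'b \<Rightarrow> real"
  assumes "finite I" and "\<And>i j. A i j = A j i"
    and "\<And>v. \<exists>i\<in>I. v i \<noteq> 0 \<Longrightarrow> 0 < (\<Sum>i\<in>I. \<Sum>j\<in>I. A i j * (v i * v j))"
  shows "\<exists>v. \<forall>i\<in>I. (\<Sum>j\<in>I. A i j * v j) = b i"
  using assms
proof (induction I arbitrary: A b rule: finite_induct)
  case empty
  then show ?case by simp
next
  case (insert k I)
  note sym = insert.prems(1) and pd = insert.prems(2)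
  define S where "S v = (\<Sum>j\<in>I. A k j * v j)" for v
  have split: "(\<Sum>i\<in>insert k I. \<Sum>j\<in>insert k I. A i j * (v i * v j))
    = A k k * (v k)\<^sup>2 + 2 * v k * S v + (\<Sum>i\<in>I. \<Sum>j\<in>I. A i j * (v i * v j))" for v
  proof -
    have "(\<Sum>i\<in>I. A i k * (v i * v k)) = v k * S v"
      unfolding S_def sum_distrib_left by (intro sum.cong refl) (simp add: sym[of _ k])
    moreover have "(\<Sum>j\<in>I. A k j * (v k * v j)) = v k * S v"
      unfolding S_def sum_distrib_left by (intro sum.cong refl) simp
    ultimately show ?thesis
      using insert.hyps by (simp add: sum.distrib power2_eq_square)
  qed
  have "0 < A k k"
  proof -
    have "S (\<lambda>i. if i = k then 1 else 0) = 0" "(\<Sum>i\<in>I. \<Sum>j\<in>I. A i j * ((if i = k then 1 else 0) * (if j = k then 1 else 0))) = 0"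
      using insert.hyps unfolding S_def by (auto intro!: sum.neutral)
    then show ?thesis
      using pd[of "\<lambda>i. if i = k then 1 else 0"] split[of "\<lambda>i. if i = k then 1 else 0"] by simp
  qed
  define A' where "A' i j = A i j - A i k * A k j / A k k" for i j
  have Sc: "S (v(k := c)) = S v" for v c
    unfolding S_def using insert.hyps by (intro sum.cong) auto
  have "\<exists>v. \<forall>i\<in>I. (\<Sum>j\<in>I. A' i j * v j) = b i - A i k * b k / A k k"
  proof (rule insert.IH)
    show "A' i j = A' j i" for i j
      using sym[of i j] sym[of i k] sym[of k j] by (simp add: A'_def)
    fix v :: "'b \<Rightarrow> real" assume nz: "\<exists>i\<in>I. v i \<noteq> 0"
    \<comment> \<open>This value minimises the form of \<open>A\<close> in the coordinate
      \<open>k\<close> when the others are given by \<open>v\<close>; the minimum is exactly the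
      form of \<open>A'\<close> at \<open>v\<close>, hence positive.\<close>
    define c where "c = - S v / A k k"
    have "0 < (\<Sum>i\<in>insert k I. \<Sum>j\<in>insert k I. A i j * ((v(k := c)) i * (v(k := c)) j))"
      using nz insert.hyps by (intro pd) auto
    also have "\<dots> = A k k * c\<^sup>2 + 2 * c * S v + (\<Sum>i\<in>I. \<Sum>j\<in>I. A i j * ((v(k := c)) i * (v(k := c)) j))"
      unfolding split Sc by simp
    also have "(\<Sum>i\<in>I. \<Sum>j\<in>I. A i j * ((v(k := c)) i * (v(k := c)) j)) = (\<Sum>i\<in>I. \<Sum>j\<in>I. A i j * (v i * v j))"
      using insert.hyps by (intro sum.cong) auto
    also have "A k k * c\<^sup>2 + 2 * c * S v = - (S v * S v / A k k)"
      using \<open>0 < A k k\<close> by (simp add: c_def field_simps power2_eq_square)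
    also have "S v * S v / A k k = (\<Sum>i\<in>I. \<Sum>j\<in>I. A i k * A k j / A k k * (v i * v j))"
    proof -
      have "S v = (\<Sum>i\<in>I. A i k * v i)" unfolding S_def by (intro sum.cong refl) (simp add: sym[of _ k])
      then have "S v * S v = (\<Sum>i\<in>I. A i k * v i) * (\<Sum>j\<in>I. A k j * v j)" by (simp add: S_def)
      then show ?thesis by (simp add: sum_product sum_divide_distrib mult_ac)
    qed
    finally show "0 < (\<Sum>i\<in>I. \<Sum>j\<in>I. A' i j * (v i * v j))"
      by (simp add: A'_def left_diff_distrib sum_subtractf)
  qed
  then obtain v where v: "\<And>i. i \<in> I \<Longrightarrow> (\<Sum>j\<in>I. A' i j * v j) = b i - A i k * b k / A k k" by blast
  define v' where "v' = v(k := (b k - S v) / A k k)"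
  have sum_I: "(\<Sum>j\<in>I. A i j * v' j) = (\<Sum>j\<in>I. A i j * v j)" for i
    unfolding v'_def using insert.hyps by (intro sum.cong) auto
  have "(\<Sum>j\<in>insert k I. A i j * v' j) = b i" if "i \<in> insert k I" for i
  proof (cases "i = k")
    case True
    then show ?thesis
      using insert.hyps \<open>0 < A k k\<close> by (simp add: sum_I S_def[symmetric]) (simp add: v'_def)
  next
    case False
    have "(\<Sum>j\<in>I. A' i j * v j) = (\<Sum>j\<in>I. A i j * v j) - A i k * S v / A k k"
      by (simp add: A'_def S_def left_diff_distrib sum_subtractf sum_distrib_left sum_divide_distrib mult.assoc)
    then have "(\<Sum>j\<in>I. A i j * v j) - A i k * S v / A k k = b i - A i k * b k / A k k"
      using that False v[of i] by simp
    then show ?thesis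
      using insert.hyps by (simp add: sum_I) (simp add: v'_def right_diff_distrib diff_divide_distrib)
  qed
  then show ?case by blast
qed

text \<open>Bolzano-Weierstrass one coordinate at a time: each new index passes to a further
  subsequence on which its coordinate is monotone and bounded, and this keeps the limits found
  before.\<close>

lemma convergent_subsequence_finite:
  fixes f :: "nat \<Rightarrow> 'b \<Rightarrow> real"
  assumes "finite I" and "\<And>k i. i \<in> I \<Longrightarrow> \<bar>f k i\<bar> \<le> B"
  shows "\<exists>r l. strict_mono (r :: nat \<Rightarrow> nat) \<and> (\<forall>i\<in>I. (\<lambda>k. f (r k) i) \<longlonglongrightarrow> l i)"
  using assms
proof (induction I rule: finite_induct)
  case empty
  have "strict_mono (\<lambda>k::nat. k)" by (simp add: strict_mono_def)
  then show ?case by blast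
next
  case (insert i I)
  then obtain r l where r: "strict_mono r" and l: "\<forall>j\<in>I. (\<lambda>k. f (r k) j) \<longlonglongrightarrow> l j" by blast
  obtain r' where r': "strict_mono r'" "monoseq (\<lambda>k. f (r (r' k)) i)"
    using seq_monosub[of "\<lambda>k. f (r k) i"] by blast
  have "Bseq (\<lambda>k. f (r (r' k)) i)" using insert.prems by (intro BseqI'[of _ B]) simp
  then obtain m where m: "(\<lambda>k. f (r (r' k)) i) \<longlonglongrightarrow> m"
    using Bseq_monoseq_convergent[OF _ r'(2)] by (auto simp: convergent_def)
  have "(\<lambda>k. f (r (r' k)) j) \<longlonglongrightarrow> l j" if "j \<in> I" for j
    using LIMSEQ_subseq_LIMSEQ[OF l[rule_format, OF that] r'(1)] by (simp add: o_def)
  with m insert.hyps have "\<forall>j\<in>insert i I. (\<lambda>k. f (r (r' k)) j) \<longlonglongrightarrow> (l(i := m)) j" by auto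
  moreover have "strict_mono (\<lambda>k. r (r' k))" using r r'(1) by (simp add: strict_mono_def)
  ultimately show ?case by (intro exI conjI)
qed

section \<open>The regularised system and its dependence on the parameter\<close>

text \<open>In the application \<open>I\<close> is the edge set, \<open>A\<close> maps potentials to
  edge loads and \<open>c\<close> weights the regularising term. \<open>A\<close> is only
  semidefinite; the added diagonal \<open>\<delta> * c\<close> makes the system uniquely
  solvable.\<close>

locale regularised_system =
  fixes I :: "'b set" and A :: "'b \<Rightarrow> 'b \<Rightarrow> real" and c :: "'b \<Rightarrow> real"
  assumes fin: "finite I" and sym: "A i j = A j i"
    and psd: "0 \<le> (\<Sum>i\<in>I. \<Sum>j\<in>I. A i j * (v i * v j))"
    and c_pos: "0 < c i"
begin

lemma solution_exists:
  assumes "0 < \<delta>"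
  shows "\<exists>v. \<forall>i\<in>I. (\<Sum>j\<in>I. A i j * v j) + \<delta> * c i * v i = 1"
proof -
  define B where "B i j = A i j + (if i = j then \<delta> * c i else 0)" for i j
  have B: "(\<Sum>j\<in>I. B i j * v j) = (\<Sum>j\<in>I. A i j * v j) + \<delta> * c i * v i" if "i \<in> I" for i v
  proof -
    have "B i j * v j = A i j * v j + (if i = j then \<delta> * c i * v i else 0)" for j
      by (simp add: B_def distrib_right)
    then show ?thesis using that fin by (simp add: sum.distrib)
  qed
  have "\<exists>v. \<forall>i\<in>I. (\<Sum>j\<in>I. B i j * v j) = 1"
  proof (rule positive_definite_solvable[OF fin])
    show "B i j = B j i" for i j by (simp add: B_def sym)
    fix v :: "'b \<Rightarrow> real" assume "\<exists>i\<in>I. v i \<noteq> 0"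
    then obtain k where k: "k \<in> I" "v k \<noteq> 0" by blast
    have "(\<Sum>i\<in>I. \<Sum>j\<in>I. B i j * (v i * v j)) = (\<Sum>i\<in>I. v i * (\<Sum>j\<in>I. B i j * v j))"
      by (simp add: sum_distrib_left mult_ac)
    also have "\<dots> = (\<Sum>i\<in>I. v i * ((\<Sum>j\<in>I. A i j * v j) + \<delta> * c i * v i))"
      by (intro sum.cong refl) (simp add: B)
    also have "\<dots> = (\<Sum>i\<in>I. \<Sum>j\<in>I. A i j * (v i * v j)) + (\<Sum>i\<in>I. \<delta> * c i * (v i)\<^sup>2)"
      by (simp add: distrib_left sum.distrib sum_distrib_left power2_eq_square mult_ac)
    finally have eq: "(\<Sum>i\<in>I. \<Sum>j\<in>I. B i j * (v i * v j))
      = (\<Sum>i\<in>I. \<Sum>j\<in>I. A i j * (v i * v j)) + (\<Sum>i\<in>I. \<delta> * c i * (v i)\<^sup>2)" .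
    have "0 < (\<Sum>i\<in>I. \<delta> * c i * (v i)\<^sup>2)"
      using fin k assms c_pos by (intro sum_pos2[of I k]) (auto simp: less_imp_le)
    then show "0 < (\<Sum>i\<in>I. \<Sum>j\<in>I. B i j * (v i * v j))"
      unfolding eq using psd[of v] by linarith
  qed
  then show ?thesis using B by auto
qed

definition sol :: "real \<Rightarrow> 'b \<Rightarrow> real" where
  "sol \<delta> = (SOME v. \<forall>i\<in>I. (\<Sum>j\<in>I. A i j * v j) + \<delta> * c i * v i = 1)"

lemma sol_eq: "0 < \<delta> \<Longrightarrow> i \<in> I \<Longrightarrow> (\<Sum>j\<in>I. A i j * sol \<delta> j) + \<delta> * c i * sol \<delta> i = 1"
  using someI_ex[OF solution_exists] unfolding sol_def by blast

text \<open>The system is tested against \<open>v\<close> itself and the nonnegative form of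
  \<open>A\<close> is dropped; Young's inequality then absorbs half of the weighted square norm. A
  general right-hand side \<open>f\<close> covers both the size of a solution and the difference of
  two solutions.\<close>

lemma weighted_energy_le:
  assumes \<delta>: "0 < \<delta>" and eq: "\<And>i. i \<in> I \<Longrightarrow> (\<Sum>j\<in>I. A i j * v j) + \<delta> * c i * v i = f i"
    and i: "i \<in> I"
  shows "\<delta>\<^sup>2 * c i * (v i)\<^sup>2 \<le> (\<Sum>j\<in>I. (f j)\<^sup>2 / c j)"
proof -
  have "(\<Sum>i\<in>I. \<delta> * c i * (v i)\<^sup>2) \<le> (\<Sum>i\<in>I. \<Sum>j\<in>I. A i j * (v i * v j)) + (\<Sum>i\<in>I. \<delta> * c i * (v i)\<^sup>2)"
    using psd[of v] by simp
  also have "\<dots> = (\<Sum>i\<in>I. v i * ((\<Sum>j\<in>I. A i j * v j) + \<delta> * c i * v i))"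
    by (simp add: distrib_left sum.distrib sum_distrib_left power2_eq_square mult_ac)
  also have "\<dots> = (\<Sum>i\<in>I. v i * f i)" by (intro sum.cong refl) (simp add: eq)
  also have "\<dots> \<le> (\<Sum>i\<in>I. \<delta> * c i * (v i)\<^sup>2 / 2 + (f i)\<^sup>2 / c i / (2 * \<delta>))"
  proof (intro sum_mono)
    fix i
    have "0 \<le> (\<delta> * c i * v i - f i)\<^sup>2 / (2 * \<delta> * c i)" using \<delta> c_pos[of i] by simp
    also have "\<dots> = \<delta> * c i * (v i)\<^sup>2 / 2 + (f i)\<^sup>2 / c i / (2 * \<delta>) - v i * f i"
      using \<delta> c_pos[of i] by (simp add: field_simps power2_eq_square)
    finally show "v i * f i \<le> \<delta> * c i * (v i)\<^sup>2 / 2 + (f i)\<^sup>2 / c i / (2 * \<delta>)" by simp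
  qed
  also have "\<dots> = (\<Sum>i\<in>I. \<delta> * c i * (v i)\<^sup>2) / 2 + (\<Sum>i\<in>I. (f i)\<^sup>2 / c i) / (2 * \<delta>)"
    by (simp add: sum.distrib sum_divide_distrib)
  finally have "\<delta> * (\<Sum>i\<in>I. \<delta> * c i * (v i)\<^sup>2) \<le> (\<Sum>i\<in>I. (f i)\<^sup>2 / c i)"
    using \<delta> by (simp add: field_simps)
  moreover have "\<delta> * c i * (v i)\<^sup>2 \<le> (\<Sum>i\<in>I. \<delta> * c i * (v i)\<^sup>2)"
    using fin i \<delta> c_pos by (intro member_le_sum) (auto simp: less_imp_le)
  then have "\<delta> * (\<delta> * c i * (v i)\<^sup>2) \<le> \<delta> * (\<Sum>i\<in>I. \<delta> * c i * (v i)\<^sup>2)"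
    using \<delta> by simp
  ultimately show ?thesis by (simp add: power2_eq_square mult_ac)
qed

lemma sol_sq_le:
  assumes "0 < \<delta>" "i \<in> I"
  shows "(sol \<delta> i)\<^sup>2 \<le> (\<Sum>j\<in>I. 1 / c j) / (\<delta>\<^sup>2 * c i)"
  using weighted_energy_le[OF assms(1) sol_eq[OF assms(1)] assms(2)] assms c_pos[of i]
  by (simp add: field_simps)

text \<open>The difference of the two solutions solves the system for \<open>\<delta>\<close> with
  right-hand side \<open>(\<delta>0 - \<delta>) * c j * sol \<delta>0 j\<close>, so the energy
  estimate applies to it.\<close>

lemma sol_diff_sq_le:
  assumes "0 < \<delta>" "0 < \<delta>0" "i \<in> I"
  shows "(sol \<delta> i - sol \<delta>0 i)\<^sup>2 \<le> ((\<delta> - \<delta>0) / \<delta>)\<^sup>2 * ((\<Sum>j\<in>I. c j * (sol \<delta>0 j)\<^sup>2) / c i)"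
proof -
  define f where "f j = (\<delta>0 - \<delta>) * c j * sol \<delta>0 j" for j
  have "\<delta>\<^sup>2 * c i * (sol \<delta> i - sol \<delta>0 i)\<^sup>2 \<le> (\<Sum>j\<in>I. (f j)\<^sup>2 / c j)"
  proof (rule weighted_energy_le[OF assms(1) _ assms(3)])
    fix i assume "i \<in> I"
    then show "(\<Sum>j\<in>I. A i j * (sol \<delta> j - sol \<delta>0 j)) + \<delta> * c i * (sol \<delta> i - sol \<delta>0 i) = f i"
      using sol_eq[OF assms(1), of i] sol_eq[OF assms(2), of i]
      by (simp add: f_def right_diff_distrib sum_subtractf algebra_simps)
  qed
  also have "(\<Sum>j\<in>I. (f j)\<^sup>2 / c j) = (\<delta> - \<delta>0)\<^sup>2 * (\<Sum>j\<in>I. c j * (sol \<delta>0 j)\<^sup>2)"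
    unfolding sum_distrib_left
  proof (intro sum.cong refl)
    fix j show "(f j)\<^sup>2 / c j = (\<delta> - \<delta>0)\<^sup>2 * (c j * (sol \<delta>0 j)\<^sup>2)"
      using c_pos[of j] by (simp add: f_def power_mult_distrib power2_commute) (simp add: power2_eq_square)
  qed
  finally show ?thesis using assms c_pos[of i] by (simp add: field_simps)
qed

lemma sol_continuous:
  assumes "i \<in> I"
  shows "continuous_on {0<..} (\<lambda>\<delta>. sol \<delta> i)"
proof (intro continuous_at_imp_continuous_on ballI)
  fix \<delta>0 :: real assume "\<delta>0 \<in> {0<..}"
  then have d0: "0 < \<delta>0" by simp
  define K where "K = (\<Sum>j\<in>I. c j * (sol \<delta>0 j)\<^sup>2) / c i"
  have K: "0 \<le> K" unfolding K_def using c_pos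
    by (intro divide_nonneg_pos sum_nonneg mult_nonneg_nonneg) (auto simp: less_imp_le)
  have "((\<lambda>\<delta>. sol \<delta> i - sol \<delta>0 i) \<longlongrightarrow> 0) (at \<delta>0)"
  proof (rule tendsto_0_le)
    have "\<forall>\<^sub>F \<delta> in at \<delta>0. 0 < \<delta>"
      using d0 by (rule order_tendstoD(1)[OF tendsto_ident_at])
    then show "\<forall>\<^sub>F \<delta> in at \<delta>0. norm (sol \<delta> i - sol \<delta>0 i) \<le> norm (\<bar>\<delta> - \<delta>0\<bar> / \<delta>) * sqrt K"
    proof eventually_elim
      case (elim \<delta>)
      have "(sol \<delta> i - sol \<delta>0 i)\<^sup>2 \<le> (\<bar>\<delta> - \<delta>0\<bar> / \<delta> * sqrt K)\<^sup>2"
      proof -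
        have "(\<bar>\<delta> - \<delta>0\<bar> / \<delta> * sqrt K)\<^sup>2 = ((\<delta> - \<delta>0) / \<delta>)\<^sup>2 * K"
          using K by (simp add: power_mult_distrib power_divide)
        then show ?thesis using sol_diff_sq_le[OF elim d0 assms] by (simp only: K_def)
      qed
      then have "\<bar>sol \<delta> i - sol \<delta>0 i\<bar> \<le> \<bar>\<bar>\<delta> - \<delta>0\<bar> / \<delta> * sqrt K\<bar>"
        by (simp only: abs_le_square_iff)
      then show ?case using K by (simp add: abs_mult)
    qed
    have "((\<lambda>\<delta>. \<bar>\<delta> - \<delta>0\<bar> / \<delta>) \<longlongrightarrow> \<bar>\<delta>0 - \<delta>0\<bar> / \<delta>0) (at \<delta>0)"
      using d0 by (intro tendsto_intros) auto
    then show "((\<lambda>\<delta>. \<bar>\<delta> - \<delta>0\<bar> / \<delta>) \<longlongrightarrow> 0) (at \<delta>0)" by simp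
  qed
  then show "isCont (\<lambda>\<delta>. sol \<delta> i) \<delta>0"
    unfolding isCont_def by (rule LIM_zero_cancel)
qed

lemma sol_tendsto_0:
  assumes "i \<in> I"
  shows "((\<lambda>\<delta>. sol \<delta> i) \<longlongrightarrow> 0) at_top"
proof (rule tendsto_0_le)
  define K where "K = (\<Sum>j\<in>I. 1 / c j) / c i"
  have K: "0 \<le> K" unfolding K_def using c_pos
    by (intro divide_nonneg_pos sum_nonneg) (auto simp: less_imp_le)
  show "\<forall>\<^sub>F \<delta> in at_top. norm (sol \<delta> i) \<le> norm (inverse \<delta>) * sqrt K"
    using eventually_gt_at_top[of 0]
  proof eventually_elim
    case (elim \<delta>)
    have "(sol \<delta> i)\<^sup>2 \<le> K / \<delta>\<^sup>2"
      using sol_sq_le[OF elim assms] by (simp only: K_def divide_divide_eq_left mult.commute[of "c i"])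
    also have "\<dots> = (inverse \<delta> * sqrt K)\<^sup>2"
      using K by (simp add: power_mult_distrib power_inverse divide_inverse mult.commute)
    finally have "\<bar>sol \<delta> i\<bar> \<le> \<bar>inverse \<delta> * sqrt K\<bar>" by (simp only: abs_le_square_iff)
    then show ?case using K by (simp add: abs_mult)
  qed
  show "((\<lambda>\<delta>::real. inverse \<delta>) \<longlongrightarrow> 0) at_top"
    by (rule tendsto_inverse_0_at_top) (rule filterlim_ident)
qed

text \<open>A bound independent of \<open>\<delta>\<close> gives a convergent subsequence along
  \<open>1 / (k + 1)\<close>; the regularising term vanishes in the limit.\<close>

lemma nonneg_solution_limit:
  assumes "\<And>\<delta> i. 0 < \<delta> \<Longrightarrow> i \<in> I \<Longrightarrow> 0 \<le> sol \<delta> i \<and> sol \<delta> i \<le> B"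
  shows "\<exists>v. (\<forall>i\<in>I. 0 \<le> v i) \<and> (\<forall>i\<in>I. (\<Sum>j\<in>I. A i j * v j) = 1)"
proof -
  define d :: "nat \<Rightarrow> real" where "d k = inverse (real (Suc k))" for k
  have d: "0 < d k" for k by (simp add: d_def)
  have "\<bar>sol (d k) i\<bar> \<le> B" if "i \<in> I" for k i using assms[OF d[of k] that] by simp
  then have "\<exists>r v. strict_mono (r :: nat \<Rightarrow> nat) \<and> (\<forall>i\<in>I. (\<lambda>k. sol (d (r k)) i) \<longlonglongrightarrow> v i)"
    by (intro convergent_subsequence_finite[OF fin, of "\<lambda>k. sol (d k)" B])
  then obtain r v where r: "strict_mono r" and v: "\<And>i. i \<in> I \<Longrightarrow> (\<lambda>k. sol (d (r k)) i) \<longlonglongrightarrow> v i"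
    by blast
  have "d \<longlonglongrightarrow> 0" unfolding d_def by (rule LIMSEQ_inverse_real_of_nat)
  then have dr: "(\<lambda>k. d (r k)) \<longlonglongrightarrow> 0" using LIMSEQ_subseq_LIMSEQ[of d 0 r, OF _ r] by (simp add: o_def)
  have "0 \<le> v i" if "i \<in> I" for i
  proof (rule LIMSEQ_le_const[OF v[OF that]])
    have "0 \<le> sol (d (r k)) i" for k using assms[OF d[of "r k"] that] by simp
    then show "\<exists>N. \<forall>k\<ge>N. 0 \<le> sol (d (r k)) i" by blast
  qed
  moreover have "(\<Sum>j\<in>I. A i j * v j) = 1" if "i \<in> I" for i
  proof -
    have "(\<lambda>k. (\<Sum>j\<in>I. A i j * sol (d (r k)) j) + d (r k) * c i * sol (d (r k)) i)
      \<longlonglongrightarrow> (\<Sum>j\<in>I. A i j * v j) + 0 * c i * v i"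
      by (intro tendsto_add tendsto_sum tendsto_mult tendsto_const dr v that)
    then have "(\<lambda>k. 1) \<longlonglongrightarrow> (\<Sum>j\<in>I. A i j * v j)"
      by (simp add: sol_eq[OF d that])
    then show ?thesis by (simp add: LIMSEQ_const_iff)
  qed
  ultimately show ?thesis by blast
qed

end

text \<open>The intermediate value theorem for the minimum of the finitely many functions: at a zero
  of the minimum all of them are nonnegative and one vanishes.\<close>

lemma first_contact:
  fixes F :: "'a \<Rightarrow> real \<Rightarrow> real"
  assumes "finite V" "a \<le> b" and cont: "\<And>v. v \<in> V \<Longrightarrow> continuous_on {a..b} (F v)"
    and b: "\<And>v. v \<in> V \<Longrightarrow> 0 < F v b" and a: "v0 \<in> V" "F v0 a \<le> 0"
  shows "\<exists>t\<in>{a..b}. (\<forall>v\<in>V. 0 \<le> F v t) \<and> (\<exists>v\<in>V. F v t = 0)"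
proof -
  define G where "G t = Min ((\<lambda>v. F v t) ` V)" for t
  have ne: "V \<noteq> {}" using a by blast
  have "continuous_on {a..b} (\<lambda>t. Min ((\<lambda>v. F v t) ` V))"
    using assms(1) ne cont
  proof (induction V rule: finite_ne_induct)
    case (singleton x)
    then show ?case by simp
  next
    case (insert x V)
    then have "continuous_on {a..b} (\<lambda>t. min (F x t) (Min ((\<lambda>v. F v t) ` V)))"
      by (intro continuous_on_min) auto
    then show ?case using insert.hyps by simp
  qed
  then have "continuous_on {a..b} G" by (simp add: G_def[abs_def])
  moreover have "G a \<le> 0" unfolding G_def using assms(1) a by (meson Min_le finite_imageI imageI order_trans)
  moreover have "0 \<le> G b" unfolding G_def using assms(1) ne b by (auto simp: less_imp_le)
  ultimately obtain t where t: "a \<le> t" "t \<le> b" "G t = 0"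
    using IVT'[of G a 0 b] assms(2) by blast
  have "\<forall>v\<in>V. 0 \<le> F v t" using t(3) assms(1) unfolding G_def by (metis Min_le finite_imageI imageI)
  moreover have "\<exists>v\<in>V. F v t = 0"
    using Min_in[of "(\<lambda>v. F v t) ` V"] assms(1) ne t(3) unfolding G_def by auto
  ultimately show ?thesis using t by auto
qed

section \<open>Edge potentials of a dense balanced tripartite graph\<close>

text \<open>Here \<open>u\<close> is the mean of \<open>s\<close> on a class, \<open>v1\<close>,
  \<open>v2\<close>, \<open>v3\<close> are the means of its square on the three classes,
  \<open>T\<close> and \<open>\<delta>\<close> stand for \<open>opposite_sum\<close> and the
  regularisation parameter divided by \<open>n\<close>, and \<open>s\<close> is the value at the
  critical vertex. The scale \<open>g\<close> of the trial potential stays free since one value is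
  used for small \<open>u\<close> and another for large \<open>u\<close>.\<close>

lemma no_critical_parameters:
  fixes u v1 v2 v3 \<delta> s T h :: real
  assumes h_eq: "h = 3/5 * u - (v1 + v2 + v3)"
    and u: "0 \<le> u" "u \<le> 1/5"
    and v: "u\<^sup>2 \<le> v1" "u\<^sup>2 \<le> v2" "u\<^sup>2 \<le> v3" and h: "0 \<le> h"
    and d: "0 \<le> \<delta>" and s: "0 \<le> s" "s \<le> 1/5"
    and T_le: "T \<le> 2/5 - 2*u + s * (2*u - 7/20) + s\<^sup>2/2 - 3/5 * \<delta> * (1/2 - s)"
    and T_ge: "\<And>g. \<lbrakk>11/10 \<le> g; g \<le> 7/5\<rbrakk> \<Longrightarrow>
      3 * T \<ge> 2 * g * (4/5 - 2*u + h)
        - g\<^sup>2 * ((1 - u)^3 - (4/5 - u) * (3/5 - 3*u - 2*h)) - 4/15 * g\<^sup>2 * \<delta>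
        + 17/50 * (u + v1) - (u - (v2 + v3) / 2)"
  shows False
proof -
  have v0: "0 \<le> v1" "0 \<le> v2" "0 \<le> v3"
    using v zero_le_power2[of u] by linarith+
  have h_le: "h \<le> 3/5 * u - 3 * u\<^sup>2"
    using v by (simp add: h_eq)
  \<comment> \<open>Since \<open>s \<le> 1/5\<close>, the tripled upper bound loses at least
    \<open>27/50 * \<delta>\<close>. This exceeds the loss
    \<open>4/15 * g\<^sup>2 * \<delta>\<close> of the lower bound for both values of
    \<open>g\<close> used below, so \<open>\<delta>\<close> only helps.\<close>
  have "0 \<le> 3 * (2/5 - 2*u + s * (2*u - 7/20) + s\<^sup>2/2 - 3/5 * \<delta> * (1/2 - s) - T)
        + 9/5 * (\<delta> * (1/5 - s))"
    using T_le d s by (intro add_nonneg_nonneg mult_nonneg_nonneg) auto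
  also have "\<dots> = 6/5 - 6*u + 3 * (s * (2*u - 7/20)) + 3/2 * s\<^sup>2 - 27/50 * \<delta> - 3 * T"
    by (simp add: field_simps)
  finally have T_le': "3 * T \<le> 6/5 - 6*u + (3 * (s * (2*u - 7/20)) + 3/2 * s\<^sup>2) - 27/50 * \<delta>"
    by simp
  show False
  \<comment> \<open>The contribution of \<open>s\<close> to the tripled upper bound is convex in
    \<open>s\<close>, with value \<open>0\<close> at \<open>s = 0\<close> and
    \<open>6/5 * u - 3/20\<close> at \<open>s = 1/5\<close>. The two agree at
    \<open>u = 1/8\<close>, the threshold between the scales \<open>7/5\<close> and
    \<open>11/10\<close>.\<close>
  proof (cases "u \<le> 1/8")
    case True
    have "0 \<le> 3 * T - (2 * (7/5) * (4/5 - 2*u + h)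
        - (7/5)\<^sup>2 * ((1 - u)^3 - (4/5 - u) * (3/5 - 3*u - 2*h)) - 4/15 * (7/5)\<^sup>2 * \<delta>
        + 17/50 * (u + v1) - (u - (v2 + v3) / 2)) + 4/25 * (v2 + v3)"
      using T_ge[of "7/5"] v0 by simp
    also have "\<dots> = 3 * T - (6/5 - 6*u + (13/625 - 7/125 * u + h * (98/25 * u - 169/250) + 49/25 * u^3)
        - 196/375 * \<delta>)"
      by (simp add: h_eq field_simps power2_eq_square power3_eq_cube)
    finally have 1: "3 * T \<ge> 6/5 - 6*u + (13/625 - 7/125 * u + h * (98/25 * u - 169/250) + 49/25 * u^3)
        - 196/375 * \<delta>"
      by simp
    \<comment> \<open>Inserting the largest possible \<open>h\<close> and using
      \<open>u \<le> 1/8\<close> leaves a quadratic in \<open>u\<close> with minimiser close to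
      \<open>73/1000\<close>; the square replaces it by its tangent line at that point.\<close>
    have "0 \<le> (3/5 * u - 3 * u\<^sup>2 - h) * (169/250 - 98/25 * u)
        + 49/5 * (u\<^sup>2 * (1/8 - u)) + 631/200 * (u - 73/1000)\<^sup>2"
      using h_le True by (intro add_nonneg_nonneg mult_nonneg_nonneg) auto
    also have "\<dots> = (13/625 - 7/125 * u + h * (98/25 * u - 169/250) + 49/25 * u^3)
        - (13/625 - 631/200 * (73/1000)\<^sup>2) - (631/100 * (73/1000) - 577/1250) * u"
      by (simp add: field_simps power2_eq_square power3_eq_cube)
    finally have 2: "13/625 - 7/125 * u + h * (98/25 * u - 169/250) + 49/25 * u^3
        \<ge> (13/625 - 631/200 * (73/1000)\<^sup>2) + (631/100 * (73/1000) - 577/1250) * u"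
      by simp
    have "0 \<le> 6 * (s * (1/8 - u)) + 3/2 * (s * (1/5 - s))"
      using s True by (intro add_nonneg_nonneg mult_nonneg_nonneg) auto
    also have "\<dots> = - (3 * (s * (2*u - 7/20)) + 3/2 * s\<^sup>2)"
      by (simp add: field_simps power2_eq_square)
    finally have 3: "3 * (s * (2*u - 7/20)) + 3/2 * s\<^sup>2 \<le> 0"
      by simp
    have "(13/625 - 631/200 * (73/1000)\<^sup>2) + (631/100 * (73/1000) - 577/1250) * u > (0::real)"
      using u True by (simp add: power2_eq_square)
    with 1 2 3 T_le' d show False by linarith
  next
    case False
    have "0 \<le> 3 * T - (2 * (11/10) * (4/5 - 2*u + h)
        - (11/10)\<^sup>2 * ((1 - u)^3 - (4/5 - u) * (3/5 - 3*u - 2*h)) - 4/15 * (11/10)\<^sup>2 * \<delta>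
        + 17/50 * (u + v1) - (u - (v2 + v3) / 2)) + 4/25 * (v2 + v3)
        + h * (121/50 * u - 19/250) + 121/100 * u^3"
      using T_ge[of "11/10"] v0 h u False by simp
    also have "\<dots> = 3 * T - (6/5 - 6*u + (- 173/2500 + 143/125 * u) - 121/375 * \<delta>)"
      by (simp add: h_eq field_simps power2_eq_square power3_eq_cube)
    finally have 1: "3 * T \<ge> 6/5 - 6*u + (- 173/2500 + 143/125 * u) - 121/375 * \<delta>"
      by simp
    have "0 \<le> 6 * ((1/5 - s) * (u - 1/8)) + 3/2 * (s * (1/5 - s))"
      using s False by (intro add_nonneg_nonneg mult_nonneg_nonneg) auto
    also have "\<dots> = 6/5 * u - 3/20 - (3 * (s * (2*u - 7/20)) + 3/2 * s\<^sup>2)"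
      by (simp add: field_simps power2_eq_square)
    finally have "3 * (s * (2*u - 7/20)) + 3/2 * s\<^sup>2 \<le> 6/5 * u - 3/20"
      by simp
    with 1 T_le' d u False show False by linarith
  qed
qed

section \<open>Potentials in the abstract setting\<close>

text \<open>The setting in which contact is refuted. \<open>load\<close> is the requirement on an
  edge after multiplication by \<open>(1 - s x) * (1 - s y)\<close>, which cancels the factors
  \<open>m x * m y\<close>. \<open>Th_le\<close> is the bound maintained by the continuation, with
  equality allowed.\<close>

locale tripartite_potential =
  fixes X Y Z :: "'a set" and e :: "'a \<Rightarrow> 'a \<Rightarrow> real" and n :: real
    and s :: "'a \<Rightarrow> real" and th :: "'a \<Rightarrow> 'a \<Rightarrow> real" and Th :: "'a \<Rightarrow> real" and \<delta> :: real
  assumes fin: "finite X" "finite Y" "finite Z"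
    and cards: "real (card X) = n" "real (card Y) = n" "real (card Z) = n"
    and n_pos: "0 < n" and delta_pos: "0 < \<delta>"
    and e01: "e u v = 0 \<or> e u v = 1"
    and e_sym: "e u v = e v u" and th_sym: "th u v = th v u"
    and th_supp: "e u v * th u v = th u v"
    and s_nonneg: "0 \<le> s v" and s_le: "s v \<le> 1/5"
    and deg: "x \<in> X \<Longrightarrow> (\<Sum>y\<in>Y. e x y) = n * (4/5 + s x)"
      "x \<in> X \<Longrightarrow> (\<Sum>z\<in>Z. e x z) = n * (4/5 + s x)"
      "y \<in> Y \<Longrightarrow> (\<Sum>x\<in>X. e y x) = n * (4/5 + s y)"
      "y \<in> Y \<Longrightarrow> (\<Sum>z\<in>Z. e y z) = n * (4/5 + s y)"
      "z \<in> Z \<Longrightarrow> (\<Sum>x\<in>X. e z x) = n * (4/5 + s z)"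
      "z \<in> Z \<Longrightarrow> (\<Sum>y\<in>Y. e z y) = n * (4/5 + s z)"
    and load: "\<lbrakk>x \<in> X; y \<in> Y\<rbrakk> \<Longrightarrow>
        e x y * (\<Sum>z\<in>Z. e x z * e y z / (1 - s z) * (th x y + th x z + th y z)) + \<delta> * th x y
        = e x y * (1 - s x) * (1 - s y)"
      "\<lbrakk>y \<in> Y; z \<in> Z\<rbrakk> \<Longrightarrow>
        e y z * (\<Sum>x\<in>X. e y x * e z x / (1 - s x) * (th y z + th y x + th z x)) + \<delta> * th y z
        = e y z * (1 - s y) * (1 - s z)"
      "\<lbrakk>z \<in> Z; x \<in> X\<rbrakk> \<Longrightarrow>
        e z x * (\<Sum>y\<in>Y. e z y * e x y / (1 - s y) * (th z x + th z y + th x y)) + \<delta> * th z x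
        = e z x * (1 - s z) * (1 - s x)"
    and Th: "x \<in> X \<Longrightarrow> (\<Sum>y\<in>Y. th x y / (1 - s y)) = Th x"
      "x \<in> X \<Longrightarrow> (\<Sum>z\<in>Z. th x z / (1 - s z)) = Th x"
      "y \<in> Y \<Longrightarrow> (\<Sum>x\<in>X. th y x / (1 - s x)) = Th y"
      "y \<in> Y \<Longrightarrow> (\<Sum>z\<in>Z. th y z / (1 - s z)) = Th y"
      "z \<in> Z \<Longrightarrow> (\<Sum>x\<in>X. th z x / (1 - s x)) = Th z"
      "z \<in> Z \<Longrightarrow> (\<Sum>y\<in>Y. th z y / (1 - s y)) = Th z"
    and Th_le: "v \<in> X \<union> Y \<union> Z \<Longrightarrow> Th v \<le> 1/2 - s v"
begin

text \<open>Rotation and exchange of the classes let an estimate be proved for one choice of classes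
  and then be transported to the others.\<close>

lemma rotate: "tripartite_potential Y Z X e n s th Th \<delta>"
  by (unfold_locales; (rule Th_le, blast)?;
      (rule fin cards n_pos delta_pos e01 e_sym th_sym th_supp s_nonneg s_le deg load Th; assumption)?)

lemma swap: "tripartite_potential X Z Y e n s th Th \<delta>"
proof -
  have 1: "e x z * (\<Sum>y\<in>Y. e x y * e z y / (1 - s y) * (th x z + th x y + th z y)) + \<delta> * th x z
        = e x z * (1 - s x) * (1 - s z)" if "x \<in> X" "z \<in> Z" for x z
    using load(3)[OF that(2,1)] by (simp add: e_sym[of z x] th_sym[of z x] mult_ac add_ac)
  have 2: "e z y * (\<Sum>x\<in>X. e z x * e y x / (1 - s x) * (th z y + th z x + th y x)) + \<delta> * th z y
        = e z y * (1 - s z) * (1 - s y)" if "z \<in> Z" "y \<in> Y" for y z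
    using load(2)[OF that(2,1)] by (simp add: e_sym[of z y] th_sym[of z y] mult_ac add_ac)
  have 3: "e y x * (\<Sum>z\<in>Z. e y z * e x z / (1 - s z) * (th y x + th y z + th x z)) + \<delta> * th y x
        = e y x * (1 - s y) * (1 - s x)" if "y \<in> Y" "x \<in> X" for x y
    using load(1)[OF that(2,1)] by (simp add: e_sym[of y x] th_sym[of y x] mult_ac add_ac)
  show ?thesis
    by (unfold_locales; (rule Th_le, blast)?;
      (rule fin cards n_pos delta_pos e01 e_sym th_sym th_supp s_nonneg s_le deg 1 2 3 Th; assumption)?)
qed

definition m :: "'a \<Rightarrow> real" where "m v = 1 / (1 - s v)"

lemma m_bounds: "1 \<le> m v" "m v \<le> 5/4" "0 < m v"
  and m_inverse: "m v * (1 - s v) = 1"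
  using s_nonneg[of v] s_le[of v] by (auto simp: m_def field_simps)

lemma m_eq: "m v = 1 + m v * s v"
  using m_inverse[of v] by (simp add: algebra_simps)

lemma s_le_m_1: "s v \<le> m v - 1"
  using m_bounds(1)[of v] m_eq[of v] mult_right_mono[OF m_bounds(1)[of v] s_nonneg[of v]] by auto

lemma s_le_1: "s v \<le> 1"
  using s_le[of v] by simp

lemma e_bounds: "0 \<le> e u v" "e u v \<le> 1"
  using e01[of u v] by auto

lemma codegree:
  assumes "x \<in> X" "y \<in> Y"
  shows "(\<Sum>z\<in>Z. e x z * e y z) \<ge> n * (3/5 + s x + s y)"
proof -
  have "n * (3/5 + s x + s y) = (\<Sum>z\<in>Z. e x z + e y z - 1)"
    using assms cards by (simp add: deg sum.distrib sum_subtractf algebra_simps)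
  also have "\<dots> \<le> (\<Sum>z\<in>Z. e x z * e y z)"
  proof (intro sum_mono)
    fix z show "e x z + e y z - 1 \<le> e x z * e y z"
      using e01[of x z] e01[of y z] by auto
  qed
  finally show ?thesis .
qed

lemma codegree_weighted:
  assumes "x \<in> X" "y \<in> Y"
  shows "(\<Sum>z\<in>Z. e x z * e y z * m z) \<ge> n * (3/5)"
proof -
  have "n * (3/5) \<le> n * (3/5 + s x + s y)"
    using n_pos s_nonneg[of x] s_nonneg[of y] by simp
  also have "\<dots> \<le> (\<Sum>z\<in>Z. e x z * e y z)" by (rule codegree[OF assms])
  also have "\<dots> \<le> (\<Sum>z\<in>Z. e x z * e y z * m z)"
  proof (intro sum_mono)
    fix z show "e x z * e y z \<le> e x z * e y z * m z"
      using mult_left_mono[OF m_bounds(1)[of z], of "e x z * e y z"] e_bounds by simp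
  qed
  finally show ?thesis .
qed

section \<open>Nonnegativity of the potentials\<close>

lemma load_m:
  assumes "x \<in> X" "y \<in> Y"
  shows "e x y * (\<Sum>z\<in>Z. e x z * e y z * m z * (th x y + th x z + th y z)) + \<delta> * th x y
        = e x y * (1 - s x) * (1 - s y)"
  using load(1)[OF assms] by (simp add: m_def)

lemma Th_m:
  "x \<in> X \<Longrightarrow> (\<Sum>y\<in>Y. m y * th x y) = Th x" "x \<in> X \<Longrightarrow> (\<Sum>z\<in>Z. m z * th x z) = Th x"
  "y \<in> Y \<Longrightarrow> (\<Sum>x\<in>X. m x * th y x) = Th y" "y \<in> Y \<Longrightarrow> (\<Sum>z\<in>Z. m z * th y z) = Th y"
  "z \<in> Z \<Longrightarrow> (\<Sum>x\<in>X. m x * th z x) = Th z" "z \<in> Z \<Longrightarrow> (\<Sum>y\<in>Y. m y * th z y) = Th z"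
  using Th by (simp_all add: m_def)

text \<open>The load equation solved for \<open>th x y\<close>: sums over common neighbours are
  completed to the weighted degrees \<open>Th x\<close> and \<open>Th y\<close>, at the price of
  sums over the vertices of \<open>Z\<close> missed by \<open>y\<close> or by
  \<open>x\<close>.\<close>

lemma th_eq:
  assumes "x \<in> X" "y \<in> Y" "e x y = 1"
  shows "((\<Sum>z\<in>Z. e x z * e y z * m z) + \<delta>) * th x y
    = (1 - s x) * (1 - s y) - Th x - Th y
      + (\<Sum>z\<in>Z. (1 - e y z) * m z * th x z) + (\<Sum>z\<in>Z. (1 - e x z) * m z * th y z)"
proof -
  have 1: "(\<Sum>z\<in>Z. e x z * e y z * m z * (th x y + th x z + th y z))
    = (\<Sum>z\<in>Z. e x z * e y z * m z) * th x y
      + (\<Sum>z\<in>Z. e y z * m z * (e x z * th x z)) + (\<Sum>z\<in>Z. e x z * m z * (e y z * th y z))"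
    by (simp add: sum_distrib_left sum.distrib algebra_simps)
  have 2: "(\<Sum>z\<in>Z. e y z * m z * (e x z * th x z))
    = (\<Sum>z\<in>Z. m z * th x z) - (\<Sum>z\<in>Z. (1 - e y z) * m z * th x z)"
    unfolding th_supp sum_subtractf[symmetric] by (intro sum.cong) (simp_all add: algebra_simps)
  have 3: "(\<Sum>z\<in>Z. e x z * m z * (e y z * th y z))
    = (\<Sum>z\<in>Z. m z * th y z) - (\<Sum>z\<in>Z. (1 - e x z) * m z * th y z)"
    unfolding th_supp sum_subtractf[symmetric] by (intro sum.cong) (simp_all add: algebra_simps)
  have 4: "(\<Sum>z\<in>Z. e x z * e y z * m z * (th x y + th x z + th y z)) + \<delta> * th x y
        = (1 - s x) * (1 - s y)"
    using load_m[OF assms(1,2)] unfolding assms(3) by simp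
  have "(P + \<delta>) * h = r - tx - ty + M + N"
    if "S = P * h + A + B" "A = Tx - M" "B = Ty - N" "S + \<delta> * h = r" "Tx = tx" "Ty = ty"
    for S P h A B Tx Ty M N r tx ty :: real
    using that by (simp add: algebra_simps)
  from this[OF 1 2 3 4 Th_m(2)[OF assms(1)] Th_m(4)[OF assms(2)]] show ?thesis .
qed

text \<open>At most \<open>n / 5\<close> vertices are missed, each of weight at most
  \<open>5/4\<close>, so the missed weight is at most \<open>n / 4\<close>.\<close>

lemma missing_sum_ge:
  assumes c: "0 \<le> c" and y: "(\<Sum>z\<in>Z. e y z) = n * (4/5 + s y)" and f: "\<And>z. z \<in> Z \<Longrightarrow> f z \<ge> - c"
  shows "(\<Sum>z\<in>Z. (1 - e y z) * m z * f z) \<ge> - (c * n / 4)"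
proof -
  have "- (c * n / 4) \<le> - (c * (5/4) * (n * (1/5 - s y)))"
    using c n_pos s_nonneg[of y] by (simp add: algebra_simps)
  also have "\<dots> = (\<Sum>z\<in>Z. (1 - e y z) * (- (5/4 * c)))"
    using cards by (simp only: sum_distrib_right[symmetric])
      (simp add: y sum_subtractf algebra_simps)
  also have "\<dots> \<le> (\<Sum>z\<in>Z. (1 - e y z) * (m z * f z))"
  proof (intro sum_mono mult_left_mono)
    fix z assume "z \<in> Z"
    then have "m z * (- c) \<le> m z * f z"
      using f m_bounds(3)[of z] by (intro mult_left_mono) auto
    moreover have "m z * c \<le> 5/4 * c"
      using c m_bounds(2)[of z] by (intro mult_right_mono) auto
    ultimately show "- (5/4 * c) \<le> m z * f z" by linarith
  qed (use e_bounds in auto)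
  also have "\<dots> = (\<Sum>z\<in>Z. (1 - e y z) * m z * f z)" by (simp only: mult.assoc)
  finally show ?thesis .
qed

text \<open>In \<open>th_eq\<close> the two missing sums contribute at least
  \<open>- (c * n / 2)\<close>, the remaining terms on the right are nonnegative by
  \<open>Th_le\<close>, and the coefficient of \<open>th x y\<close> is at least
  \<open>3/5 * n\<close>. The factor \<open>5/6\<close> is the quotient of \<open>1/2\<close> and
  \<open>3/5\<close>.\<close>

lemma th_lower_step:
  assumes c: "0 \<le> c"
    and XY: "\<And>x y. \<lbrakk>x \<in> X; y \<in> Y\<rbrakk> \<Longrightarrow> th x y \<ge> - c"
    and YZ: "\<And>y z. \<lbrakk>y \<in> Y; z \<in> Z\<rbrakk> \<Longrightarrow> th y z \<ge> - c"
    and ZX: "\<And>z x. \<lbrakk>z \<in> Z; x \<in> X\<rbrakk> \<Longrightarrow> th z x \<ge> - c"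
    and xy: "x \<in> X" "y \<in> Y"
  shows "th x y \<ge> - (5/6 * c)"
proof (rule ccontr)
  assume neg: "\<not> th x y \<ge> - (5/6 * c)"
  then have "th x y < 0" using c by linarith
  then have e1: "e x y = 1" using e01[of x y] th_supp[of x y] by auto
  have "(\<Sum>z\<in>Z. (1 - e y z) * m z * th x z) \<ge> - (c * n / 4)"
    using xy c ZX th_sym[of x] by (intro missing_sum_ge) (auto simp: deg)
  moreover have "(\<Sum>z\<in>Z. (1 - e x z) * m z * th y z) \<ge> - (c * n / 4)"
    using xy c YZ by (intro missing_sum_ge) (auto simp: deg)
  moreover have "(1 - s x) * (1 - s y) - Th x - Th y \<ge> 0"
  proof -
    have "0 \<le> s x * s y" using s_nonneg by simp
    then show ?thesis using Th_le[of x] Th_le[of y] xy by (simp add: algebra_simps)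
  qed
  ultimately have 1: "((\<Sum>z\<in>Z. e x z * e y z * m z) + \<delta>) * th x y \<ge> - (c * n / 2)"
    using th_eq[OF xy e1] by linarith
  have "((\<Sum>z\<in>Z. e x z * e y z * m z) + \<delta>) * th x y \<le> (n * (3/5)) * th x y"
    using codegree_weighted[OF xy] delta_pos \<open>th x y < 0\<close> by (intro mult_right_mono_neg) auto
  also have "\<dots> < n * (3/5) * (- (5/6 * c))"
    using neg n_pos by (intro mult_strict_left_mono) auto
  finally show False using 1 by simp
qed

text \<open>Applied to the smallest potential, the contraction by \<open>5/6\<close> forces its
  negative part to vanish. Inserting \<open>0\<close> into \<open>S\<close> ensures that
  \<open>c\<close> is nonnegative.\<close>

lemma th_nonneg:
  shows "\<lbrakk>x \<in> X; y \<in> Y\<rbrakk> \<Longrightarrow> 0 \<le> th x y"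
    and "\<lbrakk>y \<in> Y; z \<in> Z\<rbrakk> \<Longrightarrow> 0 \<le> th y z"
    and "\<lbrakk>x \<in> X; z \<in> Z\<rbrakk> \<Longrightarrow> 0 \<le> th x z"
proof -
  interpret r: tripartite_potential Y Z X by (rule rotate)
  interpret r2: tripartite_potential Z X Y by (rule r.rotate)
  define S where "S = insert 0 ((\<lambda>(u, v). th u v) ` (X \<times> Y \<union> Y \<times> Z \<union> Z \<times> X))"
  have fS: "finite S" using fin by (simp add: S_def)
  define c where "c = - Min S"
  have c0: "0 \<le> c" using fS Min_le[of S 0] by (simp add: c_def S_def)
  have ge: "f \<ge> - c" if "f \<in> S" for f using fS Min_le[OF fS that] by (simp add: c_def)
  have XY: "th x y \<ge> - c" if "x \<in> X" "y \<in> Y" for x y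
    using that by (intro ge) (force simp: S_def)
  have YZ: "th y z \<ge> - c" if "y \<in> Y" "z \<in> Z" for y z
    using that by (intro ge) (force simp: S_def)
  have ZX: "th z x \<ge> - c" if "z \<in> Z" "x \<in> X" for z x
    using that by (intro ge) (force simp: S_def)
  have "f \<ge> - (5/6 * c)" if "f \<in> S" for f
    using that c0 th_lower_step[OF c0 XY YZ ZX] r.th_lower_step[OF c0 YZ ZX XY]
      r2.th_lower_step[OF c0 ZX XY YZ] by (auto simp: S_def)
  moreover have "Min S \<in> S" using fS by (intro Min_in) (auto simp: S_def)
  ultimately have "c = 0" using c0 by (fastforce simp: c_def)
  then show "\<lbrakk>x \<in> X; y \<in> Y\<rbrakk> \<Longrightarrow> 0 \<le> th x y" "\<lbrakk>y \<in> Y; z \<in> Z\<rbrakk> \<Longrightarrow> 0 \<le> th y z"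
    "\<lbrakk>x \<in> X; z \<in> Z\<rbrakk> \<Longrightarrow> 0 \<le> th x z"
    using XY[of x y] YZ[of y z] ZX[of z x] th_sym[of x z] by auto
qed

lemma Th_nonneg: "v \<in> X \<union> Y \<union> Z \<Longrightarrow> 0 \<le> Th v"
proof -
  assume "v \<in> X \<union> Y \<union> Z"
  then consider "v \<in> X" | "v \<in> Y" | "v \<in> Z" by blast
  then show ?thesis
  proof cases
    case 1
    then show ?thesis
      using th_nonneg m_bounds(3) unfolding Th_m(1)[OF 1, symmetric]
      by (intro sum_nonneg) (simp add: less_imp_le)
  next
    case 2
    then show ?thesis
      using th_nonneg m_bounds(3) unfolding Th_m(4)[OF 2, symmetric]
      by (intro sum_nonneg) (simp add: less_imp_le)
  next
    case 3
    then show ?thesis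
      using th_nonneg m_bounds(3) unfolding Th_m(5)[OF 3, symmetric] th_sym[of v]
      by (intro sum_nonneg) (simp add: less_imp_le)
  qed
qed

section \<open>Load equations summed at one vertex\<close>

text \<open>Double counting of the edges between \<open>X\<close> and each of the other
  classes.\<close>

lemma sum_s: "sum s Y = sum s X" "sum s Z = sum s X"
proof -
  have c: "(\<Sum>v\<in>A. n * (4/5 + s v)) = n * (4/5 * n + sum s A)" if "real (card A) = n" for A
    using that by (simp add: sum_distrib_left[symmetric] sum.distrib)
  have "(\<Sum>x\<in>X. n * (4/5 + s x)) = (\<Sum>x\<in>X. \<Sum>y\<in>Y. e x y)" by (simp add: deg)
  also have "\<dots> = (\<Sum>y\<in>Y. \<Sum>x\<in>X. e y x)" by (subst sum.swap) (simp add: e_sym)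
  also have "\<dots> = (\<Sum>y\<in>Y. n * (4/5 + s y))" by (simp add: deg)
  finally show "sum s Y = sum s X" using c[OF cards(1)] c[OF cards(2)] n_pos by simp
  have "(\<Sum>x\<in>X. n * (4/5 + s x)) = (\<Sum>x\<in>X. \<Sum>z\<in>Z. e x z)" by (simp add: deg)
  also have "\<dots> = (\<Sum>z\<in>Z. \<Sum>x\<in>X. e z x)" by (subst sum.swap) (simp add: e_sym)
  also have "\<dots> = (\<Sum>z\<in>Z. n * (4/5 + s z))" by (simp add: deg)
  finally show "sum s Z = sum s X" using c[OF cards(1)] c[OF cards(3)] n_pos by simp
qed

text \<open>Since \<open>kappa y z = m y * m z * ((1 - s y) + (1 - s z) - 1)\<close>, it is what remains of the triangle weight
when the load equations at a vertex are tested against the factor \<open>(1 - s y) + (1 - s z) - 1\<close>.\<close>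

definition kappa :: "'a \<Rightarrow> 'a \<Rightarrow> real" where "kappa u v = m u + m v - m u * m v"

lemma kappa_sym: "kappa u v = kappa v u"
  by (simp add: kappa_def)

lemma kappa_eq: "kappa u v = m u * (1 - s u * m v)"
proof -
  have "m v * (m u * (1 - s u)) = m v" by (simp add: m_inverse)
  then show ?thesis by (simp add: kappa_def algebra_simps)
qed

lemma s_m_le: "s u * m v \<le> 5/4 * s u" "5/4 * s u \<le> 1/4"
  using mult_left_mono[OF m_bounds(2)[of v] s_nonneg[of u]] s_le[of u] by auto

lemma kappa_bounds: "0 \<le> kappa u v" "kappa u v \<le> m v" "kappa u v \<le> m u"
proof -
  show "0 \<le> kappa u v"
    unfolding kappa_eq using m_bounds(3)[of u] s_m_le(1)[of u v] s_m_le(2)[of u] by (intro mult_nonneg_nonneg) auto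
  show "kappa u v \<le> m v" "kappa u v \<le> m u"
    using mult_left_mono[OF m_bounds(1)[of v], of "m u"] mult_left_mono[OF m_bounds(1)[of u], of "m v"]
      m_bounds(3)[of u] m_bounds(3)[of v] by (auto simp: kappa_def algebra_simps)
qed

text \<open>The total of \<open>th\<close> between the two classes opposite to \<open>X\<close>,
  weighted as the load equations at a vertex of \<open>X\<close> dictate. It is the same for all
  vertices of \<open>X\<close> and so links the estimates at different ones.\<close>

definition opposite_sum :: real where "opposite_sum = (\<Sum>y\<in>Y. \<Sum>z\<in>Z. kappa y z * th y z)"

text \<open>The load equations of the edges from \<open>x\<close> to \<open>Y\<close> and to
  \<open>Z\<close> are added, and those to \<open>Y\<close>, weighted by \<open>m y\<close>, are
  subtracted. A triangle at \<open>x\<close> then carries \<open>m z + m y - m y * m z\<close>,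
  which is \<open>kappa y z\<close>.\<close>

lemma vertex_identity:
  assumes x: "x \<in> X"
  shows "(\<Sum>y\<in>Y. \<Sum>z\<in>Z. e x y * e x z * e y z * kappa y z * (th x y + th x z + th y z))
      + \<delta> * ((\<Sum>y\<in>Y. th x y) + (\<Sum>z\<in>Z. th x z) - Th x)
    = (1 - s x) * ((\<Sum>y\<in>Y. e x y * (1 - s y)) + (\<Sum>z\<in>Z. e x z * (1 - s z)) - n * (4/5 + s x))"
proof -
  interpret r: tripartite_potential Y Z X by (rule rotate)
  interpret r2: tripartite_potential Z X Y by (rule r.rotate)
  define G where "G y z = e x y * e x z * e y z * (th x y + th x z + th y z)" for y z
  have xy: "(\<Sum>z\<in>Z. G y z * m z) + \<delta> * th x y = (1 - s x) * (e x y * (1 - s y))" if "y \<in> Y" for y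
    using load_m[OF x that] by (simp add: G_def sum_distrib_left algebra_simps)
  have xz: "(\<Sum>y\<in>Y. G y z * m y) + \<delta> * th x z = (1 - s x) * (e x z * (1 - s z))" if "z \<in> Z" for z
  proof -
    have "(\<Sum>y\<in>Y. G y z * m y)
      = e z x * (\<Sum>y\<in>Y. e z y * e x y * m y * (th z x + th z y + th x y))"
      unfolding sum_distrib_left G_def
      by (intro sum.cong) (simp_all add: e_sym[of z] th_sym[of z] algebra_simps)
    then show ?thesis
      using r2.load_m[OF that x] by (simp add: e_sym[of z] th_sym[of z] algebra_simps)
  qed
  have a: "(\<Sum>y\<in>Y. \<Sum>z\<in>Z. G y z * m z) + \<delta> * (\<Sum>y\<in>Y. th x y)
      = (1 - s x) * (\<Sum>y\<in>Y. e x y * (1 - s y))"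
    unfolding sum_distrib_left sum.distrib[symmetric] by (intro sum.cong refl xy)
  have "(\<Sum>z\<in>Z. \<Sum>y\<in>Y. G y z * m y) + \<delta> * (\<Sum>z\<in>Z. th x z)
      = (1 - s x) * (\<Sum>z\<in>Z. e x z * (1 - s z))"
    unfolding sum_distrib_left sum.distrib[symmetric] by (intro sum.cong refl xz)
  then have b: "(\<Sum>y\<in>Y. \<Sum>z\<in>Z. G y z * m y) + \<delta> * (\<Sum>z\<in>Z. th x z)
      = (1 - s x) * (\<Sum>z\<in>Z. e x z * (1 - s z))"
    by (simp only: sum.swap[of _ Z Y])
  have "(\<Sum>y\<in>Y. \<Sum>z\<in>Z. G y z * m y * m z) + \<delta> * Th x
      = (\<Sum>y\<in>Y. m y * ((\<Sum>z\<in>Z. G y z * m z) + \<delta> * th x y))"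
    by (simp add: Th_m(1)[OF x, symmetric] sum_distrib_left sum.distrib algebra_simps)
  also have "\<dots> = (\<Sum>y\<in>Y. m y * ((1 - s x) * (e x y * (1 - s y))))"
    by (intro sum.cong refl) (simp add: xy)
  also have "\<dots> = (\<Sum>y\<in>Y. (1 - s x) * e x y * (m y * (1 - s y)))"
    by (simp add: mult_ac)
  also have "\<dots> = (1 - s x) * (n * (4/5 + s x))"
    unfolding m_inverse using deg(1)[OF x] by (simp add: sum_distrib_left[symmetric])
  finally have c: "(\<Sum>y\<in>Y. \<Sum>z\<in>Z. G y z * m y * m z) + \<delta> * Th x = (1 - s x) * (n * (4/5 + s x))" .
  have "(\<Sum>y\<in>Y. \<Sum>z\<in>Z. e x y * e x z * e y z * kappa y z * (th x y + th x z + th y z))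
    = (\<Sum>y\<in>Y. \<Sum>z\<in>Z. G y z * m z) + (\<Sum>y\<in>Y. \<Sum>z\<in>Z. G y z * m y)
      - (\<Sum>y\<in>Y. \<Sum>z\<in>Z. G y z * m y * m z)"
    by (simp add: sum.distrib[symmetric] sum_subtractf[symmetric] G_def kappa_def algebra_simps)
  moreover have "A + B - C + \<delta> * (p + q - t) = h * (a + b - c)"
    if "A + \<delta> * p = h * a" "B + \<delta> * q = h * b" "C + \<delta> * t = h * c"
    for A B C p q t h a b c :: real
    using that by (simp add: algebra_simps)
  ultimately show ?thesis using a b c by simp
qed

text \<open>In the lower bound the factor \<open>1 - 5/4 * s y\<close> coming from
  \<open>kappa\<close> is compensated by the term \<open>s y\<close> of the codegree bound, at the
  price of a quarter of \<open>s x\<close>.\<close>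

lemma kappa_codegree:
  assumes "x \<in> X" "y \<in> Y"
  shows "(\<Sum>z\<in>Z. e x z * e y z * kappa y z) \<ge> m y * (n * (3/5 + 3/4 * s x))"
    and "(\<Sum>z\<in>Z. e x z * e y z * kappa y z) \<le> m y * (n * (4/5 + s x))"
proof -
  have "0 \<le> (s x + s y) * (1/4 - 5/4 * s y)"
    using s_nonneg s_m_le(2)[of y] by (intro mult_nonneg_nonneg) auto
  also have "\<dots> = (3/5 + s x + s y) * (1 - 5/4 * s y) - (3/5 + 3/4 * s x)"
    by (simp add: field_simps)
  finally have "n * (3/5 + 3/4 * s x) \<le> n * ((3/5 + s x + s y) * (1 - 5/4 * s y))"
    using n_pos by (intro mult_left_mono) auto
  also have "\<dots> = n * (3/5 + s x + s y) * (1 - 5/4 * s y)" by simp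
  also have "\<dots> \<le> (\<Sum>z\<in>Z. e x z * e y z) * (1 - 5/4 * s y)"
    using codegree[OF assms] s_m_le(2)[of y] by (intro mult_right_mono) auto
  also have "\<dots> \<le> (\<Sum>z\<in>Z. e x z * e y z * (1 - s y * m z))"
    unfolding sum_distrib_right using s_m_le(1)[of y] e_bounds
    by (intro sum_mono mult_left_mono) auto
  finally have "m y * (n * (3/5 + 3/4 * s x)) \<le> m y * (\<Sum>z\<in>Z. e x z * e y z * (1 - s y * m z))"
    using m_bounds(3)[of y] by simp
  then show "(\<Sum>z\<in>Z. e x z * e y z * kappa y z) \<ge> m y * (n * (3/5 + 3/4 * s x))"
    by (simp add: kappa_eq sum_distrib_left mult_ac)
  have "(\<Sum>z\<in>Z. e x z * e y z * kappa y z) \<le> (\<Sum>z\<in>Z. e x z * m y)"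
  proof (intro sum_mono)
    fix z
    have "e x z * e y z * kappa y z \<le> e x z * 1 * m y"
      using e_bounds kappa_bounds[of y z] by (intro mult_mono) (auto intro: mult_nonneg_nonneg)
    then show "e x z * e y z * kappa y z \<le> e x z * m y" by simp
  qed
  also have "\<dots> = m y * (n * (4/5 + s x))"
    using deg(2)[OF assms(1)] by (simp add: sum_distrib_right[symmetric])
  finally show "(\<Sum>z\<in>Z. e x z * e y z * kappa y z) \<le> m y * (n * (4/5 + s x))" .
qed

lemma pull_th:
  "(\<Sum>y\<in>Y. \<Sum>z\<in>Z. e x y * e x z * e y z * kappa y z * (th x y + th x z + th y z))
    = (\<Sum>y\<in>Y. th x y * (\<Sum>z\<in>Z. e x z * e y z * kappa y z))
      + (\<Sum>z\<in>Z. th x z * (\<Sum>y\<in>Y. e x y * e z y * kappa z y))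
      + (\<Sum>y\<in>Y. \<Sum>z\<in>Z. e x y * e x z * (kappa y z * th y z))"
proof -
  have "e x y * e x z * e y z * kappa y z * (th x y + th x z + th y z)
    = th x y * (e x z * e y z * kappa y z) + th x z * (e x y * e z y * kappa z y)
      + e x y * e x z * (kappa y z * th y z)" for y z
  proof -
    have "e x y * e x z * e y z * kappa y z * (th x y + th x z + th y z)
      = (e x y * th x y) * (e x z * e y z * kappa y z) + (e x z * th x z) * (e x y * e y z * kappa y z)
      + e x y * e x z * (kappa y z * (e y z * th y z))"
      by (simp add: algebra_simps)
    then show ?thesis by (simp add: th_supp e_sym[of z y] kappa_sym[of z y])
  qed
  then show ?thesis
    by (simp add: sum.distrib sum_distrib_left sum.swap[of _ Z Y])
qed

text \<open>This bounds \<open>opposite_sum\<close> from above when \<open>Th x\<close> is known. In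
  \<open>vertex_identity\<close> the terms with \<open>th x y\<close> and \<open>th x z\<close> are
  bounded below through \<open>Th x\<close>; restricting the remaining terms to neighbours of
  \<open>x\<close> costs at most \<open>1/2 - s v\<close> per non-neighbour \<open>v\<close>, by
  \<open>Th_le\<close>.\<close>

lemma vertex_lower:
  assumes x: "x \<in> X"
  shows "2 * (n * (3/5 + 3/4 * s x)) * Th x + 3/5 * \<delta> * Th x + opposite_sum - n * (1/5 - s x)
    \<le> (1 - s x) * (n * (4/5 + s x) - 2 * sum s X)"
proof -
  interpret w: tripartite_potential X Z Y by (rule swap)
  have 1: "(\<Sum>y\<in>Y. th x y * (\<Sum>z\<in>Z. e x z * e y z * kappa y z)) \<ge> n * (3/5 + 3/4 * s x) * Th x"
  proof -
    have "n * (3/5 + 3/4 * s x) * Th x = (\<Sum>y\<in>Y. th x y * (m y * (n * (3/5 + 3/4 * s x))))"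
      by (simp add: Th_m(1)[OF x, symmetric] sum_distrib_left sum_distrib_right mult_ac)
    also have "\<dots> \<le> (\<Sum>y\<in>Y. th x y * (\<Sum>z\<in>Z. e x z * e y z * kappa y z))"
      using x kappa_codegree(1) th_nonneg(1) by (intro sum_mono mult_left_mono) auto
    finally show ?thesis .
  qed
  have 2: "(\<Sum>z\<in>Z. th x z * (\<Sum>y\<in>Y. e x y * e z y * kappa z y)) \<ge> n * (3/5 + 3/4 * s x) * Th x"
  proof -
    have "n * (3/5 + 3/4 * s x) * Th x = (\<Sum>z\<in>Z. th x z * (m z * (n * (3/5 + 3/4 * s x))))"
      by (simp add: Th_m(2)[OF x, symmetric] sum_distrib_left sum_distrib_right mult_ac)
    also have "\<dots> \<le> (\<Sum>z\<in>Z. th x z * (\<Sum>y\<in>Y. e x y * e z y * kappa z y))"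
      using x w.kappa_codegree(1) th_nonneg(3) by (intro sum_mono mult_left_mono) auto
    finally show ?thesis .
  qed
  have 3: "(\<Sum>y\<in>Y. \<Sum>z\<in>Z. e x y * e x z * (kappa y z * th y z))
    \<ge> opposite_sum - (\<Sum>y\<in>Y. (1 - e x y) * (1/2 - s y)) - (\<Sum>z\<in>Z. (1 - e x z) * (1/2 - s z))"
  proof -
    have Y: "(1 - e x y) * (\<Sum>z\<in>Z. kappa y z * th y z) \<le> (1 - e x y) * (1/2 - s y)" if "y \<in> Y" for y
    proof (intro mult_left_mono)
      have "(\<Sum>z\<in>Z. kappa y z * th y z) \<le> (\<Sum>z\<in>Z. m z * th y z)"
        using that kappa_bounds(2) th_nonneg(2) by (intro sum_mono mult_right_mono) auto
      then show "(\<Sum>z\<in>Z. kappa y z * th y z) \<le> 1/2 - s y"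
        using Th_m(4)[OF that] Th_le[of y] that by auto
    qed (use e_bounds in auto)
    have Z: "(1 - e x z) * (\<Sum>y\<in>Y. kappa y z * th y z) \<le> (1 - e x z) * (1/2 - s z)" if "z \<in> Z" for z
    proof (intro mult_left_mono)
      have "(\<Sum>y\<in>Y. kappa y z * th y z) \<le> (\<Sum>y\<in>Y. m y * th z y)"
        using that kappa_bounds(3) th_nonneg(2) unfolding th_sym[of z]
        by (intro sum_mono mult_right_mono) auto
      then show "(\<Sum>y\<in>Y. kappa y z * th y z) \<le> 1/2 - s z"
        using Th_m(6)[OF that] Th_le[of z] that by auto
    qed (use e_bounds in auto)
    have "opposite_sum - (\<Sum>y\<in>Y. (1 - e x y) * (1/2 - s y)) - (\<Sum>z\<in>Z. (1 - e x z) * (1/2 - s z))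
      \<le> opposite_sum - (\<Sum>y\<in>Y. (1 - e x y) * (\<Sum>z\<in>Z. kappa y z * th y z))
        - (\<Sum>z\<in>Z. (1 - e x z) * (\<Sum>y\<in>Y. kappa y z * th y z))"
      by (intro diff_mono order_refl sum_mono Y Z)
    also have "\<dots> = (\<Sum>y\<in>Y. \<Sum>z\<in>Z. (e x y + e x z - 1) * (kappa y z * th y z))"
      unfolding opposite_sum_def by (simp add: sum_distrib_left sum.swap[of _ Z Y])
        (simp add: sum_subtractf[symmetric] algebra_simps)
    also have "\<dots> \<le> (\<Sum>y\<in>Y. \<Sum>z\<in>Z. e x y * e x z * (kappa y z * th y z))"
    proof (intro sum_mono mult_right_mono)
      fix y z assume "y \<in> Y" "z \<in> Z"
      show "e x y + e x z - 1 \<le> e x y * e x z" using e01[of x y] e01[of x z] by auto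
      show "0 \<le> kappa y z * th y z"
        using \<open>y \<in> Y\<close> \<open>z \<in> Z\<close> kappa_bounds(1)[of y z] th_nonneg(2) by simp
    qed
    finally show ?thesis .
  qed
  have 4: "3/5 * Th x \<le> (\<Sum>y\<in>Y. th x y) + (\<Sum>z\<in>Z. th x z) - Th x"
  proof -
    have m: "4/5 * (m v * a) \<le> a" if "0 \<le> a" for v a
      using mult_right_mono[OF m_bounds(2)[of v] that] by simp
    have "4/5 * Th x \<le> (\<Sum>y\<in>Y. th x y)"
      using m th_nonneg(1)[OF x] unfolding Th_m(1)[OF x, symmetric] sum_distrib_left
      by (intro sum_mono) auto
    moreover have "4/5 * Th x \<le> (\<Sum>z\<in>Z. th x z)"
      using m th_nonneg(3)[OF x] unfolding Th_m(2)[OF x, symmetric] sum_distrib_left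
      by (intro sum_mono) auto
    ultimately show ?thesis by linarith
  qed
  \<comment> \<open>The total of \<open>s\<close> over the non-neighbours of \<open>x\<close>. It
    lowers their cost by \<open>a\<close> and raises the right-hand side of the identity by at most
    \<open>a\<close>, so it cancels.\<close>
  define a where "a = (\<Sum>y\<in>Y. (1 - e x y) * s y) + (\<Sum>z\<in>Z. (1 - e x z) * s z)"
  have "0 \<le> a"
    unfolding a_def using e_bounds s_nonneg by (intro add_nonneg_nonneg sum_nonneg) auto
  have 5: "(\<Sum>y\<in>Y. (1 - e x y) * (1/2 - s y)) + (\<Sum>z\<in>Z. (1 - e x z) * (1/2 - s z))
      = n * (1/5 - s x) - a"
  proof -
    have "(\<Sum>v\<in>A. (1 - e x v) * (1/2 - s v)) = n * (1/5 - s x) / 2 - (\<Sum>v\<in>A. (1 - e x v) * s v)"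
      if "real (card A) = n" "(\<Sum>v\<in>A. e x v) = n * (4/5 + s x)" for A
    proof -
      have "(\<Sum>v\<in>A. (1 - e x v) * (1/2 - s v))
        = (\<Sum>v\<in>A. 1 - e x v) * (1/2) - (\<Sum>v\<in>A. (1 - e x v) * s v)"
        unfolding sum_distrib_right by (simp add: sum_subtractf[symmetric] algebra_simps)
      moreover have "(\<Sum>v\<in>A. 1 - e x v) = n * (1/5 - s x)"
        using that by (simp add: sum_subtractf algebra_simps)
      ultimately show ?thesis by simp
    qed
    from this[OF cards(2) deg(1)[OF x]] this[OF cards(3) deg(2)[OF x]]
    show ?thesis by (simp add: a_def)
  qed
  have 6: "(\<Sum>y\<in>Y. e x y * (1 - s y)) + (\<Sum>z\<in>Z. e x z * (1 - s z)) - n * (4/5 + s x)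
      = n * (4/5 + s x) - 2 * sum s X + a"
    using deg(1)[OF x] deg(2)[OF x] sum_s unfolding a_def
    by (simp add: right_diff_distrib left_diff_distrib sum_subtractf algebra_simps)
  have 7: "\<delta> * (3/5 * Th x) \<le> \<delta> * ((\<Sum>y\<in>Y. th x y) + (\<Sum>z\<in>Z. th x z) - Th x)"
    using 4 delta_pos by simp
  have 8: "(1 - s x) * (n * (4/5 + s x) - 2 * sum s X + a)
    \<le> (1 - s x) * (n * (4/5 + s x) - 2 * sum s X) + a"
    using s_nonneg[of x] \<open>0 \<le> a\<close> by (simp add: algebra_simps)
  have "2 * (n * (3/5 + 3/4 * s x)) * t + 3/5 * \<delta> * t + T - c \<le> R"
    if "A + B + C + P = S" "A \<ge> n * (3/5 + 3/4 * s x) * t" "B \<ge> n * (3/5 + 3/4 * s x) * t"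
      "C \<ge> T - p - q" "\<delta> * (3/5 * t) \<le> P" "S \<le> R + a" "p + q = c - a"
    for A B C P S R t T p q c :: real
  proof -
    have "2 * (n * (3/5 + 3/4 * s x)) * t = 2 * (n * (3/5 + 3/4 * s x) * t)"
      "3/5 * \<delta> * t = \<delta> * (3/5 * t)" by simp_all
    then show ?thesis using that by linarith
  qed
  from this[OF _ 1 2 3 7 8 5] show ?thesis
    using vertex_identity[OF x] unfolding pull_th 6 by blast
qed

text \<open>The converse estimate, obtained by dropping the restriction to neighbours of
  \<open>x\<close> in nonnegative terms: when \<open>opposite_sum\<close> is small, it forces
  \<open>Th x\<close> to be large.\<close>

lemma vertex_upper:
  assumes x: "x \<in> X"
  shows "(1 - s x) * (n * (4/5 + s x) - 2 * sum s X) \<le> (n * (8/5 + 2 * s x) + \<delta>) * Th x + opposite_sum"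
proof -
  interpret w: tripartite_potential X Z Y by (rule swap)
  have 1: "(\<Sum>y\<in>Y. th x y * (\<Sum>z\<in>Z. e x z * e y z * kappa y z)) \<le> n * (4/5 + s x) * Th x"
  proof -
    have "(\<Sum>y\<in>Y. th x y * (\<Sum>z\<in>Z. e x z * e y z * kappa y z))
      \<le> (\<Sum>y\<in>Y. th x y * (m y * (n * (4/5 + s x))))"
      using x kappa_codegree(2) th_nonneg(1) by (intro sum_mono mult_left_mono) auto
    also have "\<dots> = n * (4/5 + s x) * Th x"
      by (simp add: Th_m(1)[OF x, symmetric] sum_distrib_left sum_distrib_right mult_ac)
    finally show ?thesis .
  qed
  have 2: "(\<Sum>z\<in>Z. th x z * (\<Sum>y\<in>Y. e x y * e z y * kappa z y)) \<le> n * (4/5 + s x) * Th x"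
  proof -
    have "(\<Sum>z\<in>Z. th x z * (\<Sum>y\<in>Y. e x y * e z y * kappa z y))
      \<le> (\<Sum>z\<in>Z. th x z * (m z * (n * (4/5 + s x))))"
      using x w.kappa_codegree(2) th_nonneg(3) by (intro sum_mono mult_left_mono) auto
    also have "\<dots> = n * (4/5 + s x) * Th x"
      by (simp add: Th_m(2)[OF x, symmetric] sum_distrib_left sum_distrib_right mult_ac)
    finally show ?thesis .
  qed
  have 3: "(\<Sum>y\<in>Y. \<Sum>z\<in>Z. e x y * e x z * (kappa y z * th y z)) \<le> opposite_sum"
    unfolding opposite_sum_def
  proof (intro sum_mono)
    fix y z assume "y \<in> Y" "z \<in> Z"
    then have "0 \<le> kappa y z * th y z" using kappa_bounds(1)[of y z] th_nonneg(2) by simp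
    then show "e x y * e x z * (kappa y z * th y z) \<le> kappa y z * th y z"
      using e01[of x y] e01[of x z] by auto
  qed
  have 4: "(\<Sum>y\<in>Y. th x y) + (\<Sum>z\<in>Z. th x z) - Th x \<le> Th x"
  proof -
    have m: "a \<le> m v * a" if "0 \<le> a" for v a
      using mult_right_mono[OF m_bounds(1)[of v] that] by simp
    have "(\<Sum>y\<in>Y. th x y) \<le> Th x"
      using m th_nonneg(1)[OF x] unfolding Th_m(1)[OF x, symmetric] by (intro sum_mono) auto
    moreover have "(\<Sum>z\<in>Z. th x z) \<le> Th x"
      using m th_nonneg(3)[OF x] unfolding Th_m(2)[OF x, symmetric] by (intro sum_mono) auto
    ultimately show ?thesis by linarith
  qed
  have 5: "\<delta> * ((\<Sum>y\<in>Y. th x y) + (\<Sum>z\<in>Z. th x z) - Th x) \<le> \<delta> * Th x"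
    using 4 delta_pos by simp
  have 6: "(\<Sum>y\<in>Y. e x y * s y) \<le> sum s X" "(\<Sum>z\<in>Z. e x z * s z) \<le> sum s X"
    using sum_mono[of Y "\<lambda>y. e x y * s y" s] sum_mono[of Z "\<lambda>y. e x y * s y" s]
      mult_right_mono[OF e_bounds(2) s_nonneg] sum_s by auto
  have "(1 - s x) * (n * (4/5 + s x) - 2 * sum s X)
    \<le> (1 - s x) * ((\<Sum>y\<in>Y. e x y * (1 - s y)) + (\<Sum>z\<in>Z. e x z * (1 - s z)) - n * (4/5 + s x))"
    using 6 deg(1)[OF x] deg(2)[OF x] s_le[of x]
    by (intro mult_left_mono) (auto simp: right_diff_distrib sum_subtractf)
  moreover have "L \<le> (n * (8/5 + 2 * s x) + \<delta>) * t + T"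
    if "L \<le> R" "A + B + C + P = R" "A \<le> n * (4/5 + s x) * t" "B \<le> n * (4/5 + s x) * t"
      "C \<le> T" "P \<le> \<delta> * t" for L R A B C P t T :: real
  proof -
    have "(n * (8/5 + 2 * s x) + \<delta>) * t = 2 * (n * (4/5 + s x) * t) + \<delta> * t"
      by (simp add: field_simps)
    then show ?thesis using that by linarith
  qed
  ultimately show ?thesis
    using vertex_identity[OF x] 1 2 3 5 unfolding pull_th by blast
qed

section \<open>Comparing the three pairs of classes\<close>

text \<open>Splitting \<open>kappa\<close> expresses the sum through \<open>Th\<close>. The leading
  term is the same for every class by \<open>weighted_Th_eq\<close>, so the three opposite sums
  differ only in the excess terms \<open>(m v - 1) * Th v\<close>.\<close>

lemma opposite_sum_eq: "opposite_sum = (\<Sum>y\<in>Y. m y * Th y) - (\<Sum>y\<in>Y. (m y - 1) * Th y) - (\<Sum>z\<in>Z. (m z - 1) * Th z)"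
proof -
  have 1: "(\<Sum>y\<in>Y. \<Sum>z\<in>Z. m z * th y z) = sum Th Y" by (simp add: Th_m(4))
  have "(\<Sum>y\<in>Y. \<Sum>z\<in>Z. m y * th y z) = (\<Sum>z\<in>Z. \<Sum>y\<in>Y. m y * th z y)"
    by (subst sum.swap) (simp add: th_sym)
  then have 2: "(\<Sum>y\<in>Y. \<Sum>z\<in>Z. m y * th y z) = sum Th Z" by (simp add: Th_m(6))
  have 3: "(\<Sum>y\<in>Y. \<Sum>z\<in>Z. m y * (m z * th y z)) = (\<Sum>y\<in>Y. m y * Th y)"
    by (simp add: sum_distrib_left[symmetric] Th_m(4))
  have "(\<Sum>y\<in>Y. \<Sum>z\<in>Z. m y * (m z * th y z)) = (\<Sum>z\<in>Z. \<Sum>y\<in>Y. m z * (m y * th z y))"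
    by (subst sum.swap) (simp add: th_sym mult.left_commute)
  then have 4: "(\<Sum>y\<in>Y. m y * Th y) = (\<Sum>z\<in>Z. m z * Th z)"
    by (simp add: sum_distrib_left[symmetric] Th_m(4) Th_m(6))
  have "opposite_sum = (\<Sum>y\<in>Y. \<Sum>z\<in>Z. m z * th y z) + (\<Sum>y\<in>Y. \<Sum>z\<in>Z. m y * th y z)
      - (\<Sum>y\<in>Y. \<Sum>z\<in>Z. m y * (m z * th y z))"
    unfolding opposite_sum_def by (simp add: kappa_def sum.distrib[symmetric] sum_subtractf[symmetric] algebra_simps)
  then show ?thesis
    unfolding 1 2 3 using 4 by (simp add: left_diff_distrib sum_subtractf)
qed

lemma weighted_Th_eq: "(\<Sum>y\<in>Y. m y * Th y) = (\<Sum>x\<in>X. m x * Th x)"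
proof -
  have "(\<Sum>y\<in>Y. m y * Th y) = (\<Sum>y\<in>Y. \<Sum>x\<in>X. m y * (m x * th y x))"
    by (simp add: Th_m(3)[symmetric] sum_distrib_left)
  also have "\<dots> = (\<Sum>x\<in>X. \<Sum>y\<in>Y. m x * (m y * th x y))"
    by (subst sum.swap) (simp add: th_sym mult.left_commute)
  also have "\<dots> = (\<Sum>x\<in>X. m x * Th x)"
    by (simp add: Th_m(1)[symmetric] sum_distrib_left)
  finally show ?thesis .
qed

text \<open>Since \<open>m v - 1 = m v * s v\<close>, the estimate
  \<open>1/2 - s v \<le> (1 - s v)\<^sup>2 / 2\<close> lets \<open>m v\<close> cancel against a
  factor \<open>1 - s v\<close>.\<close>

lemma excess_upper:
  assumes "A \<subseteq> X \<union> Y \<union> Z"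
  shows "(\<Sum>v\<in>A. (m v - 1) * Th v) \<le> (sum s A - (\<Sum>v\<in>A. (s v)\<^sup>2)) / 2"
proof -
  have "(m v - 1) * Th v \<le> (s v - (s v)\<^sup>2) / 2" if "v \<in> A" for v
  proof -
    have "(m v - 1) * Th v \<le> (m v * s v) * (1/2 - s v)"
      using m_eq[of v] Th_le[of v] Th_nonneg[of v] m_bounds(3)[of v] s_nonneg[of v] assms that
      by (intro mult_mono) auto
    also have "\<dots> \<le> (m v * s v) * ((1 - s v)\<^sup>2 / 2)"
      using m_bounds(3)[of v] s_nonneg[of v] by (intro mult_left_mono) (auto simp: power2_eq_square algebra_simps)
    also have "\<dots> = (m v * (1 - s v)) * (s v - (s v)\<^sup>2) / 2"
      by (simp add: power2_eq_square algebra_simps)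
    finally show ?thesis by (simp add: m_inverse)
  qed
  then have "(\<Sum>v\<in>A. (m v - 1) * Th v) \<le> (\<Sum>v\<in>A. (s v - (s v)\<^sup>2) / 2)"
    by (intro sum_mono)
  then show ?thesis by (simp add: sum_divide_distrib[symmetric] sum_subtractf)
qed

section \<open>Consequences of a critical vertex\<close>

lemma critical_opposite_sum_le:
  assumes x: "x \<in> X" and crit: "Th x = 1/2 - s x"
  defines "u \<equiv> sum s X / n" and "dl \<equiv> \<delta> / n" and "T \<equiv> opposite_sum / n"
  shows "T \<le> 2/5 - 2*u + s x * (2*u - 7/20) + (s x)\<^sup>2/2 - 3/5 * dl * (1/2 - s x)"
proof -
  have eqs: "sum s X = n * u" "\<delta> = n * dl" "opposite_sum = n * T"
    using n_pos by (simp_all add: u_def dl_def T_def)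
  have "0 \<le> (1 - s x) * (n * (4/5 + s x) - 2 * (n * u)) - (2 * (n * (3/5 + 3/4 * s x)) * (1/2 - s x)
      + 3/5 * (n * dl) * (1/2 - s x) + n * T - n * (1/5 - s x))"
    using vertex_lower[OF x] unfolding crit eqs by simp
  also have "\<dots> = n * (2/5 - 2*u + s x * (2*u - 7/20) + (s x)\<^sup>2/2 - 3/5 * dl * (1/2 - s x) - T)"
    by (simp add: field_simps power2_eq_square)
  finally show ?thesis using n_pos by (simp add: zero_le_mult_iff)
qed

lemma sum_s_le: "0 \<le> sum s X" "sum s X \<le> n / 5"
proof -
  show "0 \<le> sum s X" using s_nonneg by (intro sum_nonneg)
  have "sum s X \<le> of_nat (card X) * (1/5)" using s_le by (intro sum_bounded_above)
  then show "sum s X \<le> n / 5" using cards by simp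
qed

text \<open>One critical vertex makes \<open>opposite_sum\<close> small, and
  \<open>vertex_upper\<close> turns this into a lower bound at every vertex of the same class. The
  value \<open>17/100\<close> leaves a slack of \<open>3/100\<close>, and being below
  \<open>9/50\<close> it lets the term in \<open>\<delta>\<close> be absorbed.\<close>

lemma critical_Th_ge:
  assumes x0: "x0 \<in> X" and crit: "Th x0 = 1/2 - s x0" and x: "x \<in> X"
  shows "17/100 \<le> Th x"
proof -
  define u where "u = sum s X / n"
  define dl where "dl = \<delta> / n"
  define T where "T = opposite_sum / n"
  have eqs: "sum s X = n * u" "\<delta> = n * dl" "opposite_sum = n * T"
    using n_pos by (simp_all add: u_def dl_def T_def)
  have u: "0 \<le> u" "u \<le> 1/5" using sum_s_le n_pos by (auto simp: u_def field_simps)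
  have dl: "0 < dl" using delta_pos n_pos by (simp add: dl_def)
  have T: "T \<le> 2/5 - 2*u + s x0 * (2*u - 7/20) + (s x0)\<^sup>2/2 - 3/5 * dl * (1/2 - s x0)"
    using critical_opposite_sum_le[OF x0 crit] by (simp add: u_def dl_def T_def)
  have "0 \<le> s x0 * (2/5 - 2 * u) + 1/2 * (s x0 * (1/5 - s x0)) + 3/5 * dl * (1/5 - s x0)"
    using u dl s_nonneg[of x0] s_le[of x0] by (intro add_nonneg_nonneg mult_nonneg_nonneg) auto
  also have "\<dots> = 3/20 * s x0 - 9/50 * dl
      - (s x0 * (2*u - 7/20) + (s x0)\<^sup>2/2 - 3/5 * dl * (1/2 - s x0))"
    by (simp add: field_simps power2_eq_square)
  finally have T': "T \<le> 2/5 - 2*u + 3/100 - 9/50 * dl"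
    using T s_le[of x0] by linarith
  have "0 \<le> n * ((8/5 + 2 * s x + dl) * Th x + T - (1 - s x) * (4/5 + s x - 2 * u))"
    using vertex_upper[OF x] unfolding eqs by (simp add: algebra_simps)
  then have V: "(1 - s x) * (4/5 + s x - 2 * u) \<le> (8/5 + 2 * s x + dl) * Th x + T"
    using n_pos by (simp add: zero_le_mult_iff)
  show ?thesis
  proof (rule ccontr)
    assume "\<not> ?thesis"
    then have "(8/5 + 2 * s x + dl) * Th x \<le> (8/5 + 2 * s x + dl) * (17/100)"
      using s_nonneg[of x] dl by (intro mult_left_mono) auto
    with V T' have "(1 - s x) * (4/5 + s x - 2 * u) \<le> 2/5 - 2*u + 3/100 + 68/250 + 17/50 * s x"
      using dl by (simp add: algebra_simps)
    moreover have "(1 - s x) * (4/5 + s x - 2 * u)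
      = 2/5 - 2*u + 3/100 + 68/250 + 17/50 * s x + 3/100 + 2 * (u * s x)
        + (1/5 - s x) * (s x + 17/50)"
      by (simp add: field_simps power2_eq_square)
    moreover have "0 \<le> u * s x" "0 \<le> (1/5 - s x) * (s x + 17/50)"
      using u s_nonneg[of x] s_le[of x] by auto
    ultimately show False by linarith
  qed
qed

section \<open>The variational lower bound for the total potential\<close>

definition tri_weight :: "'a \<Rightarrow> 'a \<Rightarrow> 'a \<Rightarrow> real" where
  "tri_weight x y z = e x y * e x z * e y z * (m x * m y * m z)"

lemma tri_weight_nonneg: "0 \<le> tri_weight x y z"
  unfolding tri_weight_def using e_bounds m_bounds(3) by (intro mult_nonneg_nonneg) (auto intro: less_imp_le)

lemma load_tri_weight:
  assumes "x \<in> X" "y \<in> Y"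
  shows "(\<Sum>z\<in>Z. tri_weight x y z * (th x y + th x z + th y z)) + \<delta> * (m x * m y * th x y) = e x y"
proof -
  have "(\<Sum>z\<in>Z. tri_weight x y z * (th x y + th x z + th y z)) + \<delta> * (m x * m y * th x y)
    = m x * m y * (e x y * (\<Sum>z\<in>Z. e x z * e y z * m z * (th x y + th x z + th y z)) + \<delta> * th x y)"
    unfolding tri_weight_def by (simp add: sum_distrib_left distrib_left mult_ac)
  also have "\<dots> = e x y * (m x * (1 - s x)) * (m y * (1 - s y))"
    unfolding load_m[OF assms] by (simp add: mult_ac)
  finally show ?thesis by (simp add: m_inverse)
qed

text \<open>The symmetric bilinear form of the regularised load system, evaluated on edge
  potentials.\<close>

definition form :: "('a \<Rightarrow> 'a \<Rightarrow> real) \<Rightarrow> ('a \<Rightarrow> 'a \<Rightarrow> real) \<Rightarrow> real" where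
  "form f g = (\<Sum>x\<in>X. \<Sum>y\<in>Y. \<Sum>z\<in>Z. tri_weight x y z * ((f x y + f x z + f y z) * (g x y + g x z + g y z)))
    + \<delta> * ((\<Sum>x\<in>X. \<Sum>y\<in>Y. m x * m y * (f x y * g x y)) + (\<Sum>x\<in>X. \<Sum>z\<in>Z. m x * m z * (f x z * g x z))
      + (\<Sum>y\<in>Y. \<Sum>z\<in>Z. m y * m z * (f y z * g y z)))"

text \<open>The triple sum is regrouped by the edges of a triangle, and each inner sum is evaluated
  by a load equation: \<open>th\<close> solves the system whose right-hand side is the indicator of
  the edges.\<close>

lemma form_th:
  "form th f = (\<Sum>x\<in>X. \<Sum>y\<in>Y. e x y * f x y) + (\<Sum>x\<in>X. \<Sum>z\<in>Z. e x z * f x z)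
    + (\<Sum>y\<in>Y. \<Sum>z\<in>Z. e y z * f y z)"
proof -
  interpret w: tripartite_potential X Z Y by (rule swap)
  interpret r: tripartite_potential Y Z X by (rule rotate)
  define q where "q x y z = th x y + th x z + th y z" for x y z
  have xy: "(\<Sum>z\<in>Z. tri_weight x y z * q x y z) = e x y - \<delta> * (m x * m y * th x y)" if "x \<in> X" "y \<in> Y" for x y
    using load_tri_weight[OF that] by (simp add: q_def algebra_simps)
  have xz: "(\<Sum>y\<in>Y. tri_weight x y z * q x y z) = e x z - \<delta> * (m x * m z * th x z)" if "x \<in> X" "z \<in> Z" for x z
  proof -
    have "w.tri_weight x z y * (th x z + th x y + th z y) = tri_weight x y z * q x y z" for y
      by (simp add: w.tri_weight_def tri_weight_def q_def e_sym[of z y] th_sym[of z y] mult_ac add_ac)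
    then show ?thesis using w.load_tri_weight[OF that] by (simp add: algebra_simps)
  qed
  have yz: "(\<Sum>x\<in>X. tri_weight x y z * q x y z) = e y z - \<delta> * (m y * m z * th y z)" if "y \<in> Y" "z \<in> Z" for y z
  proof -
    have "r.tri_weight y z x * (th y z + th y x + th z x) = tri_weight x y z * q x y z" for x
      by (simp add: r.tri_weight_def tri_weight_def q_def e_sym[of z x] th_sym[of z x] e_sym[of y x] th_sym[of y x] mult_ac add_ac)
    then show ?thesis using r.load_tri_weight[OF that] by (simp add: algebra_simps)
  qed
  have "(\<Sum>x\<in>X. \<Sum>y\<in>Y. \<Sum>z\<in>Z. tri_weight x y z * (q x y z * (f x y + f x z + f y z)))
    = (\<Sum>x\<in>X. \<Sum>y\<in>Y. (\<Sum>z\<in>Z. tri_weight x y z * q x y z) * f x y)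
      + (\<Sum>x\<in>X. \<Sum>z\<in>Z. (\<Sum>y\<in>Y. tri_weight x y z * q x y z) * f x z)
      + (\<Sum>y\<in>Y. \<Sum>z\<in>Z. (\<Sum>x\<in>X. tri_weight x y z * q x y z) * f y z)"
  proof -
    have "(\<Sum>x\<in>X. \<Sum>y\<in>Y. \<Sum>z\<in>Z. tri_weight x y z * (q x y z * (f x y + f x z + f y z)))
      = (\<Sum>x\<in>X. \<Sum>y\<in>Y. \<Sum>z\<in>Z. tri_weight x y z * q x y z * f x y)
      + (\<Sum>x\<in>X. \<Sum>y\<in>Y. \<Sum>z\<in>Z. tri_weight x y z * q x y z * f x z)
      + (\<Sum>x\<in>X. \<Sum>y\<in>Y. \<Sum>z\<in>Z. tri_weight x y z * q x y z * f y z)"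
      by (simp add: sum.distrib[symmetric] distrib_left mult.assoc)
    moreover have "(\<Sum>x\<in>X. \<Sum>y\<in>Y. \<Sum>z\<in>Z. tri_weight x y z * q x y z * f x z)
      = (\<Sum>x\<in>X. \<Sum>z\<in>Z. (\<Sum>y\<in>Y. tri_weight x y z * q x y z) * f x z)"
      unfolding sum_distrib_right by (intro sum.cong refl sum.swap)
    moreover have "(\<Sum>x\<in>X. \<Sum>y\<in>Y. \<Sum>z\<in>Z. tri_weight x y z * q x y z * f y z)
      = (\<Sum>y\<in>Y. \<Sum>x\<in>X. \<Sum>z\<in>Z. tri_weight x y z * q x y z * f y z)"
      by (rule sum.swap)
    moreover have "\<dots> = (\<Sum>y\<in>Y. \<Sum>z\<in>Z. (\<Sum>x\<in>X. tri_weight x y z * q x y z) * f y z)"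
      unfolding sum_distrib_right by (intro sum.cong refl sum.swap)
    ultimately show ?thesis by (simp add: sum_distrib_right)
  qed
  also have "\<dots> = (\<Sum>x\<in>X. \<Sum>y\<in>Y. (e x y - \<delta> * (m x * m y * th x y)) * f x y)
      + (\<Sum>x\<in>X. \<Sum>z\<in>Z. (e x z - \<delta> * (m x * m z * th x z)) * f x z)
      + (\<Sum>y\<in>Y. \<Sum>z\<in>Z. (e y z - \<delta> * (m y * m z * th y z)) * f y z)"
    by (simp add: xy xz yz)
  also have "\<dots> = (\<Sum>x\<in>X. \<Sum>y\<in>Y. e x y * f x y) + (\<Sum>x\<in>X. \<Sum>z\<in>Z. e x z * f x z)
    + (\<Sum>y\<in>Y. \<Sum>z\<in>Z. e y z * f y z)
    - \<delta> * ((\<Sum>x\<in>X. \<Sum>y\<in>Y. m x * m y * (th x y * f x y)) + (\<Sum>x\<in>X. \<Sum>z\<in>Z. m x * m z * (th x z * f x z))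
      + (\<Sum>y\<in>Y. \<Sum>z\<in>Z. m y * m z * (th y z * f y z)))"
    by (simp add: left_diff_distrib sum_subtractf sum_distrib_left distrib_left mult.assoc)
  finally show ?thesis
    unfolding form_def q_def by simp
qed

text \<open>The form is nonnegative at \<open>th - f\<close>, and \<open>form th th\<close> is the
  total of \<open>th\<close>; every trial potential \<open>f\<close> therefore gives a lower
  bound.\<close>

lemma sum_th_ge:
  "(\<Sum>x\<in>X. \<Sum>y\<in>Y. th x y) + (\<Sum>x\<in>X. \<Sum>z\<in>Z. th x z) + (\<Sum>y\<in>Y. \<Sum>z\<in>Z. th y z)
    \<ge> 2 * form th f - form f f"
proof -
  define h where "h u v = th u v - f u v" for u v
  have square: "0 \<le> k * (a * a)" if "0 \<le> k" for k a :: real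
    using that by simp
  have "0 \<le> form h h"
    unfolding form_def using tri_weight_nonneg m_bounds(3)
    by (intro add_nonneg_nonneg mult_nonneg_nonneg[OF less_imp_le[OF delta_pos]] sum_nonneg square)
      (auto simp: less_imp_le)
  also have "form h h = form th th - 2 * form th f + form f f"
  proof -
    have *: "((a1 - b1) + (a2 - b2) + (a3 - b3)) * ((a1 - b1) + (a2 - b2) + (a3 - b3))
      = (a1 + a2 + a3) * (a1 + a2 + a3) - 2 * ((a1 + a2 + a3) * (b1 + b2 + b3))
        + (b1 + b2 + b3) * (b1 + b2 + b3)" for a1 a2 a3 b1 b2 b3 :: real
      by (simp add: algebra_simps)
    have **: "(a - b) * (a - b) = a * a - 2 * (a * b) + b * b" for a b :: real
      by (simp add: algebra_simps)
    have ***: "k * (p - 2 * q + r) = k * p - 2 * (k * q) + k * r" for k p q r :: real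
      by (simp add: algebra_simps)
    show ?thesis
      unfolding form_def h_def * ** *** sum.distrib sum_subtractf sum_distrib_left[symmetric]
      by (simp add: algebra_simps)
  qed
  also have "form th th = (\<Sum>x\<in>X. \<Sum>y\<in>Y. th x y) + (\<Sum>x\<in>X. \<Sum>z\<in>Z. th x z) + (\<Sum>y\<in>Y. \<Sum>z\<in>Z. th y z)"
    by (simp add: form_th th_supp)
  finally show ?thesis by simp
qed

text \<open>All terms of the load equation are nonnegative, so it suffices to keep
  \<open>th x y\<close> once for each common neighbour, with total weight at least
  \<open>3/5 * n\<close>.\<close>

lemma th_le:
  assumes "x \<in> X" "y \<in> Y"
  shows "n * (3/5) * th x y \<le> (1 - s x) * (1 - s y)"
proof (cases "e x y = 0")
  case True
  then have "th x y = 0" using th_supp[of x y] by simp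
  then show ?thesis using s_le_1 by simp
next
  case False
  then have e1: "e x y = 1" using e01[of x y] by auto
  have "n * (3/5) * th x y \<le> (\<Sum>z\<in>Z. e x z * e y z * m z) * th x y"
    using codegree_weighted[OF assms] th_nonneg(1)[OF assms] by (intro mult_right_mono)
  also have "\<dots> \<le> (\<Sum>z\<in>Z. e x z * e y z * m z * (th x y + th x z + th y z))"
    unfolding sum_distrib_right
  proof (intro sum_mono mult_left_mono)
    fix z assume "z \<in> Z"
    then show "th x y \<le> th x y + th x z + th y z" using assms th_nonneg(2,3) by simp
    show "0 \<le> e x z * e y z * m z"
      using e_bounds m_bounds(3) by (intro mult_nonneg_nonneg) (auto intro: less_imp_le)
  qed
  also have "\<dots> \<le> (1 - s x) * (1 - s y)"
    using load_m[OF assms] mult_nonneg_nonneg[OF less_imp_le[OF delta_pos] th_nonneg(1)[OF assms]]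
    unfolding e1 by linarith
  finally show ?thesis .
qed

text \<open>\<open>kappa x y\<close> differs from \<open>1\<close> by
  \<open>(m x - 1) * (m y - 1)\<close>; multiplied by the factors
  \<open>(1 - s x) * (1 - s y)\<close> from \<open>th_le\<close>, this becomes
  \<open>s x * s y\<close>.\<close>

lemma kappa_th_ge:
  assumes "x \<in> X" "y \<in> Y"
  shows "kappa x y * th x y \<ge> th x y - 5/3 * (e x y * (s x * s y)) / n"
proof (cases "e x y = 0")
  case True
  then show ?thesis using th_supp[of x y] by simp
next
  case False
  then have e1: "e x y = 1" using e01[of x y] by auto
  have "(m x - 1) * (m y - 1) = (m x * s x) * (m y * s y)"
    using m_eq[of x] m_eq[of y] by (metis add_diff_cancel_left')
  then have "(m x - 1) * (m y - 1) * (n * (3/5) * th x y) \<le> (m x * s x) * (m y * s y) * ((1 - s x) * (1 - s y))"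
    using th_le[OF assms] m_bounds(3) s_nonneg by (simp only:) (intro mult_left_mono mult_nonneg_nonneg, auto intro: less_imp_le)
  also have "\<dots> = (m x * (1 - s x)) * (m y * (1 - s y)) * (s x * s y)" by (simp add: mult_ac)
  finally have "(m x - 1) * (m y - 1) * (n * (3/5) * th x y) \<le> s x * s y"
    by (simp add: m_inverse)
  then have "(m x - 1) * (m y - 1) * th x y \<le> 5/3 * (s x * s y) / n"
    using n_pos by (simp add: field_simps)
  moreover have "kappa x y * th x y = th x y - (m x - 1) * (m y - 1) * th x y"
    by (simp add: kappa_def algebra_simps)
  ultimately show ?thesis by (simp add: e1)
qed

lemma s_products:
  "0 \<le> s x * s y" "s x * s y \<le> (s x + s y) / 10" "s x * s y * s z \<le> s x * s y / 5"
proof -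
  show 1: "0 \<le> s x * s y" using s_nonneg by simp
  have "s x * s y \<le> s x * (1/5)" "s y * s x \<le> s y * (1/5)"
    by (rule mult_left_mono[OF s_le s_nonneg])+
  then show "s x * s y \<le> (s x + s y) / 10" by (simp add: mult.commute)
  show "s x * s y * s z \<le> s x * s y / 5"
    using mult_left_mono[OF s_le[of z] 1] by simp
qed

text \<open>The coefficients are chosen so that the sum over a triangle is a lower approximation of
\<open>(1 - s x) * (1 - s y) * (1 - s z)\<close>, with error of second order in \<open>s\<close>.\<close>

definition trial :: "'a \<Rightarrow> 'a \<Rightarrow> real" where
  "trial u v = 1/3 - (s u + s v) / 2 + 4/5 * (s u * s v)"

text \<open>\<open>trial x y\<close> is at most \<open>(1 - s x) * (1 - s y) / 3\<close>; after
  squaring, \<open>m x * m y\<close> cancels one copy of \<open>(1 - s x) * (1 - s y)\<close>. The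
  next lemma does the same for a triangle.\<close>

lemma trial_pair: "0 \<le> trial x y" "m x * m y * (trial x y)\<^sup>2 \<le> (1 - s x) * (1 - s y) / 9"
proof -
  show 0: "0 \<le> trial x y"
    unfolding trial_def using s_products(1)[of x y] s_le[of x] s_le[of y] by simp
  have "0 \<le> 7/15 * ((s x + s y) / 10 - s x * s y) + 3/25 * (s x + s y)"
    using s_products(2)[of x y] s_nonneg[of x] s_nonneg[of y] by simp
  also have "\<dots> = (1 - s x) * (1 - s y) / 3 - trial x y"
    by (simp add: trial_def field_simps)
  finally have "trial x y \<le> (1 - s x) * (1 - s y) / 3" by simp
  then have "(trial x y)\<^sup>2 \<le> ((1 - s x) * (1 - s y) / 3)\<^sup>2" using 0 by (intro power_mono)
  then have "m x * m y * (trial x y)\<^sup>2 \<le> m x * m y * ((1 - s x) * (1 - s y) / 3)\<^sup>2"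
    using m_bounds(3) by (intro mult_left_mono) (auto simp: less_imp_le)
  also have "\<dots> = (m x * (1 - s x)) * (m y * (1 - s y)) * ((1 - s x) * (1 - s y) / 9)"
    by (simp add: power2_eq_square)
  finally show "m x * m y * (trial x y)\<^sup>2 \<le> (1 - s x) * (1 - s y) / 9" by (simp add: m_inverse)
qed

lemma trial_triangle:
  "m x * m y * m z * (trial x y + trial x z + trial y z)\<^sup>2 \<le> (1 - s x) * (1 - s y) * (1 - s z)"
proof -
  have 0: "0 \<le> trial x y + trial x z + trial y z" using trial_pair(1) by (intro add_nonneg_nonneg)
  have "0 \<le> (s x * s y / 5 - s x * s y * s z) + 1/5 * (s x * s z) + 1/5 * (s y * s z)"
    using s_products(1)[of x z] s_products(1)[of y z] s_products(3)[of x y z] by simp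
  also have "\<dots> = (1 - s x) * (1 - s y) * (1 - s z) - (trial x y + trial x z + trial y z)"
    by (simp add: trial_def field_simps)
  finally have "trial x y + trial x z + trial y z \<le> (1 - s x) * (1 - s y) * (1 - s z)" by simp
  then have "(trial x y + trial x z + trial y z)\<^sup>2 \<le> ((1 - s x) * (1 - s y) * (1 - s z))\<^sup>2"
    using 0 by (intro power_mono)
  then have "m x * m y * m z * (trial x y + trial x z + trial y z)\<^sup>2
    \<le> m x * m y * m z * ((1 - s x) * (1 - s y) * (1 - s z))\<^sup>2"
    using m_bounds(3) by (intro mult_left_mono) (auto simp: less_imp_le)
  also have "\<dots> = (m x * (1 - s x)) * (m y * (1 - s y)) * (m z * (1 - s z))
      * ((1 - s x) * (1 - s y) * (1 - s z))"
    by (simp add: power2_eq_square)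
  finally show ?thesis by (simp add: m_inverse)
qed

section \<open>Weighted counts of edges, non-edges and triangles\<close>

text \<open>The inequality of arithmetic and geometric means splits the product into contributions
  of the two ends, and \<open>(4/5 + s v) * (1 - s v)\<^sup>2\<close> is at most
  \<open>4/5\<close>.\<close>

lemma sum_edges_r: "(\<Sum>x\<in>X. \<Sum>y\<in>Y. e x y * ((1 - s x) * (1 - s y))) \<le> 4/5 * n\<^sup>2"
proof -
  have deg_r: "(\<Sum>v\<in>A. n * (4/5 + s v) * (1 - s v)\<^sup>2) \<le> 4/5 * n\<^sup>2" if "real (card A) = n" for A
  proof -
    have "n * (4/5 + s v) * (1 - s v)\<^sup>2 \<le> n * (4/5)" for v
    proof -
      have "0 \<le> s v * (3/5 + 6/5 * s v - (s v)\<^sup>2)"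
        using s_nonneg[of v] s_le[of v] power_mono[OF s_le s_nonneg, of v 2]
        by (intro mult_nonneg_nonneg) (auto simp: power2_eq_square)
      also have "\<dots> = 4/5 - (4/5 + s v) * (1 - s v)\<^sup>2"
        by (simp add: field_simps power2_eq_square)
      finally show ?thesis using n_pos by simp
    qed
    then have "(\<Sum>v\<in>A. n * (4/5 + s v) * (1 - s v)\<^sup>2) \<le> of_nat (card A) * (n * (4/5))"
      by (intro sum_bounded_above)
    then show ?thesis using that by (simp add: power2_eq_square)
  qed
  have "(\<Sum>x\<in>X. \<Sum>y\<in>Y. e x y * ((1 - s x) * (1 - s y)))
    \<le> (\<Sum>x\<in>X. \<Sum>y\<in>Y. e x y * ((1 - s x)\<^sup>2 / 2) + e x y * ((1 - s y)\<^sup>2 / 2))"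
  proof (intro sum_mono)
    fix x y
    have "0 \<le> ((1 - s x) - (1 - s y))\<^sup>2 / 2" by simp
    also have "\<dots> = (1 - s x)\<^sup>2 / 2 + (1 - s y)\<^sup>2 / 2 - (1 - s x) * (1 - s y)"
      by (simp add: power2_eq_square field_simps)
    finally have "(1 - s x) * (1 - s y) \<le> (1 - s x)\<^sup>2 / 2 + (1 - s y)\<^sup>2 / 2" by simp
    then show "e x y * ((1 - s x) * (1 - s y)) \<le> e x y * ((1 - s x)\<^sup>2 / 2) + e x y * ((1 - s y)\<^sup>2 / 2)"
      using e_bounds(1)[of x y] unfolding distrib_left[symmetric] by (intro mult_left_mono)
  qed
  also have "\<dots> = (\<Sum>x\<in>X. (\<Sum>y\<in>Y. e x y) * ((1 - s x)\<^sup>2 / 2)) + (\<Sum>y\<in>Y. (\<Sum>x\<in>X. e y x) * ((1 - s y)\<^sup>2 / 2))"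
  proof -
    have "(\<Sum>x\<in>X. \<Sum>y\<in>Y. e x y * ((1 - s y)\<^sup>2 / 2)) = (\<Sum>y\<in>Y. (\<Sum>x\<in>X. e y x) * ((1 - s y)\<^sup>2 / 2))"
      unfolding sum_distrib_right by (subst sum.swap) (simp add: e_sym)
    then show ?thesis by (simp only: sum.distrib sum_distrib_right)
  qed
  also have "\<dots> = (\<Sum>x\<in>X. n * (4/5 + s x) * (1 - s x)\<^sup>2) / 2 + (\<Sum>y\<in>Y. n * (4/5 + s y) * (1 - s y)\<^sup>2) / 2"
    by (simp add: deg sum_divide_distrib)
  also have "\<dots> \<le> 4/5 * n\<^sup>2"
    using deg_r[OF cards(1)] deg_r[OF cards(2)] by simp
  finally show ?thesis .
qed

text \<open>The affine part of \<open>trial\<close> is evaluated exactly by counting degrees. The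
  products \<open>s x * s y\<close> over edges are kept: they later outweigh the loss in
  \<open>kappa_th_ge\<close>.\<close>

lemma sum_edges_trial:
  "(\<Sum>x\<in>X. \<Sum>y\<in>Y. e x y * trial x y)
    = n * ((4/5 * n + sum s X) / 3 - (8/5 * sum s X + (\<Sum>x\<in>X. (s x)\<^sup>2) + (\<Sum>y\<in>Y. (s y)\<^sup>2)) / 2)
      + 4/5 * (\<Sum>x\<in>X. \<Sum>y\<in>Y. e x y * (s x * s y))"
proof -
  have sq: "(\<Sum>v\<in>A. (n * (4/5 + s v)) * s v) = n * (4/5 * sum s A + (\<Sum>v\<in>A. (s v)\<^sup>2))" for A
    unfolding sum_distrib_left sum.distrib[symmetric]
    by (intro sum.cong refl) (simp add: algebra_simps power2_eq_square)
  have 1: "(\<Sum>x\<in>X. \<Sum>y\<in>Y. e x y) = n * (4/5 * n + sum s X)"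
    using cards by (simp add: deg sum_distrib_left[symmetric] sum.distrib)
  have 2: "(\<Sum>x\<in>X. \<Sum>y\<in>Y. e x y * s x) = n * (4/5 * sum s X + (\<Sum>x\<in>X. (s x)\<^sup>2))"
    by (simp add: sum_distrib_right[symmetric] deg sq)
  have "(\<Sum>x\<in>X. \<Sum>y\<in>Y. e x y * s y) = (\<Sum>y\<in>Y. (\<Sum>x\<in>X. e y x) * s y)"
    unfolding sum_distrib_right by (subst sum.swap) (simp add: e_sym)
  then have 3: "(\<Sum>x\<in>X. \<Sum>y\<in>Y. e x y * s y) = n * (4/5 * sum s X + (\<Sum>y\<in>Y. (s y)\<^sup>2))"
    by (simp add: deg sq sum_s)
  have "(\<Sum>x\<in>X. \<Sum>y\<in>Y. e x y * trial x y)
    = (\<Sum>x\<in>X. \<Sum>y\<in>Y. e x y) * (1/3) - ((\<Sum>x\<in>X. \<Sum>y\<in>Y. e x y * s x) + (\<Sum>x\<in>X. \<Sum>y\<in>Y. e x y * s y)) * (1/2)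
      + (\<Sum>x\<in>X. \<Sum>y\<in>Y. e x y * (s x * s y)) * (4/5)"
    unfolding sum_distrib_right sum.distrib[symmetric] sum_subtractf[symmetric]
    by (intro sum.cong refl) (simp add: trial_def field_simps)
  then show ?thesis unfolding 1 2 3 by (simp add: field_simps)
qed

definition missing :: "'a set \<Rightarrow> 'a set \<Rightarrow> real" where
  "missing A B = (\<Sum>a\<in>A. \<Sum>b\<in>B. (1 - e a b) * ((1 - s a) * (1 - s b)))"

lemma missing_sym: "missing A B = missing B A"
  unfolding missing_def by (subst sum.swap) (simp add: e_sym mult.commute)

lemma sum_r: "(\<Sum>x\<in>X. 1 - s x) = n - sum s X" "(\<Sum>y\<in>Y. 1 - s y) = n - sum s X"
  "(\<Sum>z\<in>Z. 1 - s z) = n - sum s X"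
  using cards sum_s by (simp_all add: sum_subtractf)

lemma missing_ge:
  "missing X Y \<ge> n * (n / 5 - sum s X) - n * (2/5 * sum s X - (\<Sum>x\<in>X. (s x)\<^sup>2) - (\<Sum>y\<in>Y. (s y)\<^sup>2))"
proof -
  have miss: "(\<Sum>v\<in>A. (1 - e u v)) = n * (1/5 - s u)"
    if "real (card A) = n" "(\<Sum>v\<in>A. e u v) = n * (4/5 + s u)" for A u
    using that by (simp add: sum_subtractf algebra_simps)
  have sq: "(\<Sum>v\<in>A. (n * (1/5 - s v)) * s v) = n * (1/5 * sum s A - (\<Sum>v\<in>A. (s v)\<^sup>2))" for A
    unfolding sum_distrib_left sum_subtractf[symmetric]
    by (intro sum.cong refl) (simp add: algebra_simps power2_eq_square)
  have 1: "(\<Sum>x\<in>X. \<Sum>y\<in>Y. (1 - e x y)) = n * (n / 5 - sum s X)"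
    using cards by (simp add: miss deg sum_distrib_left[symmetric] sum_subtractf sum.distrib algebra_simps)
  have 2: "(\<Sum>x\<in>X. \<Sum>y\<in>Y. (1 - e x y) * s x) = n * (1/5 * sum s X - (\<Sum>x\<in>X. (s x)\<^sup>2))"
    using cards by (simp add: sum_distrib_right[symmetric] miss deg sq)
  have "(\<Sum>x\<in>X. \<Sum>y\<in>Y. (1 - e x y) * s y) = (\<Sum>y\<in>Y. (\<Sum>x\<in>X. (1 - e y x)) * s y)"
    unfolding sum_distrib_right by (subst sum.swap) (simp add: e_sym)
  then have 3: "(\<Sum>x\<in>X. \<Sum>y\<in>Y. (1 - e x y) * s y) = n * (1/5 * sum s X - (\<Sum>y\<in>Y. (s y)\<^sup>2))"
    using cards by (simp add: miss deg sq sum_s)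
  have "missing X Y \<ge> (\<Sum>x\<in>X. \<Sum>y\<in>Y. (1 - e x y) * (1 - s x - s y))"
    unfolding missing_def
  proof (intro sum_mono mult_left_mono)
    fix x y
    show "1 - s x - s y \<le> (1 - s x) * (1 - s y)"
      using s_products(1)[of x y] by (simp add: algebra_simps)
    show "0 \<le> 1 - e x y" using e_bounds by simp
  qed
  also have "(\<Sum>x\<in>X. \<Sum>y\<in>Y. (1 - e x y) * (1 - s x - s y))
    = (\<Sum>x\<in>X. \<Sum>y\<in>Y. (1 - e x y)) - (\<Sum>x\<in>X. \<Sum>y\<in>Y. (1 - e x y) * s x)
      - (\<Sum>x\<in>X. \<Sum>y\<in>Y. (1 - e x y) * s y)"
    unfolding sum_subtractf[symmetric] by (intro sum.cong refl) (simp add: algebra_simps)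
  finally show ?thesis unfolding 1 2 3 by (simp add: algebra_simps)
qed

text \<open>The weighted numbers \<open>a x\<close> and \<open>b x\<close> of non-neighbours of
  \<open>x\<close> in the two other classes are at most \<open>n / 5\<close>, which linearises their
  product.\<close>

lemma missing_pair:
  "(\<Sum>x\<in>X. \<Sum>y\<in>Y. \<Sum>z\<in>Z. (1 - e x y) * (1 - e x z) * ((1 - s x) * (1 - s y) * (1 - s z)))
    \<le> n / 10 * (missing X Y + missing X Z)"
proof -
  define a where "a x = (\<Sum>y\<in>Y. (1 - e x y) * (1 - s y))" for x
  define b where "b x = (\<Sum>z\<in>Z. (1 - e x z) * (1 - s z))" for x
  have le: "(\<Sum>v\<in>A. (1 - e x v) * (1 - s v)) \<le> n / 5" "0 \<le> (\<Sum>v\<in>A. (1 - e x v) * (1 - s v))"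
    if "real (card A) = n" "(\<Sum>v\<in>A. e x v) = n * (4/5 + s x)" for A x
  proof -
    have "(\<Sum>v\<in>A. (1 - e x v) * (1 - s v)) \<le> (\<Sum>v\<in>A. (1 - e x v) * 1)"
      using e_bounds s_nonneg by (intro sum_mono mult_left_mono) auto
    also have "\<dots> \<le> n / 5"
      using that n_pos s_nonneg[of x] by (simp add: sum_subtractf algebra_simps)
    finally show "(\<Sum>v\<in>A. (1 - e x v) * (1 - s v)) \<le> n / 5" .
    show "0 \<le> (\<Sum>v\<in>A. (1 - e x v) * (1 - s v))"
      using e_bounds s_le_1 by (intro sum_nonneg mult_nonneg_nonneg) auto
  qed
  have "(\<Sum>x\<in>X. \<Sum>y\<in>Y. \<Sum>z\<in>Z. (1 - e x y) * (1 - e x z) * ((1 - s x) * (1 - s y) * (1 - s z)))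
    = (\<Sum>x\<in>X. (1 - s x) * (a x * b x))"
    unfolding a_def b_def sum_product unfolding sum_distrib_left by (simp add: mult_ac)
  also have "\<dots> \<le> (\<Sum>x\<in>X. (1 - s x) * (n / 10 * (a x + b x)))"
  proof (intro sum_mono mult_left_mono)
    fix x assume x: "x \<in> X"
    have "a x \<le> n / 5" "0 \<le> a x" "b x \<le> n / 5" "0 \<le> b x"
      unfolding a_def b_def using le cards x deg by auto
    then have "0 \<le> (a x * (n / 5 - b x) + b x * (n / 5 - a x)) / 2"
      by (intro divide_nonneg_pos add_nonneg_nonneg mult_nonneg_nonneg) auto
    also have "\<dots> = n / 10 * (a x + b x) - a x * b x" by (simp add: field_simps)
    finally show "a x * b x \<le> n / 10 * (a x + b x)" by simp
    show "0 \<le> 1 - s x" using s_le[of x] by simp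
  qed
  also have "\<dots> = n / 10 * ((\<Sum>x\<in>X. (1 - s x) * a x) + (\<Sum>x\<in>X. (1 - s x) * b x))"
    unfolding sum.distrib[symmetric] sum_distrib_left
    by (intro sum.cong refl) (simp add: field_simps)
  also have "(\<Sum>x\<in>X. (1 - s x) * a x) = missing X Y"
    unfolding a_def missing_def by (simp add: sum_distrib_left mult_ac)
  also have "(\<Sum>x\<in>X. (1 - s x) * b x) = missing X Z"
    unfolding b_def missing_def by (simp add: sum_distrib_left mult_ac)
  finally show ?thesis .
qed

lemma missing_times:
  "(\<Sum>x\<in>X. \<Sum>y\<in>Y. \<Sum>z\<in>Z. (1 - e x y) * ((1 - s x) * (1 - s y) * (1 - s z)))
    = missing X Y * (n - sum s X)"
  unfolding missing_def sum_r(3)[symmetric] sum_distrib_right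
  unfolding sum_distrib_left by (simp add: mult_ac)

text \<open>Bonferroni's inequality, truncated after pairs of missing edges. Each of the three
  \<open>missing\<close> terms occurs in two of the pair bounds, which reduces its factor
  \<open>n - sum s X\<close> by \<open>n / 5\<close>.\<close>

lemma triangle_weight_le:
  "(\<Sum>x\<in>X. \<Sum>y\<in>Y. \<Sum>z\<in>Z. e x y * e x z * e y z * ((1 - s x) * (1 - s y) * (1 - s z)))
    \<le> (n - sum s X)^3 - (n - sum s X - n / 5) * (missing X Y + missing X Z + missing Y Z)"
proof -
  interpret w: tripartite_potential X Z Y by (rule swap)
  interpret r: tripartite_potential Y Z X by (rule rotate)
  interpret r2: tripartite_potential Z X Y by (rule r.rotate)
  define q where "q x y z = (1 - s x) * (1 - s y) * (1 - s z)" for x y z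
  have q0: "0 \<le> q x y z" for x y z
    unfolding q_def using s_le_1 by (intro mult_nonneg_nonneg) auto
  have "(\<Sum>x\<in>X. \<Sum>y\<in>Y. \<Sum>z\<in>Z. e x y * e x z * e y z * q x y z)
    \<le> (\<Sum>x\<in>X. \<Sum>y\<in>Y. \<Sum>z\<in>Z. q x y z - (1 - e x y) * q x y z - (1 - e x z) * q x y z - (1 - e y z) * q x y z
      + (1 - e x y) * (1 - e x z) * q x y z + (1 - e x y) * (1 - e y z) * q x y z
      + (1 - e x z) * (1 - e y z) * q x y z)"
  proof (intro sum_mono)
    fix x y z
    show "e x y * e x z * e y z * q x y z \<le> q x y z - (1 - e x y) * q x y z - (1 - e x z) * q x y z
      - (1 - e y z) * q x y z + (1 - e x y) * (1 - e x z) * q x y z + (1 - e x y) * (1 - e y z) * q x y z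
      + (1 - e x z) * (1 - e y z) * q x y z"
      using e01[of x y] e01[of x z] e01[of y z] q0[of x y z] by auto
  qed
  also have "\<dots> = (\<Sum>x\<in>X. \<Sum>y\<in>Y. \<Sum>z\<in>Z. q x y z) - (\<Sum>x\<in>X. \<Sum>y\<in>Y. \<Sum>z\<in>Z. (1 - e x y) * q x y z)
      - (\<Sum>x\<in>X. \<Sum>y\<in>Y. \<Sum>z\<in>Z. (1 - e x z) * q x y z) - (\<Sum>x\<in>X. \<Sum>y\<in>Y. \<Sum>z\<in>Z. (1 - e y z) * q x y z)
      + (\<Sum>x\<in>X. \<Sum>y\<in>Y. \<Sum>z\<in>Z. (1 - e x y) * (1 - e x z) * q x y z)
      + (\<Sum>x\<in>X. \<Sum>y\<in>Y. \<Sum>z\<in>Z. (1 - e x y) * (1 - e y z) * q x y z)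
      + (\<Sum>x\<in>X. \<Sum>y\<in>Y. \<Sum>z\<in>Z. (1 - e x z) * (1 - e y z) * q x y z)"
    by (simp only: sum.distrib sum_subtractf)
  also have "(\<Sum>x\<in>X. \<Sum>y\<in>Y. \<Sum>z\<in>Z. q x y z) = (n - sum s X)^3"
  proof -
    have "(\<Sum>x\<in>X. \<Sum>y\<in>Y. \<Sum>z\<in>Z. q x y z)
      = (\<Sum>x\<in>X. (1 - s x) * (\<Sum>y\<in>Y. (1 - s y) * (\<Sum>z\<in>Z. 1 - s z)))"
      unfolding q_def sum_distrib_left mult.assoc ..
    then show ?thesis unfolding sum_r(3) sum_distrib_right[symmetric] sum_r(1,2)
      by (simp add: power3_eq_cube mult_ac)
  qed
  also have "(\<Sum>x\<in>X. \<Sum>y\<in>Y. \<Sum>z\<in>Z. (1 - e x y) * q x y z) = missing X Y * (n - sum s X)"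
    unfolding q_def by (rule missing_times)
  also have "(\<Sum>x\<in>X. \<Sum>y\<in>Y. \<Sum>z\<in>Z. (1 - e x z) * q x y z) = missing X Z * (n - sum s X)"
  proof -
    have "(\<Sum>x\<in>X. \<Sum>y\<in>Y. \<Sum>z\<in>Z. (1 - e x z) * q x y z) = (\<Sum>x\<in>X. \<Sum>z\<in>Z. \<Sum>y\<in>Y. (1 - e x z) * q x y z)"
      by (intro sum.cong refl sum.swap)
    also have "\<dots> = missing X Z * (n - sum s X)"
      using w.missing_times unfolding q_def by (simp add: mult_ac)
    finally show ?thesis .
  qed
  also have "(\<Sum>x\<in>X. \<Sum>y\<in>Y. \<Sum>z\<in>Z. (1 - e y z) * q x y z) = missing Y Z * (n - sum s X)"
  proof -
    have "(\<Sum>x\<in>X. \<Sum>y\<in>Y. \<Sum>z\<in>Z. (1 - e y z) * q x y z) = (\<Sum>y\<in>Y. \<Sum>x\<in>X. \<Sum>z\<in>Z. (1 - e y z) * q x y z)"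
      by (rule sum.swap)
    also have "\<dots> = (\<Sum>y\<in>Y. \<Sum>z\<in>Z. \<Sum>x\<in>X. (1 - e y z) * q x y z)"
      by (intro sum.cong refl sum.swap)
    also have "\<dots> = missing Y Z * (n - sum s X)"
      using r.missing_times unfolding q_def sum_s by (simp add: mult_ac)
    finally show ?thesis .
  qed
  finally have main: "(\<Sum>x\<in>X. \<Sum>y\<in>Y. \<Sum>z\<in>Z. e x y * e x z * e y z * q x y z)
    \<le> (n - sum s X)^3 - missing X Y * (n - sum s X) - missing X Z * (n - sum s X) - missing Y Z * (n - sum s X)
      + (\<Sum>x\<in>X. \<Sum>y\<in>Y. \<Sum>z\<in>Z. (1 - e x y) * (1 - e x z) * q x y z)
      + (\<Sum>x\<in>X. \<Sum>y\<in>Y. \<Sum>z\<in>Z. (1 - e x y) * (1 - e y z) * q x y z)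
      + (\<Sum>x\<in>X. \<Sum>y\<in>Y. \<Sum>z\<in>Z. (1 - e x z) * (1 - e y z) * q x y z)" .
  have p1: "(\<Sum>x\<in>X. \<Sum>y\<in>Y. \<Sum>z\<in>Z. (1 - e x y) * (1 - e x z) * q x y z) \<le> n / 10 * (missing X Y + missing X Z)"
    unfolding q_def by (rule missing_pair)
  have p2: "(\<Sum>x\<in>X. \<Sum>y\<in>Y. \<Sum>z\<in>Z. (1 - e x y) * (1 - e y z) * q x y z) \<le> n / 10 * (missing X Y + missing Y Z)"
  proof -
    have "(\<Sum>x\<in>X. \<Sum>y\<in>Y. \<Sum>z\<in>Z. (1 - e x y) * (1 - e y z) * q x y z)
      = (\<Sum>y\<in>Y. \<Sum>x\<in>X. \<Sum>z\<in>Z. (1 - e x y) * (1 - e y z) * q x y z)"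
      by (rule sum.swap)
    also have "\<dots> = (\<Sum>y\<in>Y. \<Sum>z\<in>Z. \<Sum>x\<in>X. (1 - e y z) * (1 - e y x) * ((1 - s y) * (1 - s z) * (1 - s x)))"
      unfolding q_def by (subst sum.swap[of _ X Z]) (simp add: e_sym mult_ac)
    also have "\<dots> \<le> n / 10 * (missing Y Z + missing Y X)" by (rule r.missing_pair)
    finally show ?thesis by (simp add: missing_sym[of Y X] add.commute)
  qed
  have p3: "(\<Sum>x\<in>X. \<Sum>y\<in>Y. \<Sum>z\<in>Z. (1 - e x z) * (1 - e y z) * q x y z) \<le> n / 10 * (missing X Z + missing Y Z)"
  proof -
    have "(\<Sum>x\<in>X. \<Sum>y\<in>Y. \<Sum>z\<in>Z. (1 - e x z) * (1 - e y z) * q x y z)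
      = (\<Sum>x\<in>X. \<Sum>z\<in>Z. \<Sum>y\<in>Y. (1 - e x z) * (1 - e y z) * q x y z)"
      by (intro sum.cong refl sum.swap)
    also have "\<dots> = (\<Sum>z\<in>Z. \<Sum>x\<in>X. \<Sum>y\<in>Y. (1 - e z x) * (1 - e z y) * ((1 - s z) * (1 - s x) * (1 - s y)))"
      unfolding q_def by (subst sum.swap) (simp add: e_sym mult_ac)
    also have "\<dots> \<le> n / 10 * (missing Z X + missing Z Y)" by (rule r2.missing_pair)
    finally show ?thesis by (simp add: missing_sym[of Z X] missing_sym[of Z Y])
  qed
  have "t \<le> R^3 - (R - n / 5) * (A + B + C)"
    if "t \<le> R^3 - A * R - B * R - C * R + a + b + c"
      "a \<le> n / 10 * (A + B)" "b \<le> n / 10 * (A + C)" "c \<le> n / 10 * (B + C)"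
    for t R A B C a b c :: real
  proof -
    have "t \<le> R^3 - A * R - B * R - C * R + n / 10 * (A + B) + n / 10 * (A + C) + n / 10 * (B + C)"
      using that by linarith
    also have "\<dots> = R^3 - (R - n / 5) * (A + B + C)" by (simp add: field_simps)
    finally show ?thesis .
  qed
  from this[OF main p1 p2 p3] show ?thesis unfolding q_def .
qed

text \<open>Nonnegativity of the variance of \<open>s\<close> on \<open>X\<close>.\<close>

lemma sum_s_sq_ge: "(sum s X / n)\<^sup>2 \<le> (\<Sum>x\<in>X. (s x)\<^sup>2) / n"
proof -
  define u where "u = sum s X / n"
  have "0 \<le> (\<Sum>x\<in>X. (s x - u)\<^sup>2)" by (intro sum_nonneg) simp
  also have "\<dots> = (\<Sum>x\<in>X. (s x)\<^sup>2 - 2 * u * s x + u\<^sup>2)"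
    by (intro sum.cong refl) (simp add: power2_eq_square algebra_simps)
  also have "\<dots> = (\<Sum>x\<in>X. (s x)\<^sup>2) - 2 * u * sum s X + n * u\<^sup>2"
    using cards(1) by (simp add: sum.distrib sum_subtractf sum_distrib_left[symmetric])
  also have "\<dots> = (\<Sum>x\<in>X. (s x)\<^sup>2) - n * u\<^sup>2"
    using n_pos by (simp add: u_def power2_eq_square)
  finally show ?thesis using n_pos unfolding u_def[symmetric] by (simp add: field_simps)
qed

end

section \<open>Excluding critical vertices\<close>

context tripartite_potential
begin

text \<open>\<open>sum_th_ge\<close> is applied to \<open>g / n * trial\<close> supported on the
  edges. Here \<open>h\<close> is the averaged slack in \<open>(s v)\<^sup>2 \<le> s v / 5\<close>,
  summed over the three classes.\<close>

lemma energy_bound: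
  fixes g :: real
  defines "u \<equiv> sum s X / n"
    and "h \<equiv> 3/5 * (sum s X / n) - ((\<Sum>x\<in>X. (s x)\<^sup>2) + (\<Sum>y\<in>Y. (s y)\<^sup>2) + (\<Sum>z\<in>Z. (s z)\<^sup>2)) / n"
    and "S \<equiv> (\<Sum>x\<in>X. \<Sum>y\<in>Y. e x y * (s x * s y)) + (\<Sum>x\<in>X. \<Sum>z\<in>Z. e x z * (s x * s z))
      + (\<Sum>y\<in>Y. \<Sum>z\<in>Z. e y z * (s y * s z))"
  shows "(\<Sum>x\<in>X. \<Sum>y\<in>Y. th x y) + (\<Sum>x\<in>X. \<Sum>z\<in>Z. th x z) + (\<Sum>y\<in>Y. \<Sum>z\<in>Z. th y z)
    \<ge> 2 * g * n * (4/5 - 2*u + h) + 8/5 * g * S / n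
      - g\<^sup>2 * n * ((1 - u)^3 - (4/5 - u) * (3/5 - 3*u - 2*h)) - 4/15 * g\<^sup>2 * \<delta>"
proof -
  interpret w: tripartite_potential X Z Y by (rule swap)
  interpret r: tripartite_potential Y Z X by (rule rotate)
  define f where "f a b = e a b * (g / n * trial a b)" for a b
  have ee: "e a b * e a b = e a b" for a b using e01[of a b] by auto
  define V where "V = (\<Sum>x\<in>X. (s x)\<^sup>2) + (\<Sum>y\<in>Y. (s y)\<^sup>2) + (\<Sum>z\<in>Z. (s z)\<^sup>2)"
  have U: "sum s X = n * u" and V: "V = n * (3/5 * u - h)"
    using n_pos by (simp_all add: u_def h_def V_def)
  have lin: "form th f = g / n * (n\<^sup>2 * (4/5 - 2*u + h) + 4/5 * S)"
  proof -
    have "form th f = g / n * ((\<Sum>x\<in>X. \<Sum>y\<in>Y. e x y * trial x y) + (\<Sum>x\<in>X. \<Sum>z\<in>Z. e x z * trial x z)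
      + (\<Sum>y\<in>Y. \<Sum>z\<in>Z. e y z * trial y z))"
      unfolding form_th f_def mult.assoc[symmetric] ee
      by (simp add: sum_distrib_left distrib_left mult_ac)
    also have "(\<Sum>x\<in>X. \<Sum>y\<in>Y. e x y * trial x y) + (\<Sum>x\<in>X. \<Sum>z\<in>Z. e x z * trial x z)
      + (\<Sum>y\<in>Y. \<Sum>z\<in>Z. e y z * trial y z) = n * (4/5 * n + sum s X - 12/5 * sum s X - V) + 4/5 * S"
    proof -
      have "A1 + A2 + A3 = n * (4/5 * n + U - 12/5 * U - (a + b + c)) + 4/5 * (S1 + S2 + S3)"
        if "A1 = n * ((4/5 * n + U) / 3 - (8/5 * U + a + b) / 2) + 4/5 * S1"
          "A2 = n * ((4/5 * n + U) / 3 - (8/5 * U + a + c) / 2) + 4/5 * S2"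
          "A3 = n * ((4/5 * n + U) / 3 - (8/5 * U + b + c) / 2) + 4/5 * S3"
        for A1 A2 A3 U a b c S1 S2 S3 :: real
        unfolding that by (simp add: field_simps)
      from this[OF sum_edges_trial w.sum_edges_trial r.sum_edges_trial[unfolded sum_s]]
      show ?thesis unfolding S_def V_def .
    qed
    also have "\<dots> = n\<^sup>2 * (4/5 - 2*u + h) + 4/5 * S"
      unfolding U V by (simp add: field_simps power2_eq_square)
    finally show ?thesis .
  qed
  have quad: "form f f \<le> (g / n)\<^sup>2 * (n^3 * ((1 - u)^3 - (4/5 - u) * (3/5 - 3*u - 2*h)) + \<delta> * (4/15 * n\<^sup>2))"
  proof -
    have 1: "tri_weight x y z * ((f x y + f x z + f y z) * (f x y + f x z + f y z))
      \<le> (g / n)\<^sup>2 * (e x y * e x z * e y z * ((1 - s x) * (1 - s y) * (1 - s z)))" for x y z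
    proof (cases "e x y * e x z * e y z = 1")
      case True
      then have "e x y = 1" "e x z = 1" "e y z = 1"
        using e01[of x y] e01[of x z] e01[of y z] by auto
      then show ?thesis
        using mult_left_mono[OF trial_triangle[of x y z], of "(g / n)\<^sup>2"]
        by (simp add: tri_weight_def f_def power2_eq_square algebra_simps)
    next
      case False
      then have "e x y * e x z * e y z = 0"
        using e01[of x y] e01[of x z] e01[of y z] by auto
      then show ?thesis unfolding tri_weight_def by (simp only:)
    qed
    have 2: "m x * m y * (f x y * f x y) \<le> (g / n)\<^sup>2 / 9 * (e x y * ((1 - s x) * (1 - s y)))" for x y
    proof -
      have "m x * m y * (f x y * f x y) = e x y * ((g / n)\<^sup>2 * (m x * m y * (trial x y)\<^sup>2))"
        using e01[of x y] by (auto simp: f_def power2_eq_square)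
      also have "\<dots> \<le> e x y * ((g / n)\<^sup>2 * ((1 - s x) * (1 - s y) / 9))"
        by (intro mult_left_mono trial_pair e_bounds) simp
      finally show ?thesis by (simp add: mult_ac)
    qed
    have tri: "(\<Sum>x\<in>X. \<Sum>y\<in>Y. \<Sum>z\<in>Z. tri_weight x y z * ((f x y + f x z + f y z) * (f x y + f x z + f y z)))
      \<le> (g / n)\<^sup>2 * (n^3 * ((1 - u)^3 - (4/5 - u) * (3/5 - 3*u - 2*h)))"
    proof -
      have "(\<Sum>x\<in>X. \<Sum>y\<in>Y. \<Sum>z\<in>Z. tri_weight x y z * ((f x y + f x z + f y z) * (f x y + f x z + f y z)))
        \<le> (g / n)\<^sup>2 * (\<Sum>x\<in>X. \<Sum>y\<in>Y. \<Sum>z\<in>Z. e x y * e x z * e y z * ((1 - s x) * (1 - s y) * (1 - s z)))"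
        unfolding sum_distrib_left by (intro sum_mono 1)
      also have "\<dots> \<le> (g / n)\<^sup>2 * ((n - sum s X)^3
          - (n - sum s X - n / 5) * (missing X Y + missing X Z + missing Y Z))"
        by (intro mult_left_mono triangle_weight_le) simp
      also have "\<dots> \<le> (g / n)\<^sup>2 * ((n - sum s X)^3
          - (n - sum s X - n / 5) * (3 * n * (n / 5 - sum s X) - 2 * n * (3/5 * sum s X - V)))"
      proof (intro mult_left_mono diff_mono order_refl)
        show "3 * n * (n / 5 - sum s X) - 2 * n * (3/5 * sum s X - V) \<le> missing X Y + missing X Z + missing Y Z"
        proof -
          have "3 * n * (n / 5 - U) - 2 * n * (3/5 * U - (a + b + c)) \<le> A1 + A2 + A3"
            if "A1 \<ge> n * (n / 5 - U) - n * (2/5 * U - a - b)"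
              "A2 \<ge> n * (n / 5 - U) - n * (2/5 * U - a - c)"
              "A3 \<ge> n * (n / 5 - U) - n * (2/5 * U - b - c)"
            for A1 A2 A3 U a b c :: real
          proof -
            have "3 * n * (n / 5 - U) - 2 * n * (3/5 * U - (a + b + c))
              = (n * (n / 5 - U) - n * (2/5 * U - a - b)) + (n * (n / 5 - U) - n * (2/5 * U - a - c))
                + (n * (n / 5 - U) - n * (2/5 * U - b - c))"
              by (simp add: field_simps)
            also have "\<dots> \<le> A1 + A2 + A3" by (intro add_mono that)
            finally show ?thesis .
          qed
          from this[OF missing_ge w.missing_ge r.missing_ge[unfolded sum_s]]
          show ?thesis unfolding V_def .
        qed
        show "0 \<le> n - sum s X - n / 5" using sum_s_le(2) n_pos by simp
      qed simp
      also have "(n - sum s X)^3 - (n - sum s X - n / 5) * (3 * n * (n / 5 - sum s X) - 2 * n * (3/5 * sum s X - V))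
        = n^3 * ((1 - u)^3 - (4/5 - u) * (3/5 - 3*u - 2*h))"
        unfolding U V by (simp add: field_simps power2_eq_square power3_eq_cube)
      finally show ?thesis .
    qed
    have pair: "(\<Sum>a\<in>A. \<Sum>b\<in>B. m a * m b * (f a b * f a b)) \<le> (g / n)\<^sup>2 / 9 * (4/5 * n\<^sup>2)"
      if "(\<Sum>a\<in>A. \<Sum>b\<in>B. e a b * ((1 - s a) * (1 - s b))) \<le> 4/5 * n\<^sup>2" for A B
    proof -
      have "(\<Sum>a\<in>A. \<Sum>b\<in>B. m a * m b * (f a b * f a b))
        \<le> (g / n)\<^sup>2 / 9 * (\<Sum>a\<in>A. \<Sum>b\<in>B. e a b * ((1 - s a) * (1 - s b)))"
        unfolding sum_distrib_left by (intro sum_mono 2)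
      also have "\<dots> \<le> (g / n)\<^sup>2 / 9 * (4/5 * n\<^sup>2)" by (intro mult_left_mono that) simp
      finally show ?thesis .
    qed
    have "form f f \<le> (g / n)\<^sup>2 * (n^3 * ((1 - u)^3 - (4/5 - u) * (3/5 - 3*u - 2*h)))
      + \<delta> * ((g / n)\<^sup>2 / 9 * (4/5 * n\<^sup>2) + (g / n)\<^sup>2 / 9 * (4/5 * n\<^sup>2) + (g / n)\<^sup>2 / 9 * (4/5 * n\<^sup>2))"
      unfolding form_def using delta_pos
      by (intro add_mono tri mult_left_mono pair sum_edges_r w.sum_edges_r r.sum_edges_r) auto
    then show ?thesis by (simp add: algebra_simps)
  qed
  have "2 * (g / n * (n\<^sup>2 * (4/5 - 2*u + h) + 4/5 * S))
      - (g / n)\<^sup>2 * (n^3 * ((1 - u)^3 - (4/5 - u) * (3/5 - 3*u - 2*h)) + \<delta> * (4/15 * n\<^sup>2))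
    = 2 * g * n * (4/5 - 2*u + h) + 8/5 * g * S / n
      - g\<^sup>2 * n * ((1 - u)^3 - (4/5 - u) * (3/5 - 3*u - 2*h)) - 4/15 * g\<^sup>2 * \<delta>"
  proof -
    have "2 * (g / n * (n\<^sup>2 * a + 4/5 * S)) - (g / n)\<^sup>2 * (n^3 * b + \<delta> * (4/15 * n\<^sup>2))
      = 2 * g * n * a + 8/5 * g * S / n - g\<^sup>2 * n * b - 4/15 * g\<^sup>2 * \<delta>" for a b
      using n_pos by (simp add: field_simps power2_eq_square power3_eq_cube)
    then show ?thesis .
  qed
  with sum_th_ge[of f] quad show ?thesis unfolding lin by linarith
qed

text \<open>The lower bound on the total of \<open>th\<close> is transferred to
  \<open>3 * opposite_sum\<close>. The excess terms that arise are bounded below on \<open>X\<close>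
  by \<open>critical_Th_ge\<close> and above on \<open>Y\<close> and \<open>Z\<close> by
  \<open>excess_upper\<close>; the outcome contradicts
  \<open>critical_opposite_sum_le\<close>.\<close>

lemma no_critical_vertex:
  assumes x0: "x0 \<in> X" and crit: "Th x0 = 1/2 - s x0"
  shows False
proof -
  interpret w: tripartite_potential X Z Y by (rule swap)
  interpret r: tripartite_potential Y Z X by (rule rotate)
  interpret r2: tripartite_potential Z X Y by (rule r.rotate)
  define u where "u = sum s X / n"
  define v1 where "v1 = (\<Sum>x\<in>X. (s x)\<^sup>2) / n"
  define v2 where "v2 = (\<Sum>y\<in>Y. (s y)\<^sup>2) / n"
  define v3 where "v3 = (\<Sum>z\<in>Z. (s z)\<^sup>2) / n"
  define h where "h = 3/5 * u - (v1 + v2 + v3)"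
  define S where "S = (\<Sum>x\<in>X. \<Sum>y\<in>Y. e x y * (s x * s y)) + (\<Sum>x\<in>X. \<Sum>z\<in>Z. e x z * (s x * s z))
      + (\<Sum>y\<in>Y. \<Sum>z\<in>Z. e y z * (s y * s z))"
  define DX where "DX = (\<Sum>x\<in>X. (m x - 1) * Th x)"
  define DY where "DY = (\<Sum>y\<in>Y. (m y - 1) * Th y)"
  define DZ where "DZ = (\<Sum>z\<in>Z. (m z - 1) * Th z)"
  have S0: "0 \<le> S"
    unfolding S_def using e_bounds s_products(1)
    by (intro add_nonneg_nonneg sum_nonneg mult_nonneg_nonneg[OF e_bounds(1)]) auto
  have u: "0 \<le> u" "u \<le> 1/5" using sum_s_le n_pos by (auto simp: u_def field_simps)
  have U: "sum s X = n * u" using n_pos by (simp add: u_def)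
  have v: "u\<^sup>2 \<le> v1" "u\<^sup>2 \<le> v2" "u\<^sup>2 \<le> v3"
    using sum_s_sq_ge r.sum_s_sq_ge r2.sum_s_sq_ge unfolding sum_s u_def v1_def v2_def v3_def by auto
  have "0 \<le> h"
  proof -
    have *: "(\<Sum>v\<in>A. (s v)\<^sup>2) \<le> 1/5 * sum s A" for A
      unfolding sum_distrib_left power2_eq_square using s_le s_nonneg
      by (intro sum_mono mult_right_mono) auto
    have "(\<Sum>v\<in>A. (s v)\<^sup>2) / n \<le> 1/5 * sum s A / n" for A
      using n_pos by (intro divide_right_mono *) simp
    from this[of X] this[of Y] this[of Z] show ?thesis
      unfolding sum_s v1_def[symmetric] v2_def[symmetric] v3_def[symmetric] by (simp add: h_def u_def)
  qed
  have TTs: "3 * opposite_sum = (opposite_sum + r.opposite_sum + r2.opposite_sum) + 2 * DX - DY - DZ"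
    using opposite_sum_eq r.opposite_sum_eq r2.opposite_sum_eq weighted_Th_eq r.weighted_Th_eq
    unfolding DX_def DY_def DZ_def by linarith
  have DY: "DY \<le> (n * u - n * v2) / 2" and DZ: "DZ \<le> (n * u - n * v3) / 2"
    using excess_upper[of Y] excess_upper[of Z] n_pos unfolding sum_s DY_def DZ_def U v2_def v3_def
    by auto
  have DX: "DX \<ge> 17/100 * (n * u + n * v1)"
  proof -
    have "17/100 * (n * u + n * v1) = (\<Sum>x\<in>X. (s x + (s x)\<^sup>2) * (17/100))"
      unfolding sum_distrib_right[symmetric] sum.distrib using n_pos by (simp add: U[symmetric] v1_def)
    also have "\<dots> \<le> DX"
      unfolding DX_def
    proof (intro sum_mono mult_mono)
      fix x assume "x \<in> X"
      then show "17/100 \<le> Th x" by (rule critical_Th_ge[OF x0 crit])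
      have "s x * (1 + s x) \<le> s x * m x"
        using s_le_m_1[of x] s_nonneg[of x] by (intro mult_left_mono) auto
      then show "s x + (s x)\<^sup>2 \<le> m x - 1"
        using m_eq[of x] by (simp add: power2_eq_square algebra_simps)
      show "0 \<le> m x - 1" using m_bounds(1)[of x] by simp
    qed simp
    finally show ?thesis .
  qed
  have opposite_sum_sum: "opposite_sum + r.opposite_sum + r2.opposite_sum \<ge> (\<Sum>x\<in>X. \<Sum>y\<in>Y. th x y) + (\<Sum>x\<in>X. \<Sum>z\<in>Z. th x z)
      + (\<Sum>y\<in>Y. \<Sum>z\<in>Z. th y z) - 5/3 * S / n"
  proof -
    have dist: "(\<Sum>a\<in>A. \<Sum>b\<in>B. th a b - 5/3 * (e a b * (s a * s b)) / n)
      = (\<Sum>a\<in>A. \<Sum>b\<in>B. th a b) - 5/3 * (\<Sum>a\<in>A. \<Sum>b\<in>B. e a b * (s a * s b)) / n" for A B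
      by (simp add: sum_subtractf sum_distrib_left sum_divide_distrib)
    have "r2.opposite_sum \<ge> (\<Sum>x\<in>X. \<Sum>y\<in>Y. th x y - 5/3 * (e x y * (s x * s y)) / n)"
      unfolding r2.opposite_sum_def by (intro sum_mono kappa_th_ge)
    moreover have "opposite_sum \<ge> (\<Sum>y\<in>Y. \<Sum>z\<in>Z. th y z - 5/3 * (e y z * (s y * s z)) / n)"
      unfolding opposite_sum_def using r.kappa_th_ge by (intro sum_mono)
    moreover have "r.opposite_sum \<ge> (\<Sum>x\<in>X. \<Sum>z\<in>Z. th x z - 5/3 * (e x z * (s x * s z)) / n)"
    proof -
      have "r.opposite_sum = (\<Sum>x\<in>X. \<Sum>z\<in>Z. kappa x z * th x z)"
        unfolding r.opposite_sum_def by (subst sum.swap) (simp add: kappa_sym th_sym)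
      then show ?thesis using w.kappa_th_ge by (auto intro: sum_mono)
    qed
    ultimately show ?thesis unfolding dist S_def distrib_left add_divide_distrib by linarith
  qed
  show False
  proof (rule no_critical_parameters[OF h_def u v \<open>0 \<le> h\<close>])
    show "0 \<le> \<delta> / n" using delta_pos n_pos by simp
    show "0 \<le> s x0" "s x0 \<le> 1/5" by (rule s_nonneg s_le)+
    show "opposite_sum / n \<le> 2/5 - 2*u + s x0 * (2*u - 7/20) + (s x0)\<^sup>2/2 - 3/5 * (\<delta> / n) * (1/2 - s x0)"
      using critical_opposite_sum_le[OF x0 crit] by (simp add: u_def)
    fix g :: real assume g: "11/10 \<le> g" "g \<le> 7/5"
    define q where "q = (1 - u)^3 - (4/5 - u) * (3/5 - 3*u - 2*h)"
    \<comment> \<open>The gain from the products in \<open>trial\<close> outweighs the loss in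
      passing from \<open>th\<close> to \<open>kappa\<close>, because \<open>g\<close> is at least
      \<open>11/10\<close>, which is more than \<open>25/24\<close>.\<close>
    have "(8/5 * g - 5/3) * S / n \<ge> 0" using g S0 n_pos by simp
    then have gS: "8/5 * g * S / n - 5/3 * S / n \<ge> 0"
      by (simp only: left_diff_distrib diff_divide_distrib)
    have hh: "3/5 * (sum s X / n) - ((\<Sum>x\<in>X. (s x)\<^sup>2) + (\<Sum>y\<in>Y. (s y)\<^sup>2) + (\<Sum>z\<in>Z. (s z)\<^sup>2)) / n = h"
      by (simp add: h_def u_def v1_def v2_def v3_def add_divide_distrib)
    have "3 * opposite_sum \<ge> 2 * g * n * (4/5 - 2*u + h) - g\<^sup>2 * n * q - 4/15 * g\<^sup>2 * \<delta>
        + 2 * (17/100 * (n * u + n * v1)) - (n * u - n * v2) / 2 - (n * u - n * v3) / 2"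
    proof -
      have "P - Q - R + 2 * x - y - z \<le> 3 * t"
        if "P + a - Q - R \<le> E" "3 * t = T + 2 * x' - y' - z'" "E - b \<le> T" "x \<le> x'"
          "y' \<le> y" "z' \<le> z" "0 \<le> a - b" for P Q R E T a b t x y z x' y' z' :: real
        using that by linarith
      from this[OF energy_bound[of g, unfolded hh, folded u_def S_def, folded q_def] TTs opposite_sum_sum DX DY DZ gS]
      show ?thesis .
    qed
    also have "2 * g * n * (4/5 - 2*u + h) - g\<^sup>2 * n * q - 4/15 * g\<^sup>2 * \<delta>
        + 2 * (17/100 * (n * u + n * v1)) - (n * u - n * v2) / 2 - (n * u - n * v3) / 2
      = n * (2 * g * (4/5 - 2*u + h) - g\<^sup>2 * q - 4/15 * g\<^sup>2 * (\<delta> / n)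
        + 17/50 * (u + v1) - (u - (v2 + v3) / 2))"
      using n_pos by (simp add: field_simps)
    also have "3 * opposite_sum = n * (3 * (opposite_sum / n))" using n_pos by simp
    finally have "n * (3 * (opposite_sum / n)) \<ge> n * (2 * g * (4/5 - 2*u + h) - g\<^sup>2 * q - 4/15 * g\<^sup>2 * (\<delta> / n)
        + 17/50 * (u + v1) - (u - (v2 + v3) / 2))" .
    then show "3 * (opposite_sum / n) \<ge> 2 * g * (4/5 - 2*u + h)
        - g\<^sup>2 * ((1 - u)^3 - (4/5 - u) * (3/5 - 3*u - 2*h)) - 4/15 * g\<^sup>2 * (\<delta> / n)
        + 17/50 * (u + v1) - (u - (v2 + v3) / 2)"
      using n_pos unfolding q_def[symmetric] by (simp only: mult_le_cancel_left_pos)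
  qed
qed

end

section \<open>The graph and its regularised load equations\<close>

lemma triangle_edges_insert:
  assumes "x \<noteq> y" "x \<noteq> z" "y \<noteq> z"
  shows "triangle_edges {x, y, z} = {{x, y}, {x, z}, {y, z}}"
proof (intro equalityI subsetI)
  fix e assume "e \<in> triangle_edges {x, y, z}"
  then have sub: "e \<subseteq> {x, y, z}" and "card e = 2" by (auto simp: triangle_edges_def)
  then obtain a b where "e = {a, b}" "a \<noteq> b" by (auto simp: card_2_iff)
  then show "e \<in> {{x, y}, {x, z}, {y, z}}" using sub by (auto simp: insert_commute)
next
  fix e assume "e \<in> {{x, y}, {x, z}, {y, z}}"
  then show "e \<in> triangle_edges {x, y, z}" using assms by (auto simp: triangle_edges_def)
qed

locale balanced_tripartite =
  fixes V X Y Z :: "'a set" and E :: "'a set set" and s :: "'a \<Rightarrow> real" and n :: nat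
  assumes V_eq: "V = X \<union> Y \<union> Z" and fin_classes: "finite X" "finite Y" "finite Z"
    and cards: "card X = n" "card Y = n" "card Z = n" and n_pos: "0 < n"
    and disjoint: "X \<inter> Y = {}" "X \<inter> Z = {}" "Y \<inter> Z = {}"
    and edge_cases: "e \<in> E \<Longrightarrow> (\<exists>x\<in>X. \<exists>y\<in>Y. e = {x, y}) \<or> (\<exists>y\<in>Y. \<exists>z\<in>Z. e = {y, z})
      \<or> (\<exists>z\<in>Z. \<exists>x\<in>X. e = {z, x})"
    and s_nonneg: "0 \<le> s v" and s_le: "s v \<le> 1/5"
    and degree: "x \<in> X \<Longrightarrow> real (degree_in E x Y) = n * (4/5 + s x)"
      "x \<in> X \<Longrightarrow> real (degree_in E x Z) = n * (4/5 + s x)"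
      "y \<in> Y \<Longrightarrow> real (degree_in E y X) = n * (4/5 + s y)"
      "y \<in> Y \<Longrightarrow> real (degree_in E y Z) = n * (4/5 + s y)"
      "z \<in> Z \<Longrightarrow> real (degree_in E z X) = n * (4/5 + s z)"
      "z \<in> Z \<Longrightarrow> real (degree_in E z Y) = n * (4/5 + s z)"
begin

text \<open>The definitions below involve only \<open>V\<close>, \<open>E\<close> and
  \<open>s\<close>, so the rotated and swapped instances speak about the same potentials.\<close>

lemma rotate: "balanced_tripartite V Y Z X E s n"
proof
  show "V = Y \<union> Z \<union> X" using V_eq by blast
  show "Y \<inter> X = {}" "Z \<inter> X = {}" using disjoint by blast+
  show "(\<exists>x\<in>Y. \<exists>y\<in>Z. e = {x, y}) \<or> (\<exists>y\<in>Z. \<exists>z\<in>X. e = {y, z})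
      \<or> (\<exists>z\<in>X. \<exists>x\<in>Y. e = {z, x})" if "e \<in> E" for e
    using edge_cases[OF that] by blast
qed (rule fin_classes cards n_pos disjoint s_nonneg s_le degree; assumption?)+

lemma swap: "balanced_tripartite V X Z Y E s n"
proof
  show "V = X \<union> Z \<union> Y" using V_eq by blast
  show "Z \<inter> Y = {}" using disjoint by blast
  show "(\<exists>x\<in>X. \<exists>y\<in>Z. e = {x, y}) \<or> (\<exists>y\<in>Z. \<exists>z\<in>Y. e = {y, z})
      \<or> (\<exists>z\<in>Y. \<exists>x\<in>X. e = {z, x})" if "e \<in> E" for e
    using edge_cases[OF that] by (metis insert_commute)
qed (rule fin_classes cards n_pos disjoint s_nonneg s_le degree; assumption?)+

lemma fin_V: "finite V"
  using fin_classes by (simp add: V_eq)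

lemma fin_E: "finite E"
proof (rule finite_subset)
  show "E \<subseteq> Pow V" using edge_cases V_eq by fastforce
qed (simp add: fin_V)

lemma edge_cross: "{x, y} \<in> E \<Longrightarrow> x \<in> X \<Longrightarrow> y \<notin> X"
  using edge_cases[of "{x, y}"] disjoint by (auto simp: doubleton_eq_iff)

lemma edge_distinct: "{x, y} \<in> E \<Longrightarrow> x \<noteq> y"
  using edge_cases[of "{x, y}"] disjoint by (auto simp: doubleton_eq_iff)

definition m :: "'a \<Rightarrow> real" where "m v = 1 / (1 - s v)"

lemma m_pos: "0 < m v" and m_inverse: "m v * (1 - s v) = 1"
  using s_nonneg[of v] s_le[of v] by (auto simp: m_def)

section \<open>The Gram matrix of triangles\<close>

definition prod_m :: "'a set \<Rightarrow> real" where "prod_m A = prod m A"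

lemma prod_m_pos: "0 < prod_m A"
  unfolding prod_m_def using m_pos by (simp add: prod_pos)

text \<open>The edge-triangle incidence matrix times its transpose, with triangle \<open>T\<close>
  weighted by \<open>prod_m T\<close>. It sends \<open>f\<close> to the edge loads of the weights
  \<open>prod_m T * sum f (triangle_edges T)\<close>.\<close>

definition gram :: "'a set \<Rightarrow> 'a set \<Rightarrow> real" where
  "gram e e' = (\<Sum>T\<in>triangles V E. prod_m T * (of_bool (e \<in> triangle_edges T) * of_bool (e' \<in> triangle_edges T)))"

lemma fin_triangles: "finite (triangles V E)"
  by (rule finite_subset[of _ "Pow V"]) (auto simp: triangles_def fin_V)

lemma sum_triangle_edges:
  assumes "T \<in> triangles V E"
  shows "(\<Sum>e\<in>E. of_bool (e \<in> triangle_edges T) * f e) = (sum f (triangle_edges T) :: real)"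
proof -
  have "(\<Sum>e\<in>E. of_bool (e \<in> triangle_edges T) * f e) = (\<Sum>e\<in>triangle_edges T. of_bool (e \<in> triangle_edges T) * f e)"
    using assms fin_E by (intro sum.mono_neutral_right) (auto simp: triangles_def)
  then show ?thesis by simp
qed

lemma gram_apply:
  "(\<Sum>e'\<in>E. gram e e' * f e')
    = (\<Sum>T\<in>{T \<in> triangles V E. e \<in> triangle_edges T}. prod_m T * sum f (triangle_edges T))"
proof -
  have "(\<Sum>e'\<in>E. gram e e' * f e') = (\<Sum>e'\<in>E. \<Sum>T\<in>triangles V E.
      prod_m T * of_bool (e \<in> triangle_edges T) * (of_bool (e' \<in> triangle_edges T) * f e'))"
    unfolding gram_def sum_distrib_right by (simp add: mult.assoc)
  also have "\<dots> = (\<Sum>T\<in>triangles V E. prod_m T * of_bool (e \<in> triangle_edges T)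
      * (\<Sum>e'\<in>E. of_bool (e' \<in> triangle_edges T) * f e'))"
    unfolding sum_distrib_left by (rule sum.swap)
  also have "\<dots> = (\<Sum>T\<in>triangles V E. if e \<in> triangle_edges T then prod_m T * sum f (triangle_edges T) else 0)"
    by (intro sum.cong refl) (simp add: sum_triangle_edges)
  also have "\<dots> = (\<Sum>T\<in>{T \<in> triangles V E. e \<in> triangle_edges T}. prod_m T * sum f (triangle_edges T))"
    using fin_triangles by (simp add: sum.inter_filter)
  finally show ?thesis .
qed

text \<open>The form is a sum over triangles of squares with weights
  \<open>prod_m T\<close>.\<close>

lemma gram_psd: "0 \<le> (\<Sum>e\<in>E. \<Sum>e'\<in>E. gram e e' * (f e * f e'))"
proof -
  have "(\<Sum>e\<in>E. \<Sum>e'\<in>E. gram e e' * (f e * f e')) = (\<Sum>e\<in>E. f e * (\<Sum>e'\<in>E. gram e e' * f e'))"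
    by (simp add: sum_distrib_left mult_ac)
  also have "\<dots> = (\<Sum>e\<in>E. \<Sum>T\<in>triangles V E.
      prod_m T * sum f (triangle_edges T) * (of_bool (e \<in> triangle_edges T) * f e))"
  proof (intro sum.cong refl)
    fix e
    have "f e * (\<Sum>e'\<in>E. gram e e' * f e')
      = f e * (\<Sum>T\<in>triangles V E. if e \<in> triangle_edges T then prod_m T * sum f (triangle_edges T) else 0)"
      unfolding gram_apply using fin_triangles by (simp add: sum.inter_filter)
    also have "\<dots> = (\<Sum>T\<in>triangles V E.
      prod_m T * sum f (triangle_edges T) * (of_bool (e \<in> triangle_edges T) * f e))"
      unfolding sum_distrib_left by (intro sum.cong refl) simp
    finally show "f e * (\<Sum>e'\<in>E. gram e e' * f e') = \<dots>" .
  qed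
  also have "\<dots> = (\<Sum>T\<in>triangles V E. prod_m T * sum f (triangle_edges T)
      * (\<Sum>e\<in>E. of_bool (e \<in> triangle_edges T) * f e))"
    unfolding sum_distrib_left by (rule sum.swap)
  also have "\<dots> = (\<Sum>T\<in>triangles V E. prod_m T * (sum f (triangle_edges T))\<^sup>2)"
    by (intro sum.cong refl) (simp add: sum_triangle_edges power2_eq_square)
  also have "\<dots> \<ge> 0"
    using prod_m_pos by (intro sum_nonneg mult_nonneg_nonneg) (auto simp: less_imp_le)
  finally show ?thesis .
qed

text \<open>With \<open>prod_m\<close> as regularising weight, every edge has the same coefficient
  \<open>\<delta>\<close> once its equation is divided by \<open>m u * m v\<close>; the symmetry
  argument for \<open>Th\<close> relies on this.\<close>

sublocale regularised_system E gram prod_m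
proof
  show "gram e e' = gram e' e" for e e'
    unfolding gram_def by (simp add: mult.commute)
qed (rule fin_E gram_psd prod_m_pos)+

section \<open>Edge potentials and their load equations\<close>

definition adj :: "'a \<Rightarrow> 'a \<Rightarrow> real" where "adj u v = of_bool ({u, v} \<in> E)"

definition th :: "real \<Rightarrow> 'a \<Rightarrow> 'a \<Rightarrow> real" where "th \<delta> u v = adj u v * sol \<delta> {u, v}"

lemma adj_sym: "adj u v = adj v u" and th_sym: "th \<delta> u v = th \<delta> v u"
  by (simp_all add: adj_def th_def insert_commute)

lemma adj_degree: "finite W \<Longrightarrow> (\<Sum>w\<in>W. adj v w) = real (degree_in E v W)"
  by (simp add: adj_def degree_in_def of_bool_def sum.If_cases Int_def)

lemma triangles_through_edge:
  assumes "x \<in> X" "y \<in> Y" "{x, y} \<in> E"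
  shows "{T \<in> triangles V E. {x, y} \<in> triangle_edges T} = (\<lambda>z. {x, y, z}) ` {z\<in>Z. {x, z} \<in> E \<and> {y, z} \<in> E}"
proof (intro equalityI subsetI)
  interpret r: balanced_tripartite V Y Z X E s n by (rule rotate)
  fix T assume "T \<in> {T \<in> triangles V E. {x, y} \<in> triangle_edges T}"
  then have T: "T \<subseteq> V" "card T = 3" "triangle_edges T \<subseteq> E" "{x, y} \<subseteq> T"
    by (auto simp: triangles_def triangle_edges_def)
  have xy: "x \<noteq> y" using edge_distinct assms by blast
  have "finite T" using T(2) by (simp add: card_ge_0_finite)
  then have "card (T - {x, y}) = 1" using T(2,4) xy by (simp add: card_Diff_subset)
  then obtain z where "T - {x, y} = {z}" by (auto simp: card_1_singleton_iff)
  then have Tz: "T = {x, y, z}" and z: "z \<noteq> x" "z \<noteq> y" using T(4) by auto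
  then have E: "{x, z} \<in> E" "{y, z} \<in> E"
    using T(3) triangle_edges_insert[of x y z] xy by auto
  then have "z \<notin> X" "z \<notin> Y" using edge_cross r.edge_cross assms by blast+
  then have "z \<in> Z" using T(1) Tz V_eq by auto
  then show "T \<in> (\<lambda>z. {x, y, z}) ` {z\<in>Z. {x, z} \<in> E \<and> {y, z} \<in> E}" using Tz E by auto
next
  fix T assume "T \<in> (\<lambda>z. {x, y, z}) ` {z\<in>Z. {x, z} \<in> E \<and> {y, z} \<in> E}"
  then obtain z where z: "z \<in> Z" "{x, z} \<in> E" "{y, z} \<in> E" "T = {x, y, z}" by blast
  then have d: "x \<noteq> y" "x \<noteq> z" "y \<noteq> z" using edge_distinct assms by blast+
  then show "T \<in> {T \<in> triangles V E. {x, y} \<in> triangle_edges T}"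
    using assms z by (simp add: triangles_def triangle_edges_insert V_eq)
qed

lemma sum_triangles_through_edge:
  assumes "x \<in> X" "y \<in> Y" "{x, y} \<in> E"
  shows "(\<Sum>T\<in>{T \<in> triangles V E. {x, y} \<in> triangle_edges T}. prod_m T * sum (sol \<delta>) (triangle_edges T))
    = m x * m y * (\<Sum>z\<in>Z. adj x z * adj y z * m z * (th \<delta> x y + th \<delta> x z + th \<delta> y z))"
proof -
  let ?N = "{z\<in>Z. {x, z} \<in> E \<and> {y, z} \<in> E}"
  have xy: "x \<noteq> y" using edge_distinct assms by blast
  have d: "x \<noteq> z" "y \<noteq> z" if "z \<in> Z" for z using that assms disjoint by blast+
  have inj: "inj_on (\<lambda>z. {x, y, z}) ?N"
  proof (rule inj_onI)
    fix z z' assume "z \<in> ?N" "z' \<in> ?N" "{x, y, z} = {x, y, z'}"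
    then have "z \<in> {x, y, z'}" "z \<in> Z" by blast+
    then show "z = z'" using d[of z] by auto
  qed
  have "(\<Sum>T\<in>{T \<in> triangles V E. {x, y} \<in> triangle_edges T}. prod_m T * sum (sol \<delta>) (triangle_edges T))
    = (\<Sum>z\<in>?N. prod_m {x, y, z} * sum (sol \<delta>) (triangle_edges {x, y, z}))"
    unfolding triangles_through_edge[OF assms] by (simp add: sum.reindex[OF inj])
  also have "\<dots> = (\<Sum>z\<in>?N. m x * m y * (adj x z * adj y z * m z * (th \<delta> x y + th \<delta> x z + th \<delta> y z)))"
  proof (intro sum.cong refl)
    fix z assume z: "z \<in> ?N"
    then have "{x, y} \<noteq> {x, z}" "{x, y} \<noteq> {y, z}" "{x, z} \<noteq> {y, z}"
      using d[of z] xy by (auto simp: doubleton_eq_iff)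
    then have "sum (sol \<delta>) (triangle_edges {x, y, z}) = th \<delta> x y + th \<delta> x z + th \<delta> y z"
      using z assms d[of z] xy by (simp add: triangle_edges_insert th_def adj_def)
    moreover have "prod_m {x, y, z} = m x * m y * m z"
      using z d[of z] xy by (simp add: prod_m_def)
    ultimately show "prod_m {x, y, z} * sum (sol \<delta>) (triangle_edges {x, y, z})
      = m x * m y * (adj x z * adj y z * m z * (th \<delta> x y + th \<delta> x z + th \<delta> y z))"
      using z by (simp add: adj_def)
  qed
  also have "\<dots> = (\<Sum>z\<in>Z. m x * m y * (adj x z * adj y z * m z * (th \<delta> x y + th \<delta> x z + th \<delta> y z)))"
    using fin_classes by (intro sum.mono_neutral_left) (auto simp: adj_def)
  finally show ?thesis by (simp add: sum_distrib_left)
qed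

lemma load:
  assumes \<delta>: "0 < \<delta>" and xy: "x \<in> X" "y \<in> Y"
  shows "adj x y * (\<Sum>z\<in>Z. adj x z * adj y z / (1 - s z) * (th \<delta> x y + th \<delta> x z + th \<delta> y z)) + \<delta> * th \<delta> x y
    = adj x y * (1 - s x) * (1 - s y)"
proof (cases "{x, y} \<in> E")
  case False
  then show ?thesis by (simp add: th_def adj_def)
next
  case True
  let ?S = "\<Sum>z\<in>Z. adj x z * adj y z * m z * (th \<delta> x y + th \<delta> x z + th \<delta> y z)"
  have "prod_m {x, y} = m x * m y" using edge_distinct[OF True] by (simp add: prod_m_def)
  moreover have "th \<delta> x y = sol \<delta> {x, y}" using True by (simp add: th_def adj_def)
  ultimately have eq: "m x * m y * ?S + \<delta> * (m x * m y) * th \<delta> x y = 1"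
    using sol_eq[OF \<delta> True] unfolding gram_apply sum_triangles_through_edge[OF xy True] by simp
  have "?S + \<delta> * th \<delta> x y = (m x * (1 - s x)) * (m y * (1 - s y)) * (?S + \<delta> * th \<delta> x y)"
    by (simp add: m_inverse)
  also have "\<dots> = (1 - s x) * (1 - s y) * (m x * m y * ?S + \<delta> * (m x * m y) * th \<delta> x y)"
    by (simp only: distrib_left mult_ac)
  finally show ?thesis unfolding eq using True by (simp add: adj_def m_def)
qed

text \<open>The load equations at \<open>x\<close>, weighted by \<open>m y\<close>. The triangle
  part is symmetric in \<open>Y\<close> and \<open>Z\<close> and the right-hand side depends only on
  \<open>x\<close>, so comparison with the swapped instance isolates the regularising term.\<close>

lemma weighted_load_sum:
  assumes \<delta>: "0 < \<delta>" and x: "x \<in> X"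
  shows "(\<Sum>y\<in>Y. \<Sum>z\<in>Z. adj x y * adj x z * adj y z * m y * m z * (th \<delta> x y + th \<delta> x z + th \<delta> y z))
    + \<delta> * (\<Sum>y\<in>Y. m y * th \<delta> x y) = (1 - s x) * (n * (4/5 + s x))"
proof -
  have "(\<Sum>y\<in>Y. \<Sum>z\<in>Z. adj x y * adj x z * adj y z * m y * m z * (th \<delta> x y + th \<delta> x z + th \<delta> y z))
    + \<delta> * (\<Sum>y\<in>Y. m y * th \<delta> x y)
    = (\<Sum>y\<in>Y. m y * (adj x y * (\<Sum>z\<in>Z. adj x z * adj y z / (1 - s z) * (th \<delta> x y + th \<delta> x z + th \<delta> y z))
        + \<delta> * th \<delta> x y))"
    unfolding sum_distrib_left[of \<delta>] sum.distrib[symmetric]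
  proof (intro sum.cong refl)
    fix y
    have "(\<Sum>z\<in>Z. adj x y * adj x z * adj y z * m y * m z * (th \<delta> x y + th \<delta> x z + th \<delta> y z))
      = m y * (adj x y * (\<Sum>z\<in>Z. adj x z * adj y z / (1 - s z) * (th \<delta> x y + th \<delta> x z + th \<delta> y z)))"
      unfolding sum_distrib_left by (intro sum.cong refl) (simp add: m_def)
    then show "(\<Sum>z\<in>Z. adj x y * adj x z * adj y z * m y * m z * (th \<delta> x y + th \<delta> x z + th \<delta> y z)) + \<delta> * (m y * th \<delta> x y)
      = m y * (adj x y * (\<Sum>z\<in>Z. adj x z * adj y z / (1 - s z) * (th \<delta> x y + th \<delta> x z + th \<delta> y z)) + \<delta> * th \<delta> x y)"
      by (simp add: distrib_left)
  qed
  also have "\<dots> = (\<Sum>y\<in>Y. (1 - s x) * adj x y)"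
  proof (intro sum.cong refl)
    fix y assume "y \<in> Y"
    have "m y * (adj x y * (1 - s x) * (1 - s y)) = (m y * (1 - s y)) * ((1 - s x) * adj x y)" by simp
    then show "m y * (adj x y * (\<Sum>z\<in>Z. adj x z * adj y z / (1 - s z) * (th \<delta> x y + th \<delta> x z + th \<delta> y z))
        + \<delta> * th \<delta> x y) = (1 - s x) * adj x y"
      unfolding load[OF \<delta> x \<open>y \<in> Y\<close>] m_inverse by simp
  qed
  also have "\<dots> = (1 - s x) * (n * (4/5 + s x))"
    using fin_classes degree(1)[OF x] by (simp add: sum_distrib_left[symmetric] adj_degree)
  finally show ?thesis .
qed

text \<open>Half of the sum over all of \<open>V\<close>, instead of the sum over one class, makes
  no reference to the classes and is therefore shared by all rotated and swapped instances.\<close>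

definition Th :: "real \<Rightarrow> 'a \<Rightarrow> real" where "Th \<delta> v = (\<Sum>u\<in>V. m u * th \<delta> v u) / 2"

text \<open>Equal degrees into both other classes enter here: the two instances of
  \<open>weighted_load_sum\<close> agree except for the regularising term, whose factor
  \<open>\<delta>\<close> is positive and cancels.\<close>

lemma Th_eq:
  assumes \<delta>: "0 < \<delta>" and x: "x \<in> X"
  shows "(\<Sum>y\<in>Y. th \<delta> x y / (1 - s y)) = Th \<delta> x"
proof -
  interpret r: balanced_tripartite V X Z Y E s n by (rule swap)
  have "(\<Sum>z\<in>Z. \<Sum>y\<in>Y. adj x z * adj x y * adj z y * m z * m y * (th \<delta> x z + th \<delta> x y + th \<delta> z y))
    = (\<Sum>y\<in>Y. \<Sum>z\<in>Z. adj x y * adj x z * adj y z * m y * m z * (th \<delta> x y + th \<delta> x z + th \<delta> y z))"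
    by (subst sum.swap) (simp add: adj_sym[of _ y for y] th_sym[of \<delta> _ y for y] mult_ac add_ac)
  then have "\<delta> * (\<Sum>y\<in>Y. m y * th \<delta> x y) = \<delta> * (\<Sum>z\<in>Z. m z * th \<delta> x z)"
    using weighted_load_sum[OF assms] r.weighted_load_sum[OF assms] by linarith
  then have eq: "(\<Sum>y\<in>Y. m y * th \<delta> x y) = (\<Sum>z\<in>Z. m z * th \<delta> x z)" using \<delta> by simp
  have "(\<Sum>u\<in>X. m u * th \<delta> x u) = 0"
    using edge_cross x by (intro sum.neutral) (auto simp: th_def adj_def)
  moreover have "(\<Sum>u\<in>V. m u * th \<delta> x u) = (\<Sum>u\<in>X. m u * th \<delta> x u) + (\<Sum>y\<in>Y. m y * th \<delta> x y) + (\<Sum>z\<in>Z. m z * th \<delta> x z)"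
    unfolding V_eq using fin_classes disjoint by (subst sum.union_disjoint; (subst sum.union_disjoint)?; auto)
  ultimately have "Th \<delta> x = (\<Sum>y\<in>Y. m y * th \<delta> x y)" unfolding Th_def eq by simp
  then show ?thesis by (simp add: m_def)
qed

section \<open>Continuation in the regularisation parameter\<close>

lemma potential:
  assumes \<delta>: "0 < \<delta>" and le: "\<And>v. v \<in> V \<Longrightarrow> Th \<delta> v \<le> 1/2 - s v"
  shows "tripartite_potential X Y Z adj n s (th \<delta>) (Th \<delta>) \<delta>"
proof -
  interpret r: balanced_tripartite V Y Z X E s n by (rule rotate)
  interpret r2: balanced_tripartite V Z X Y E s n by (rule r.rotate)
  interpret w: balanced_tripartite V X Z Y E s n by (rule swap)
  interpret rw: balanced_tripartite V Y X Z E s n by (rule r.swap)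
  interpret r2w: balanced_tripartite V Z Y X E s n by (rule r2.swap)
  have adj_deg: "\<And>x. x \<in> X \<Longrightarrow> (\<Sum>y\<in>Y. adj x y) = n * (4/5 + s x)"
    "\<And>x. x \<in> X \<Longrightarrow> (\<Sum>z\<in>Z. adj x z) = n * (4/5 + s x)"
    "\<And>y. y \<in> Y \<Longrightarrow> (\<Sum>x\<in>X. adj y x) = n * (4/5 + s y)"
    "\<And>y. y \<in> Y \<Longrightarrow> (\<Sum>z\<in>Z. adj y z) = n * (4/5 + s y)"
    "\<And>z. z \<in> Z \<Longrightarrow> (\<Sum>x\<in>X. adj z x) = n * (4/5 + s z)"
    "\<And>z. z \<in> Z \<Longrightarrow> (\<Sum>y\<in>Y. adj z y) = n * (4/5 + s z)"
    using fin_classes by (simp_all only: adj_degree degree)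
  show ?thesis
  proof
    show "real (card X) = n" "real (card Y) = n" "real (card Z) = n" using cards by simp_all
    show "0 < real n" using n_pos by simp
    show "adj u v = 0 \<or> adj u v = 1" for u v by (simp add: adj_def)
    show "adj u v * th \<delta> u v = th \<delta> u v" for u v by (simp add: th_def adj_def)
    show "Th \<delta> v \<le> 1/2 - s v" if "v \<in> X \<union> Y \<union> Z" for v using le that V_eq by blast
  qed (rule fin_classes \<delta> adj_sym th_sym s_nonneg s_le adj_deg load[OF \<delta>] r.load[OF \<delta>] r2.load[OF \<delta>]
      Th_eq[OF \<delta>] r.Th_eq[OF \<delta>] r2.Th_eq[OF \<delta>] w.Th_eq[OF \<delta>] rw.Th_eq[OF \<delta>] r2w.Th_eq[OF \<delta>]; assumption)+
qed

lemma no_contact: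
  assumes "0 < \<delta>" and "\<And>v. v \<in> V \<Longrightarrow> Th \<delta> v \<le> 1/2 - s v" and "v \<in> V"
  shows "Th \<delta> v \<noteq> 1/2 - s v"
proof -
  interpret p: tripartite_potential X Y Z adj n s "th \<delta>" "Th \<delta>" \<delta> by (rule potential[OF assms(1,2)])
  interpret pr: tripartite_potential Y Z X adj n s "th \<delta>" "Th \<delta>" \<delta> by (rule p.rotate)
  interpret pr2: tripartite_potential Z X Y adj n s "th \<delta>" "Th \<delta>" \<delta> by (rule pr.rotate)
  show ?thesis using assms(3) p.no_critical_vertex pr.no_critical_vertex pr2.no_critical_vertex V_eq by blast
qed

lemma Th_continuous: "continuous_on {0<..} (\<lambda>\<delta>. Th \<delta> v)"
proof -
  have "continuous_on {0<..} (\<lambda>\<delta>. th \<delta> v u)" for u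
  proof (cases "{v, u} \<in> E")
    case True
    then show ?thesis using sol_continuous by (simp add: th_def adj_def)
  qed (simp add: th_def adj_def)
  then show ?thesis unfolding Th_def by (intro continuous_intros) auto
qed

lemma Th_tendsto_0: "((\<lambda>\<delta>. Th \<delta> v) \<longlongrightarrow> 0) at_top"
proof -
  have "((\<lambda>\<delta>. th \<delta> v u) \<longlongrightarrow> 0) at_top" for u
  proof (cases "{v, u} \<in> E")
    case True
    then show ?thesis using sol_tendsto_0 by (simp add: th_def adj_def)
  qed (simp add: th_def adj_def)
  then have "((\<lambda>\<delta>. (\<Sum>u\<in>V. m u * th \<delta> v u) / 2) \<longlongrightarrow> (\<Sum>u\<in>V. m u * 0) / 2) at_top"
    by (intro tendsto_intros) auto
  then show ?thesis by (simp add: Th_def)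
qed

text \<open>For large parameters all values lie below \<open>3/10\<close>, the least possible value
  of \<open>1/2 - s v\<close>. A violation at \<open>\<delta>\<close> would yield some
  \<open>t \<ge> \<delta>\<close> with the bound everywhere and equality at one vertex, which
  \<open>no_contact\<close> excludes.\<close>

lemma Th_le:
  assumes "0 < \<delta>" "v0 \<in> V"
  shows "Th \<delta> v0 \<le> 1/2 - s v0"
proof (rule ccontr)
  assume not_le: "\<not> ?thesis"
  have "\<forall>\<^sub>F t in at_top. Th t v < 3/10" for v
    using Th_tendsto_0 by (rule order_tendstoD) simp
  then have "\<forall>\<^sub>F t in at_top. \<delta> \<le> t \<and> (\<forall>v\<in>V. Th t v < 3/10)"
    using fin_V by (intro eventually_conj eventually_ge_at_top eventually_ball_finite) auto
  then obtain b where b: "\<delta> \<le> b" "\<And>v. v \<in> V \<Longrightarrow> Th b v < 3/10"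
    using eventually_happens'[OF trivial_limit_at_top_linorder] by blast
  have "\<exists>t\<in>{\<delta>..b}. (\<forall>v\<in>V. 0 \<le> 1/2 - s v - Th t v) \<and> (\<exists>v\<in>V. 1/2 - s v - Th t v = 0)"
  proof (rule first_contact[OF fin_V b(1)])
    show "continuous_on {\<delta>..b} (\<lambda>t. 1/2 - s v - Th t v)" for v
      using assms by (intro continuous_intros continuous_on_subset[OF Th_continuous]) auto
    show "0 < 1/2 - s v - Th b v" if "v \<in> V" for v
      using b(2)[OF that] s_le[of v] by simp
  qed (use not_le assms in auto)
  then obtain t v where t: "\<delta> \<le> t" "\<And>v. v \<in> V \<Longrightarrow> Th t v \<le> 1/2 - s v" "v \<in> V" "Th t v = 1/2 - s v"
    by force
  then show False using no_contact[of t v] assms by simp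
qed

text \<open>The upper bound does not depend on \<open>\<delta>\<close>, which is what the passage to
  the limit requires.\<close>

lemma th_bounds:
  assumes \<delta>: "0 < \<delta>" and xy: "x \<in> X" "y \<in> Y"
  shows "0 \<le> th \<delta> x y \<and> th \<delta> x y \<le> 5/3"
proof -
  interpret p: tripartite_potential X Y Z adj n s "th \<delta>" "Th \<delta>" \<delta>
    using potential[OF \<delta>] Th_le[OF \<delta>] by blast
  have nn: "0 \<le> th \<delta> x y" by (rule p.th_nonneg(1)[OF xy])
  have "3/5 * th \<delta> x y \<le> n * (3/5) * th \<delta> x y"
    using nn n_pos by (intro mult_right_mono) auto
  also have "\<dots> \<le> (1 - s x) * (1 - s y)" by (rule p.th_le[OF xy])
  also have "\<dots> \<le> 1 * 1" using s_nonneg s_le[of x] s_le[of y] by (intro mult_mono) auto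
  finally show ?thesis using nn by simp
qed

lemma sol_bounds:
  assumes \<delta>: "0 < \<delta>" and e: "e \<in> E"
  shows "0 \<le> sol \<delta> e \<and> sol \<delta> e \<le> 5/3"
proof -
  interpret r: balanced_tripartite V Y Z X E s n by (rule rotate)
  interpret r2: balanced_tripartite V Z X Y E s n by (rule r.rotate)
  have "\<exists>u v. e = {u, v} \<and> 0 \<le> th \<delta> u v \<and> th \<delta> u v \<le> 5/3"
    using edge_cases[OF e] th_bounds[OF \<delta>] r.th_bounds[OF \<delta>] r2.th_bounds[OF \<delta>] by metis
  then show ?thesis using e by (auto simp: th_def adj_def)
qed

lemma decomposition_exists: "\<exists>w. fractional_triangle_decomposition V E w"
proof -
  obtain f where nn: "\<And>e. e \<in> E \<Longrightarrow> 0 \<le> f e" and eq: "\<And>e. e \<in> E \<Longrightarrow> (\<Sum>e'\<in>E. gram e e' * f e') = 1"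
    using nonneg_solution_limit[OF sol_bounds] by blast
  have "0 \<le> prod_m T * sum f (triangle_edges T)" if "T \<in> triangles V E" for T
    using that nn prod_m_pos[of T] by (intro mult_nonneg_nonneg sum_nonneg) (auto simp: triangles_def)
  then have "fractional_triangle_decomposition V E (\<lambda>T. prod_m T * sum f (triangle_edges T))"
    unfolding fractional_triangle_decomposition_def using eq by (simp add: gram_apply)
  then show ?thesis by blast
qed

end

theorem theorem1p1:
  fixes V X Y Z :: "'a set" and E :: "'a set set" and n :: nat
  assumes "simple_graph V E"
    and "tripartite V E X Y Z"
    and "card X = n" and "card Y = n" and "card Z = n"
    and "triangle_divisible E X Y Z"
    and "real (partite_min_degree E X Y Z) \<ge> 4 * real n / 5"
  shows "\<exists>w. fractional_triangle_decomposition V E w"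
proof -
  have V: "V = X \<union> Y \<union> Z" and disj: "X \<inter> Y = {}" "X \<inter> Z = {}" "Y \<inter> Z = {}"
    using assms(2) by (auto simp: tripartite_def)
  have fin: "finite X" "finite Y" "finite Z" using assms(1) V by (auto simp: simple_graph_def)
  have edges: "\<exists>U\<in>{X, Y, Z}. \<exists>W\<in>{X, Y, Z}. U \<noteq> W \<and> (\<exists>u\<in>U. \<exists>w\<in>W. e = {u, w})" if "e \<in> E" for e
    using assms(2) that by (auto simp: tripartite_def)
  show ?thesis
  \<comment> \<open>With empty classes \<open>partite_min_degree\<close> is an unspecified number;
    there are then no edges, and zero weights suffice.\<close>
  proof (cases "n = 0")
    case True
    then have "V = {}" using fin assms(3-5) V by simp
    then have "E = {}" using assms(1) by (force simp: simple_graph_def)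
    then have "fractional_triangle_decomposition V E (\<lambda>_. 0)"
      by (simp add: fractional_triangle_decomposition_def)
    then show ?thesis by blast
  next
    case False
    \<comment> \<open>Disjoint classes of positive size are different sets, so the condition
      \<open>U \<noteq> W\<close> in the minimum degree admits every pair of classes.\<close>
    then have distinct: "X \<noteq> Y" "X \<noteq> Z" "Y \<noteq> Z" using disj assms(3-5) by auto
    let ?D = "{degree_in E v W | U W v. U \<in> {X, Y, Z} \<and> W \<in> {X, Y, Z} \<and> U \<noteq> W \<and> v \<in> U}"
    have "?D \<subseteq> (\<lambda>(v, W). degree_in E v W) ` (V \<times> {X, Y, Z})" using V by force
    then have fin_D: "finite ?D" using fin V by (elim finite_subset) simp
    have min: "4/5 * real n \<le> degree_in E v W"
      if "U \<in> {X, Y, Z}" "W \<in> {X, Y, Z}" "U \<noteq> W" "v \<in> U" for U W v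
    proof -
      have "degree_in E v W \<in> ?D" using that by blast
      then have "partite_min_degree E X Y Z \<le> degree_in E v W"
        unfolding partite_min_degree_def by (rule Min_le[OF fin_D])
      then show ?thesis using assms(7) by linarith
    qed
    have max: "degree_in E v W \<le> n" if "W \<in> {X, Y, Z}" for v W
    proof -
      have "finite W" "card W = n" using that fin assms(3-5) by auto
      then show ?thesis unfolding degree_in_def by (metis (no_types, lifting) card_mono mem_Collect_eq subsetI)
    qed
    \<comment> \<open>The degree into one chosen class not containing \<open>v\<close>; divisibility
      gives the same number for the other class.\<close>
    define d where "d v = degree_in E v (if v \<in> X then Y else X)" for v
    \<comment> \<open>The default \<open>0\<close> outside \<open>V\<close> provides the bounds on
      \<open>s\<close> at all points of the type.\<close>
    define s where "s v = (if v \<in> V then real (d v) / n - 4/5 else 0)" for v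
    have d_ge: "4/5 * real n \<le> d v" if "v \<in> V" for v
      using that min[of X Y v] min[of Y X v] min[of Z X v] distinct disj V by (auto simp: d_def)
    have d_le: "d v \<le> n" for v using max by (simp add: d_def)
    have deg: "real (d v) = n * (4/5 + s v)" if "v \<in> V" for v
      using that False by (simp add: s_def)
    have div: "\<And>x. x \<in> X \<Longrightarrow> degree_in E x Y = d x" "\<And>x. x \<in> X \<Longrightarrow> degree_in E x Z = d x"
      "\<And>y. y \<in> Y \<Longrightarrow> degree_in E y X = d y" "\<And>y. y \<in> Y \<Longrightarrow> degree_in E y Z = d y"
      "\<And>z. z \<in> Z \<Longrightarrow> degree_in E z X = d z" "\<And>z. z \<in> Z \<Longrightarrow> degree_in E z Y = d z"
      using assms(6) disj by (auto simp: triangle_divisible_def d_def)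
    interpret balanced_tripartite V X Y Z E s n
    proof
      show "(\<exists>x\<in>X. \<exists>y\<in>Y. e = {x, y}) \<or> (\<exists>y\<in>Y. \<exists>z\<in>Z. e = {y, z}) \<or> (\<exists>z\<in>Z. \<exists>x\<in>X. e = {z, x})"
        if e: "e \<in> E" for e
      proof -
        obtain U W u w where "U \<in> {X, Y, Z}" "W \<in> {X, Y, Z}" "U \<noteq> W" "u \<in> U" "w \<in> W" "e = {u, w}"
          using edges[OF e] by blast
        moreover have "e = {w, u}" using \<open>e = {u, w}\<close> by (simp add: insert_commute)
        ultimately show ?thesis by blast
      qed
      show "0 \<le> s v" for v using d_ge[of v] False by (simp add: s_def field_simps)
      show "s v \<le> 1/5" for v using d_le[of v] False by (simp add: s_def field_simps)
      show "0 < n" using False by simp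
    qed (use fin assms(3-5) disj V deg div in simp_all)
    show ?thesis by (rule decomposition_exists)
  qed
qed

end
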